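(* Let $M, M' \subset \mathbb{C}^N$ be smooth generic submanifolds of the same dimension through $p$ and $p'$ respectively, and let $H: (\mathbb{C}^N, p) \to (\mathbb{C}^N,p')$ be a germ of a holomorphic mapping such that $H(M) \subset M'$ (as germs at $p$ and $p'$). Assume that $M$ is of finite type at $p$ and that $\operatorname{Jac} H \not\equiv 0$. Then $H$ is CR transversal to $M'$ at $p$.
   Context: A smooth real submanifold $M\subset\mathbb{C}^N$ of real codimension $d$ is generic if near every point of $M$ it is defined by an equation $\rho(Z,\bar Z)=0$, where $\rho=(\rho_1,\dots,\rho_d)$ is a smooth $\mathbb{R}^d$-valued function with $\partial\rho_1\wedge\cdots\wedge\partial\rho_d\neq 0$. Its CR bundle is $T^{0,1}M=\mathbb{C}TM\cap T^{0,1}\mathbb{C}^N$, and $T^{1,0}M=\overline{T^{0,1}M}$; sections of $T^{0,1}M$ are called CR (or $(0,1)$) vector fields. $M$ is of finite type at $p\in M$ (in the sense of Kohn and Bloom--Graham) if the complex Lie algebra $\mathfrak{g}_M$ generated by all smooth CR vector fields on $M$ (near $p$) and their conjugates satisfies $\mathfrak{g}_M(p)=\mathbb{C}T_pM$. $\operatorname{Jac}H$ denotes the (holomorphic) Jacobian determinant of $H$, and $\not\equiv 0$ means not identically zero near $p$. $H$ is CR transversal to $M'$ at $p$ (where $p'=H(p)\in M'$) if $T^{1,0}_{p'}M'+dH(T^{1,0}_p\mathbb{C}^N)=T^{1,0}_{p'}\mathbb{C}^N$. *)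

theory Defs
  imports "HOL-Analysis.Analysis"
begin

text \<open>Smoothness on an open set, by iterated Frechet derivatives over the reals. For a set that
  is not open the definition is not meaningful; it is only used on open sets.\<close>

fun Ck_on :: "nat \<Rightarrow> 'a::real_normed_vector set \<Rightarrow> ('a \<Rightarrow> 'b::real_normed_vector) \<Rightarrow> bool" where
  "Ck_on 0 U f \<longleftrightarrow> continuous_on U f"
| "Ck_on (Suc k) U f \<longleftrightarrow> f differentiable_on U \<and>
     (\<forall>v. Ck_on k U (\<lambda>x. frechet_derivative f (at x) v))"

definition smooth_on :: "'a::real_normed_vector set \<Rightarrow> ('a \<Rightarrow> 'b::real_normed_vector) \<Rightarrow> bool" where
  "smooth_on U f \<longleftrightarrow> (\<forall>k. Ck_on k U f)"

text \<open>\<open>frechet_derivative f (at q)\<close> is the real differential, so \<open>axis j 1\<close> and \<open>axis j \<i>\<close> are the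
  directions of the real coordinates \<open>x\<^sub>j\<close> and \<open>y\<^sub>j\<close>, where \<open>z\<^sub>j = x\<^sub>j + \<i> y\<^sub>j\<close>.\<close>

definition d_z :: "'n \<Rightarrow> (complex^'n::finite \<Rightarrow> complex) \<Rightarrow> complex^'n \<Rightarrow> complex" where
  "d_z j f q = (frechet_derivative f (at q) (axis j 1)
                - \<i> * frechet_derivative f (at q) (axis j \<i>)) / 2"

definition d_zbar :: "'n \<Rightarrow> (complex^'n::finite \<Rightarrow> complex) \<Rightarrow> complex^'n \<Rightarrow> complex" where
  "d_zbar j f q = (frechet_derivative f (at q) (axis j 1)
                   + \<i> * frechet_derivative f (at q) (axis j \<i>)) / 2"

text \<open>Complexified tangent vectors of complex N-space at a point: the pair \<open>(b, a)\<close> stands for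
  \<open>\<Sum>j. b\<^sub>j \<partial>/\<partial>z\<^sub>j + a\<^sub>j \<partial>/\<partial>zbar\<^sub>j\<close>. In these coordinates the spaces of (1,0) and (0,1)
  vectors do not depend on the base point.\<close>

type_synonym 'n ctvec = "(complex^'n) \<times> (complex^'n)"

definition vcnj :: "complex^'n::finite \<Rightarrow> complex^'n" where
  "vcnj v = (\<chi> j. cnj (v $ j))"

definition ct_scale :: "complex \<Rightarrow> 'n::finite ctvec \<Rightarrow> 'n ctvec" where
  "ct_scale c X = (c *s fst X, c *s snd X)"

definition ct_cnj :: "'n::finite ctvec \<Rightarrow> 'n ctvec" where
  "ct_cnj X = (vcnj (snd X), vcnj (fst X))"

text \<open>The real tangent vector \<open>v\<close>, as an element of the complexified tangent space.\<close>

definition ct_of_real :: "complex^'n::finite \<Rightarrow> 'n ctvec" where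
  "ct_of_real v = (v, vcnj v)"

definition T10 :: "'n::finite ctvec set" where
  "T10 = {X. snd X = 0}"

definition T01 :: "'n::finite ctvec set" where
  "T01 = {X. fst X = 0}"

definition ct_apply :: "'n::finite ctvec \<Rightarrow> (complex^'n \<Rightarrow> complex) \<Rightarrow> complex^'n \<Rightarrow> complex" where
  "ct_apply X f q = (\<Sum>j\<in>UNIV. fst X $ j * d_z j f q + snd X $ j * d_zbar j f q)"

text \<open>The complexified differential of a map \<open>H\<close> at \<open>q\<close>.\<close>

definition ct_diff :: "(complex^'n \<Rightarrow> complex^'m) \<Rightarrow> complex^'n \<Rightarrow> 'n::finite ctvec \<Rightarrow> 'm::finite ctvec" where
  "ct_diff H q X = (\<chi> i. ct_apply X (\<lambda>z. H z $ i) q, \<chi> i. ct_apply X (\<lambda>z. cnj (H z $ i)) q)"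

definition lie_bracket ::
    "(complex^'n \<Rightarrow> 'n::finite ctvec) \<Rightarrow> (complex^'n \<Rightarrow> 'n ctvec) \<Rightarrow> complex^'n \<Rightarrow> 'n ctvec" where
  "lie_bracket X Y q =
     (\<chi> i. ct_apply (X q) (\<lambda>z. fst (Y z) $ i) q - ct_apply (Y q) (\<lambda>z. fst (X z) $ i) q,
      \<chi> i. ct_apply (X q) (\<lambda>z. snd (Y z) $ i) q - ct_apply (Y q) (\<lambda>z. snd (X z) $ i) q)"

text \<open>The (1,0)-form \<open>\<partial>r\<close> of a real-valued function \<open>r\<close>, evaluated on \<open>\<Sum>j. v\<^sub>j \<partial>/\<partial>z\<^sub>j\<close>.\<close>

definition del :: "(complex^'n::finite \<Rightarrow> real) \<Rightarrow> complex^'n \<Rightarrow> complex^'n \<Rightarrow> complex" where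
  "del r q v = (\<Sum>j\<in>UNIV. d_z j (\<lambda>z. complex_of_real (r z)) q * v $ j)"

text \<open>The exterior product of the covectors \<open>\<alpha> 0, \<dots>, \<alpha> (d - 1)\<close> evaluated at
  \<open>v 0, \<dots>, v (d - 1)\<close>, that is, the determinant of \<open>\<alpha> i (v j)\<close>. For \<open>d = 0\<close> it is 1.\<close>

definition wedge :: "nat \<Rightarrow> (nat \<Rightarrow> 'v \<Rightarrow> complex) \<Rightarrow> (nat \<Rightarrow> 'v) \<Rightarrow> complex" where
  "wedge d \<alpha> v =
     (\<Sum>\<pi> | \<pi> permutes {..<d}. of_int (sign \<pi>) * (\<Prod>i<d. \<alpha> i (v (\<pi> i))))"

text \<open>Generic submanifolds of real codimension \<open>d\<close>. Linear independence of the real differentials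
  of the \<open>\<rho> i\<close>, hence that \<open>M\<close> is a submanifold of codimension \<open>d\<close>, follows from the condition on
  the exterior product, because the \<open>\<rho> i\<close> are real-valued.\<close>

definition generic_submanifold :: "nat \<Rightarrow> (complex^'n::finite) set \<Rightarrow> bool" where
  "generic_submanifold d M \<longleftrightarrow>
     (\<forall>q\<in>M. \<exists>U (\<rho> :: nat \<Rightarrow> complex^'n \<Rightarrow> real). open U \<and> q \<in> U \<and>
        (\<forall>i<d. smooth_on U (\<rho> i)) \<and>
        M \<inter> U = {z\<in>U. \<forall>i<d. \<rho> i z = 0} \<and>
        (\<forall>z\<in>M \<inter> U. wedge d (\<lambda>i. del (\<rho> i) z) \<noteq> (\<lambda>v. 0)))"

text \<open>The real tangent space: velocities of smooth curves in \<open>M\<close>.\<close>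

definition tangent_space :: "(complex^'n::finite) set \<Rightarrow> complex^'n \<Rightarrow> (complex^'n) set" where
  "tangent_space M q =
     {v. \<exists>\<epsilon>>0. \<exists>\<gamma> :: real \<Rightarrow> complex^'n. smooth_on {-\<epsilon><..<\<epsilon>} \<gamma> \<and>
           \<gamma> ` {-\<epsilon><..<\<epsilon>} \<subseteq> M \<and> \<gamma> 0 = q \<and> (\<gamma> has_vector_derivative v) (at 0)}"

definition CT :: "(complex^'n::finite) set \<Rightarrow> complex^'n \<Rightarrow> 'n ctvec set" where
  "CT M q = {ct_of_real v + ct_scale \<i> (ct_of_real w) | v w.
               v \<in> tangent_space M q \<and> w \<in> tangent_space M q}"

definition T01_of :: "(complex^'n::finite) set \<Rightarrow> complex^'n \<Rightarrow> 'n ctvec set" where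
  "T01_of M q = CT M q \<inter> T01"

definition T10_of :: "(complex^'n::finite) set \<Rightarrow> complex^'n \<Rightarrow> 'n ctvec set" where
  "T10_of M q = ct_cnj ` T01_of M q"

text \<open>A smooth CR vector field on \<open>M\<close> near \<open>p\<close> is represented by a smooth extension to a
  neighbourhood of \<open>p\<close> in the ambient space. Values outside the neighbourhood are irrelevant.\<close>

definition cr_field_near ::
    "(complex^'n::finite) set \<Rightarrow> complex^'n \<Rightarrow> (complex^'n \<Rightarrow> 'n ctvec) \<Rightarrow> bool" where
  "cr_field_near M p X \<longleftrightarrow>
     (\<exists>U. open U \<and> p \<in> U \<and> smooth_on U X \<and> (\<forall>q\<in>M \<inter> U. X q \<in> T01_of M q))"

text \<open>The complex Lie algebra generated by the CR vector fields near \<open>p\<close> and their conjugates.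
  All its members are tangent to \<open>M\<close> near \<open>p\<close>, so the values of brackets on \<open>M\<close> do not depend on
  the chosen extensions.\<close>

inductive_set cr_lie_algebra ::
    "(complex^'n::finite) set \<Rightarrow> complex^'n \<Rightarrow> (complex^'n \<Rightarrow> 'n ctvec) set"
  for M p where
  cr: "cr_field_near M p X \<Longrightarrow> X \<in> cr_lie_algebra M p"
| cr_cnj: "cr_field_near M p X \<Longrightarrow> (\<lambda>q. ct_cnj (X q)) \<in> cr_lie_algebra M p"
| add: "X \<in> cr_lie_algebra M p \<Longrightarrow> Y \<in> cr_lie_algebra M p \<Longrightarrow>
    (\<lambda>q. X q + Y q) \<in> cr_lie_algebra M p"
| scale: "X \<in> cr_lie_algebra M p \<Longrightarrow> (\<lambda>q. ct_scale c (X q)) \<in> cr_lie_algebra M p"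
| bracket: "X \<in> cr_lie_algebra M p \<Longrightarrow> Y \<in> cr_lie_algebra M p \<Longrightarrow>
    lie_bracket X Y \<in> cr_lie_algebra M p"

definition finite_type_at :: "(complex^'n::finite) set \<Rightarrow> complex^'n \<Rightarrow> bool" where
  "finite_type_at M p \<longleftrightarrow> (\<lambda>X. X p) ` cr_lie_algebra M p = CT M p"

text \<open>Holomorphy in several variables: the real derivative exists and is complex linear.\<close>

definition holomorphic_map_on :: "(complex^'n::finite) set \<Rightarrow> (complex^'n \<Rightarrow> complex^'m::finite) \<Rightarrow> bool" where
  "holomorphic_map_on U H \<longleftrightarrow>
     (\<forall>z\<in>U. \<exists>A :: complex^'n^'m. (H has_derivative (\<lambda>v. A *v v)) (at z))"

definition Jac :: "(complex^'n::finite \<Rightarrow> complex^'n) \<Rightarrow> complex^'n \<Rightarrow> complex" where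
  "Jac H z = det (\<chi> i j. d_z j (\<lambda>w. H w $ i) z)"

definition cr_transversal_at ::
    "(complex^'n::finite \<Rightarrow> complex^'n) \<Rightarrow> (complex^'n) set \<Rightarrow> complex^'n \<Rightarrow> bool" where
  "cr_transversal_at H M' p \<longleftrightarrow>
     {X + Y | X Y. X \<in> T10_of M' (H p) \<and> Y \<in> ct_diff H p ` T10} = T10"

end

theory Submission
  imports Defs "HOL-Complex_Analysis.Cauchy_Integral_Formula" "HOL-Library.List_Lexorder"
begin

text \<open>
  Along \<open>M\<close> the characteristic forms of \<open>M'\<close> pull back under \<open>H\<close> to combinations of those of \<open>M\<close>, with
  a real coefficient matrix \<open>A\<close>; let \<open>D = det A\<close>. The map \<open>H\<close> is CR transversal at \<open>p\<close> if \<open>D p \<noteq> 0\<close>.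
  In moving frames the matrix of \<open>dH\<close> on (1,0) vectors is block triangular with diagonal block \<open>A\<close>, so
  \<open>Jac H = D e\<close> on \<open>M\<close> for some smooth \<open>e\<close>, and also \<open>cnj (Jac H) = D (cnj e)\<close> because \<open>D\<close> is real.

  Attach to a smooth function \<open>f\<close> the family of numbers \<open>(X\<^sub>k \<dots> X\<^sub>1 f)(p)\<close>, indexed by the words in CR
  vector fields and their conjugates. By the Leibniz rule a product of functions becomes a shuffle
  product. Finite type and \<open>Jac H \<noteq> 0\<close> imply that some word does not vanish on \<open>Jac H\<close>, but every word
  in which a CR field acts first vanishes on it. Order the letters so that CR fields are the largest and compare
  lexicographically largest words among the shortest words that do not vanish: no shortest word of
  \<open>D\<close> begins with a CR field. By conjugation none begins with a conjugate field either, so the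
  shortest word of \<open>D\<close> is empty, which says \<open>D p \<noteq> 0\<close>.
\<close>

section \<open>Shuffle products\<close>

text \<open>The obstacle is that \<open>D\<close> is merely smooth: that \<open>D e\<close>
  restricts to a holomorphic function which is not identically zero does not by itself prevent
  \<open>D\<close> from vanishing at \<open>p\<close>. Words turn smooth germs into coefficient
  functions of noncommutative series, where leading words multiply. The order of action is
  essential: a CR field kills \<open>Jac H\<close> if it acts before all other letters, but not
  after a conjugate field, because the bracket of the two need not kill it. This is why words are
  compared from the letter that acts first. Reality of \<open>D\<close> supplies the second
  relation; with one relation alone a shortest word of \<open>D\<close> could still begin with a
  conjugate field. Finitely many letters suffice, those of one word that does not vanish on
  \<open>Jac H\<close> together with their conjugates, and finiteness makes the maximal words exist.
  Finite type enters once: the functions on which all words vanish are stable under the whole Lie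
  algebra, whose (1,0) parts at \<open>p\<close> fill the space by genericity, so a holomorphic
  function among them has zero Taylor series at \<open>p\<close>.\<close>

fun splits :: "'c list \<Rightarrow> ('c list \<times> 'c list) list" where
  "splits [] = [([], [])]"
| "splits (x # w) = map (\<lambda>(a, b). (x # a, b)) (splits w) @ map (\<lambda>(a, b). (a, x # b)) (splits w)"

lemma splits_length: "(a, b) \<in> set (splits w) \<Longrightarrow> length a + length b = length w"
  by (induction w arbitrary: a b) auto

lemma splits_set: "(a, b) \<in> set (splits w) \<Longrightarrow> set w = set a \<union> set b"
  by (induction w arbitrary: a b) fastforce+

lemma splits_lists: "(a, b) \<in> set (splits w) \<Longrightarrow> w \<in> lists A \<Longrightarrow> a \<in> lists A \<and> b \<in> lists A"
  and splits_in_lists: "(a, b) \<in> set (splits w) \<Longrightarrow> a \<in> lists A \<Longrightarrow> b \<in> lists A \<Longrightarrow> w \<in> lists A"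
  by (auto dest: splits_set)

lemma splits_append: "(a, b) \<in> set (splits (a @ b))"
proof (induction a)
  case Nil
  show ?case by (induction b) force+
next
  case (Cons x a)
  then show ?case by force
qed

lemma splits_map:
  "splits (map f w) = map (\<lambda>(a, b). (map f a, map f b)) (splits w)"
  by (induction w) (auto simp: case_prod_unfold)

text \<open>Refilling the positions of \<open>a\<close> and \<open>b\<close> in \<open>w\<close> by the lexicographically larger \<open>u\<close> and \<open>v\<close>.\<close>
lemma splits_mono:
  fixes w :: "nat list"
  assumes "(a, b) \<in> set (splits w)" "length a = length u" "length b = length v" "a \<le> u" "b \<le> v"
  shows "\<exists>w'. (u, v) \<in> set (splits w') \<and> w \<le> w' \<and> (w = w' \<longrightarrow> a = u \<and> b = v)"
  using assms
proof (induction w arbitrary: a b u v)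
  case Nil
  then show ?case by (intro exI[of _ "[]"]) auto
next
  case (Cons x w)
  from Cons.prems(1) consider a' where "a = x # a'" "(a', b) \<in> set (splits w)"
    | b' where "b = x # b'" "(a, b') \<in> set (splits w)"
    by auto
  then show ?case
  proof cases
    case 1
    then obtain y u' where u: "u = y # u'" using Cons.prems(2) by (cases u) auto
    show ?thesis
    proof (cases "x = y")
      case True
      then have "a' \<le> u'" using Cons.prems 1 u by auto
      then obtain w' where w': "(u', v) \<in> set (splits w')" "w \<le> w'" "w = w' \<longrightarrow> a' = u' \<and> b = v"
        using Cons.IH[OF 1(2), of u' v] Cons.prems 1 u by auto
      then show ?thesis using True 1 u by (intro exI[of _ "x # w'"]) force
    next
      case False
      \<comment> \<open>The first letter already grows strictly, so the tail may be any shuffle of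
        what remains; concatenation is one.\<close>
      then have "x < y" using Cons.prems 1 u by auto
      moreover have "(u, v) \<in> set (splits (y # (u' @ v)))"
        using splits_append[of u' v] u by force
      ultimately show ?thesis by (intro exI[of _ "y # (u' @ v)"]) auto
    qed
  next
    case 2
    then obtain y v' where v: "v = y # v'" using Cons.prems(3) by (cases v) auto
    show ?thesis
    proof (cases "x = y")
      case True
      then have "b' \<le> v'" using Cons.prems 2 v by auto
      then obtain w' where w': "(u, v') \<in> set (splits w')" "w \<le> w'" "w = w' \<longrightarrow> a = u \<and> b' = v'"
        using Cons.IH[OF 2(2), of u v'] Cons.prems 2 v by auto
      then show ?thesis using True 2 v by (intro exI[of _ "x # w'"]) force
    next
      case False
      then have "x < y" using Cons.prems 2 v by auto
      moreover have "(u, v) \<in> set (splits (y # (u @ v')))"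
        using splits_append[of u v'] v by force
      ultimately show ?thesis by (intro exI[of _ "y # (u @ v')"]) auto
    qed
  qed
qed

lemma finite_lists_length: "finite A \<Longrightarrow> finite {w \<in> lists A. length w = n}"
  using finite_lists_length_eq[of A n] by (simp add: lists_eq_set)

lemma splits_finite_inv: "finite {w. (u, v) \<in> set (splits w)}"
proof (rule finite_subset)
  show "{w. (u, v) \<in> set (splits w)} \<subseteq> {w \<in> lists (set u \<union> set v). length w = length u + length v}"
    using splits_length splits_in_lists[of u v _ "set u \<union> set v"] by fastforce
qed (auto intro: finite_lists_length)

text \<open>The sum runs over a list, not a set: a pair \<open>(a, b)\<close> that arises from
  several choices of positions counts each time, exactly as in an iterated Leibniz rule.\<close>

definition shuffle_product :: "('c list \<Rightarrow> complex) \<Rightarrow> ('c list \<Rightarrow> complex) \<Rightarrow> 'c list \<Rightarrow> complex" where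
  "shuffle_product f g w = (\<Sum>(a, b)\<leftarrow>splits w. f a * g b)"

text \<open>With repeated letters the leading pair can occur several times. Its multiplicity is a
  positive integer, so in characteristic zero the occurrences cannot cancel.\<close>

lemma sum_list_single:
  fixes c :: complex
  assumes "\<And>y. y \<in> set xs \<Longrightarrow> y = z \<or> f y = 0" "z \<in> set xs"
  shows "\<exists>n>0. sum_list (map f xs) = of_nat n * f z"
proof -
  have "sum_list (map f xs) = of_nat (count_list xs z) * f z"
    using assms(1)
  proof (induction xs)
    case (Cons x xs)
    then have "f x = 0 \<or> x = z" "sum_list (map f xs) = of_nat (count_list xs z) * f z" by auto
    then show ?case by (auto simp: algebra_simps)
  qed auto
  then show ?thesis using assms(2) by (metis count_list_0_iff gr0I)
qed

lemma sum_list_zero: "(\<And>x. x \<in> set xs \<Longrightarrow> f x = (0::complex)) \<Longrightarrow> sum_list (map f xs) = 0"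
  by (induction xs) auto

lemma shuffle_product_zero_left:
  assumes "w \<in> lists A" "\<And>a. a \<in> lists A \<Longrightarrow> f a = 0"
  shows "shuffle_product f g w = 0"
  unfolding shuffle_product_def
proof (rule sum_list_zero)
  fix x assume "x \<in> set (splits w)"
  then show "(case x of (a, b) \<Rightarrow> f a * g b) = 0"
    using splits_lists[of "fst x" "snd x" w A] assms by (auto simp: case_prod_unfold)
qed

lemma shuffle_product_zero_right:
  assumes "w \<in> lists A" "\<And>a. a \<in> lists A \<Longrightarrow> g a = 0"
  shows "shuffle_product f g w = 0"
  unfolding shuffle_product_def
proof (rule sum_list_zero)
  fix x assume "x \<in> set (splits w)"
  then show "(case x of (a, b) \<Rightarrow> f a * g b) = 0"
    using splits_lists[of "fst x" "snd x" w A] assms by (auto simp: case_prod_unfold)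
qed

text \<open>The letters are vector fields and carry no order of their own. Any numbering is made to
  place \<open>K\<close> on top by shifting the numbers of its letters by \<open>card A\<close>,
  beyond all the unshifted ones.\<close>

lemma ranking_exists:
  assumes "finite A"
  obtains rk :: "'c \<Rightarrow> nat" where "inj_on rk A" "\<And>x y. x \<in> K \<Longrightarrow> x \<in> A \<Longrightarrow> y \<in> A \<Longrightarrow> rk x \<le> rk y \<Longrightarrow> y \<in> K"
proof -
  obtain g :: "'c \<Rightarrow> nat" where g: "bij_betw g A {0..<card A}" using ex_bij_betw_finite_nat[OF assms] by blast
  define rk where "rk x = (if x \<in> K then g x + card A else g x)" for x
  have lt: "g x < card A" if "x \<in> A" for x using g that by (auto simp: bij_betw_def)
  have inj: "inj_on g A" using g by (auto simp: bij_betw_def)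
  show thesis
  proof
    show "inj_on rk A"
    proof (rule inj_onI)
      fix x y assume xy: "x \<in> A" "y \<in> A" "rk x = rk y"
      then have "g x = g y" using lt[of x] lt[of y] by (simp add: rk_def split: if_splits)
      then show "x = y" using inj xy by (meson inj_onD)
    qed
    fix x y assume "x \<in> K" "x \<in> A" "y \<in> A" "rk x \<le> rk y"
    then show "y \<in> K" using lt[of y] by (auto simp: rk_def split: if_splits)
  qed
qed

text \<open>Compare coefficients at the largest shuffle of the largest words of minimal length of \<open>f\<close> and \<open>g\<close>:
  only this pair of words contributes to it.\<close>
lemma shuffle_product_leading:
  assumes A: "finite A"
    and kill: "\<And>x w. x \<in> K \<Longrightarrow> x \<in> A \<Longrightarrow> w \<in> lists A \<Longrightarrow> shuffle_product f g (x # w) = 0"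
    and nz: "w0 \<in> lists A" "shuffle_product f g w0 \<noteq> 0"
    and u: "u \<in> lists A" "f u \<noteq> 0" and umin: "\<And>w. w \<in> lists A \<Longrightarrow> f w \<noteq> 0 \<Longrightarrow> length u \<le> length w"
    and uh: "u = x # u'"
  shows "x \<notin> K"
proof
  assume "x \<in> K"
  obtain rk :: "'a \<Rightarrow> nat" where inj: "inj_on rk A"
    and up: "\<And>x y. x \<in> K \<Longrightarrow> x \<in> A \<Longrightarrow> y \<in> A \<Longrightarrow> rk x \<le> rk y \<Longrightarrow> y \<in> K"
    by (rule ranking_exists[OF A, of K]) blast
  have injl: "a = b" if "map rk a = map rk b" "a \<in> lists A" "b \<in> lists A" for a b
    by (rule map_inj_on[OF that(1) inj_on_subset[OF inj]]) (use that in auto)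
  have "\<exists>b. b \<in> lists A \<and> g b \<noteq> 0"
  proof (rule ccontr)
    assume "\<not> ?thesis"
    then have "shuffle_product f g w0 = 0"
      by (intro shuffle_product_zero_right[OF nz(1)]) blast
    then show False using nz by simp
  qed
  define s where "s = (LEAST n. \<exists>b. b \<in> lists A \<and> g b \<noteq> 0 \<and> length b = n)"
  have "\<exists>b. b \<in> lists A \<and> g b \<noteq> 0 \<and> length b = s"
    unfolding s_def by (rule LeastI_ex) (use \<open>\<exists>b. b \<in> lists A \<and> g b \<noteq> 0\<close> in auto)
  have smin: "s \<le> length b" if "b \<in> lists A" "g b \<noteq> 0" for b
    unfolding s_def using that by (intro Least_le) auto
  define r where "r = length u"
  define P where "P = {a \<in> lists A. length a = r \<and> f a \<noteq> 0}"
  define Q where "Q = {b \<in> lists A. length b = s \<and> g b \<noteq> 0}"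
  have finP: "finite P" and finQ: "finite Q"
    unfolding P_def Q_def
    by (rule finite_subset[OF _ finite_lists_length[OF A, of r]], blast)
      (rule finite_subset[OF _ finite_lists_length[OF A, of s]], blast)
  have "u \<in> P" using u by (auto simp: P_def r_def)
  have "Q \<noteq> {}" using \<open>\<exists>b. b \<in> lists A \<and> g b \<noteq> 0 \<and> length b = s\<close> by (auto simp: Q_def)
  define um where "um = Max ((map rk) ` P)"
  define vm where "vm = Max ((map rk) ` Q)"
  obtain p where p: "p \<in> P" "um = map rk p"
    using Max_in[of "(map rk) ` P"] finP \<open>u \<in> P\<close> unfolding um_def by blast
  obtain q where q: "q \<in> Q" "vm = map rk q"
    using Max_in[of "(map rk) ` Q"] finQ \<open>Q \<noteq> {}\<close> unfolding vm_def by blast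
  have le_um: "map rk a \<le> um" if "a \<in> P" for a unfolding um_def using finP that by auto
  have le_vm: "map rk b \<le> vm" if "b \<in> Q" for b unfolding vm_def using finQ that by auto
  define W where "W = {w. (um, vm) \<in> set (splits w)}"
  have "W \<noteq> {}" using splits_append[of um vm] by (auto simp: W_def)
  have "finite W" unfolding W_def by (rule splits_finite_inv)
  define wm where "wm = Max W"
  have wmW: "(um, vm) \<in> set (splits wm)" using Max_in[OF \<open>finite W\<close> \<open>W \<noteq> {}\<close>] by (simp add: wm_def W_def)
  have le_wm: "w \<le> wm" if "(um, vm) \<in> set (splits w)" for w
    unfolding wm_def using \<open>finite W\<close> that by (auto simp: W_def)
  have "set wm \<subseteq> rk ` A"
    using splits_set[OF wmW] p q by (auto simp: P_def Q_def)
  then have "map (inv_into A rk) wm \<in> lists A" "map rk (map (inv_into A rk) wm) = wm"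
    by (auto simp: subset_iff f_inv_into_f inv_into_into intro!: map_idI)
  then obtain w where w: "w \<in> lists A" "map rk w = wm" by blast
  have pqA: "p \<in> lists A" "q \<in> lists A" "length p = r" "length q = s" "f p \<noteq> 0" "g q \<noteq> 0"
    using p q by (simp_all add: P_def Q_def)
  have lum: "length um = r" "length vm = s" using pqA p q by simp_all
  have key: "(a, b) = (p, q)" if ab: "(a, b) \<in> set (splits w)" and ne: "f a * g b \<noteq> 0" for a b
  proof -
    have abA: "a \<in> lists A" "b \<in> lists A" using splits_lists[OF ab w(1)] by blast+
    have "length wm = length w" using w(2) by force
    then have "length a + length b = r + s"
      using splits_length[OF ab] splits_length[OF wmW] lum by simp
    moreover have "r \<le> length a" using umin[OF abA(1)] ne by (simp add: r_def)
    moreover have "s \<le> length b" using smin[OF abA(2)] ne by simp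
    ultimately have abl: "length a = r" "length b = s" by linarith+
    then have abPQ: "a \<in> P" "b \<in> Q" using abA ne by (simp_all add: P_def Q_def)
    \<comment> \<open>The lengths are now those of the leading words. Refilling \<open>wm\<close> by
      \<open>um\<close> and \<open>vm\<close> gives one of their shuffles that is at least
      \<open>wm\<close>; maximality of \<open>wm\<close> forces equality, hence \<open>a = p\<close>
      and \<open>b = q\<close>.\<close>
    have "(map rk a, map rk b) \<in> set (splits wm)" unfolding w(2)[symmetric] splits_map using ab by force
    then obtain w' where w': "(um, vm) \<in> set (splits w')" "wm \<le> w'" "wm = w' \<longrightarrow> map rk a = um \<and> map rk b = vm"
      using splits_mono[of "map rk a" "map rk b" wm um vm] le_um[OF abPQ(1)] le_vm[OF abPQ(2)] abl lum
      by (metis length_map)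
    have "wm = w'" using le_wm[OF w'(1)] w'(2) by (rule antisym[rotated])
    then have "map rk a = map rk p" "map rk b = map rk q" using w'(3) p q by auto
    then show ?thesis using injl[OF _ abA(1) pqA(1)] injl[OF _ abA(2) pqA(2)] by simp
  qed
  have pq: "(p, q) \<in> set (splits w)"
  proof -
    have "(um, vm) \<in> set (splits (map rk w))" using wmW w by simp
    then obtain a b where ab: "(a, b) \<in> set (splits w)" "map rk a = um" "map rk b = vm"
      by (auto simp: splits_map)
    have "a = p" using splits_lists[OF ab(1) w(1)] ab(2) p(2) by (intro injl) (simp_all add: pqA)
    moreover have "b = q" using splits_lists[OF ab(1) w(1)] ab(3) q(2) by (intro injl) (simp_all add: pqA)
    ultimately show ?thesis using ab by simp
  qed
  have "\<exists>n>0. sum_list (map (\<lambda>(a, b). f a * g b) (splits w)) = of_nat n * (\<lambda>(a, b). f a * g b) (p, q)"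
  proof (rule sum_list_single)
    fix y assume y: "y \<in> set (splits w)"
    show "y = (p, q) \<or> (\<lambda>(a, b). f a * g b) y = 0"
      using key[of "fst y" "snd y"] y by (cases y) auto
  qed (rule pq)
  then have wne: "shuffle_product f g w \<noteq> 0"
    using pqA by (auto simp: shuffle_product_def)
  \<comment> \<open>The first letters only rise from \<open>u\<close> to the largest shortest word
    \<open>p\<close>, and from \<open>um @ vm\<close> to the largest shuffle \<open>wm\<close>. As
    \<open>K\<close> is closed upwards, \<open>w\<close> begins with a letter of \<open>K\<close>,
    where the product is assumed to vanish.\<close>
  have um: "map rk u \<le> um" using le_um \<open>u \<in> P\<close> by blast
  have "p \<noteq> []" using pqA(3) uh by (auto simp: r_def)
  then obtain y ys where pcons: "p = y # ys" by (cases p) simp_all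
  have 1: "rk x \<le> rk y" using um unfolding uh p(2) pcons by auto
  have umvm: "um @ vm \<le> wm" using le_wm splits_append by blast
  then obtain z zs where wcons: "w = z # zs" using w p pcons by (cases w) simp_all
  have 2: "rk y \<le> rk z" using umvm unfolding wcons w(2)[symmetric] p(2) pcons by auto
  have "x \<in> A" "z \<in> A" using u(1) uh w(1) wcons by simp_all
  then have "z \<in> K" using up[OF \<open>x \<in> K\<close>, of z] 1 2 by simp
  then show False using kill[OF _ \<open>z \<in> A\<close>, of zs] w(1) wcons wne by simp
qed

text \<open>The two products are examined with different orders of the alphabet, one for each of
  \<open>K1\<close> and \<open>K2\<close>. This is consistent because
  \<open>shuffle_product_leading\<close> constrains every shortest word of \<open>f\<close>, so one
  and the same \<open>u\<close> can be used for both.\<close>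

lemma shuffle_product_unit:
  assumes "finite (K1 \<union> K2)"
    and "\<And>x w. x \<in> K1 \<Longrightarrow> w \<in> lists (K1 \<union> K2) \<Longrightarrow> shuffle_product f g (x # w) = 0"
    and "\<And>x w. x \<in> K2 \<Longrightarrow> w \<in> lists (K1 \<union> K2) \<Longrightarrow> shuffle_product f h (x # w) = 0"
    and "w1 \<in> lists (K1 \<union> K2)" "shuffle_product f g w1 \<noteq> 0"
    and "w2 \<in> lists (K1 \<union> K2)" "shuffle_product f h w2 \<noteq> 0"
  shows "f [] \<noteq> 0"
proof -
  let ?A = "K1 \<union> K2"
  have ex: "\<exists>u. u \<in> lists ?A \<and> f u \<noteq> 0"
  proof (rule ccontr)
    assume "\<not> ?thesis"
    then have "shuffle_product f g w1 = 0"
      by (intro shuffle_product_zero_left[OF assms(4)]) blast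
    then show False using assms(5) by simp
  qed
  then obtain u0 where u0: "u0 \<in> lists ?A \<and> f u0 \<noteq> 0" by (rule exE)
  obtain u where "(u \<in> lists ?A \<and> f u \<noteq> 0) \<and>
      (\<forall>w. w \<in> lists ?A \<and> f w \<noteq> 0 \<longrightarrow> length u \<le> length w)"
    using ex_has_least_nat[where P = "\<lambda>u. u \<in> lists ?A \<and> f u \<noteq> 0" and m = length, OF u0] by (rule exE)
  then have u: "u \<in> lists ?A" "f u \<noteq> 0" "\<And>w. w \<in> lists ?A \<Longrightarrow> f w \<noteq> 0 \<Longrightarrow> length u \<le> length w"
    by simp_all
  show ?thesis
  proof (cases u)
    case Nil
    then show ?thesis using u by simp
  next
    case (Cons x u')
    have "x \<notin> K1" 
      by (rule shuffle_product_leading[OF assms(1) assms(2) assms(4) assms(5) u(1,2) u(3) Cons])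
    moreover have "x \<notin> K2" 
      by (rule shuffle_product_leading[OF assms(1) assms(3) assms(6) assms(7) u(1,2) u(3) Cons])
    moreover have "x \<in> K1 \<union> K2" using u(1) unfolding Cons by simp
    ultimately show ?thesis by blast
  qed
qed

section \<open>Smooth functions\<close>

lemma frechet_derivative_cong:
  assumes "open U" "x \<in> U" "\<And>y. y \<in> U \<Longrightarrow> f y = g y"
  shows "frechet_derivative f (at x) = frechet_derivative g (at x)"
proof -
  have "(f has_derivative D) (at x) \<longleftrightarrow> (g has_derivative D) (at x)" for D
    using has_derivative_transform_within_open[OF _ assms(1,2)] assms(3) by metis
  then show ?thesis by (simp add: frechet_derivative_def)
qed

lemma Ck_on_cong:
  assumes "open U" "\<And>y. y \<in> U \<Longrightarrow> f y = g y" "Ck_on k U f"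
  shows "Ck_on k U g"
  using assms(2,3)
proof (induction k arbitrary: f g)
  case 0
  then show ?case using continuous_on_cong[of U U f g] by simp
next
  case (Suc k)
  have "g differentiable_on U" 
    using Suc.prems by (auto simp: differentiable_on_def cong: ball_cong
        intro: differentiable_transform_within[where d=1, OF _ zero_less_one])
  moreover have "Ck_on k U (\<lambda>x. frechet_derivative g (at x) v)" for v
  proof (rule Suc.IH)
    show "Ck_on k U (\<lambda>x. frechet_derivative f (at x) v)" using Suc.prems by simp
    fix y assume "y \<in> U"
    then show "frechet_derivative f (at y) v = frechet_derivative g (at y) v"
      using frechet_derivative_cong[OF assms(1), of y f g] Suc.prems by simp
  qed
  ultimately show ?case by simp
qed

lemma Ck_on_subset:
  assumes "open U" "open V" "V \<subseteq> U" "Ck_on k U f"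
  shows "Ck_on k V f"
  using assms(4)
proof (induction k arbitrary: f)
  case 0
  then show ?case using continuous_on_subset assms by auto
next
  case (Suc k)
  then show ?case using differentiable_on_subset assms by auto
qed

lemma Ck_on_continuous: "Ck_on k U f \<Longrightarrow> continuous_on U f"
  by (cases k) (auto intro: differentiable_imp_continuous_on)

lemma Ck_on_Suc_imp: "Ck_on (Suc k) U f \<Longrightarrow> Ck_on k U f"
proof (induction k arbitrary: f)
  case 0
  then show ?case by (auto intro: differentiable_imp_continuous_on)
next
  case (Suc k)
  then have "Ck_on k U (\<lambda>x. frechet_derivative f (at x) v)" for v by simp
  then show ?case using Suc.prems by simp
qed

text \<open>\<open>Ck_on\<close> refers to the derivative selected by
  \<open>frechet_derivative\<close>. Here any derivative produced by the calculus rules may take its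
  place; the inductions below all end with this rule.\<close>

lemma Ck_on_SucI:
  assumes "open U" "\<And>x. x \<in> U \<Longrightarrow> (f has_derivative D x) (at x)" "\<And>v. Ck_on k U (\<lambda>x. D x v)"
  shows "Ck_on (Suc k) U f"
proof -
  have "Ck_on k U (\<lambda>x. frechet_derivative f (at x) v)" for v
    by (rule Ck_on_cong[OF assms(1) _ assms(3)[of v]]) (simp add: frechet_derivative_at[OF assms(2), symmetric])
  moreover have "f differentiable_on U"
    using assms(1,2) by (auto simp: differentiable_on_eq_differentiable_at differentiable_def)
  ultimately show ?thesis by simp
qed

lemma Ck_on_Suc_has_derivative:
  assumes "open U" "Ck_on (Suc k) U f" "x \<in> U"
  shows "(f has_derivative frechet_derivative f (at x)) (at x)"
  using assms by (simp add: differentiable_on_eq_differentiable_at frechet_derivative_works)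

lemma Ck_on_Suc_frechet_derivative: "Ck_on (Suc k) U f \<Longrightarrow> Ck_on k U (\<lambda>x. frechet_derivative f (at x) v)"
  by simp

lemma Ck_on_const: "open U \<Longrightarrow> Ck_on k U (\<lambda>x. c)"
proof (induction k arbitrary: c)
  case (Suc k)
  then show ?case by (intro Ck_on_SucI[where D="\<lambda>x v. 0"]) simp_all
qed simp

lemma Ck_on_bounded_linear:
  assumes "open U" "bounded_linear h" "Ck_on k U f"
  shows "Ck_on k U (\<lambda>x. h (f x))"
  using assms(3)
proof (induction k arbitrary: f)
  case 0
  then show ?case using assms bounded_linear.continuous_on by auto
next
  case (Suc k)
  show ?case
  proof (rule Ck_on_SucI[OF assms(1)])
    fix x assume "x \<in> U"
    then show "((\<lambda>x. h (f x)) has_derivative (\<lambda>v. h (frechet_derivative f (at x) v))) (at x)"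
      using Ck_on_Suc_has_derivative[OF assms(1) Suc.prems] bounded_linear.has_derivative[OF assms(2)] by blast
  qed (use Suc in auto)
qed

lemma Ck_on_add:
  assumes "open U" "Ck_on k U f" "Ck_on k U g"
  shows "Ck_on k U (\<lambda>x. f x + g x)"
  using assms(2,3)
proof (induction k arbitrary: f g)
  case 0
  then show ?case by (auto intro: continuous_intros)
next
  case (Suc k)
  show ?case
  proof (rule Ck_on_SucI[OF assms(1)])
    fix x assume "x \<in> U"
    then show "((\<lambda>x. f x + g x) has_derivative (\<lambda>v. frechet_derivative f (at x) v + frechet_derivative g (at x) v)) (at x)"
      using Ck_on_Suc_has_derivative[OF assms(1)] Suc.prems by (blast intro: has_derivative_add)
  qed (use Suc in auto)
qed

text \<open>The derivative is a sum of two products of the same kind, each with one factor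
  differentiated and the other weakened by one order, so the induction must vary \<open>f\<close>
  and \<open>g\<close> together.\<close>

lemma Ck_on_bounded_bilinear:
  assumes "open U" "bounded_bilinear h" "Ck_on k U f" "Ck_on k U g"
  shows "Ck_on k U (\<lambda>x. h (f x) (g x))"
  using assms(3,4)
proof (induction k arbitrary: f g)
  case 0
  then show ?case by (simp add: bounded_bilinear.continuous_on[OF assms(2)])
next
  case (Suc k)
  let ?f' = "\<lambda>x. frechet_derivative f (at x)" and ?g' = "\<lambda>x. frechet_derivative g (at x)"
  have "((\<lambda>x. h (f x) (g x)) has_derivative (\<lambda>v. h (f x) (?g' x v) + h (?f' x v) (g x))) (at x)"
    if "x \<in> U" for x
    by (rule bounded_bilinear.FDERIV[OF assms(2) Ck_on_Suc_has_derivative[OF assms(1) Suc.prems(1) that]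
            Ck_on_Suc_has_derivative[OF assms(1) Suc.prems(2) that]])
  moreover have "Ck_on k U (\<lambda>x. h (f x) (?g' x v) + h (?f' x v) (g x))" for v
    by (rule Ck_on_add[OF assms(1)
            Suc.IH[OF Ck_on_Suc_imp[OF Suc.prems(1)] Ck_on_Suc_frechet_derivative[OF Suc.prems(2)]]
            Suc.IH[OF Ck_on_Suc_frechet_derivative[OF Suc.prems(1)] Ck_on_Suc_imp[OF Suc.prems(2)]]])
  ultimately show ?case
    by (rule Ck_on_SucI[where D = "\<lambda>x v. h (f x) (?g' x v) + h (?f' x v) (g x)", OF assms(1)])
qed

lemma Ck_on_sum:
  assumes "open U" "\<And>i. i \<in> I \<Longrightarrow> Ck_on k U (f i)"
  shows "Ck_on k U (\<lambda>x. \<Sum>i\<in>I. f i x)"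
  using assms(2)
  proof (induction I rule: infinite_finite_induct)
  case (insert i I)
  have "Ck_on k U (\<lambda>x. f i x + (\<Sum>i\<in>I. f i x))"
    by (rule Ck_on_add[OF assms(1)]) (use insert in simp_all)
  then show ?case using insert by simp
qed (simp_all add: Ck_on_const[OF assms(1)])

text \<open>The chain rule evaluates the derivative of \<open>g\<close> in a direction that moves
  with \<open>x\<close>, whereas \<open>Ck_on\<close> controls fixed directions only. Expanding the
  direction in a basis turns the derivative into a sum of products to which the induction hypothesis
  applies; hence the Euclidean middle space.\<close>

lemma Ck_on_compose:
  fixes f :: "'a::real_normed_vector \<Rightarrow> 'b::euclidean_space"
  assumes "open U" "open V" "f ` U \<subseteq> V" "Ck_on k U f" "Ck_on k V g"
  shows "Ck_on k U (\<lambda>x. g (f x))"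
  using assms(4,5)
proof (induction k arbitrary: g)
  case 0
  then show ?case using continuous_on_compose2[of V g U f] assms(3) by simp
next
  case (Suc k)
  let ?D = "\<lambda>x v. \<Sum>b\<in>Basis. (frechet_derivative f (at x) v \<bullet> b) *\<^sub>R frechet_derivative g (at (f x)) b"
  show ?case
  proof (rule Ck_on_SucI[OF assms(1)])
    fix x assume x: "x \<in> U"
    have g: "(g has_derivative frechet_derivative g (at (f x))) (at (f x))"
      using Ck_on_Suc_has_derivative[OF assms(2) Suc.prems(2)] x assms(3) by blast
    have "((\<lambda>x. g (f x)) has_derivative (\<lambda>v. frechet_derivative g (at (f x)) (frechet_derivative f (at x) v))) (at x)"
      using has_derivative_compose[OF Ck_on_Suc_has_derivative[OF assms(1) Suc.prems(1) x] g] .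
    moreover have "frechet_derivative g (at (f x)) w = (\<Sum>b\<in>Basis. (w \<bullet> b) *\<^sub>R frechet_derivative g (at (f x)) b)" for w
    proof -
      interpret bounded_linear "frechet_derivative g (at (f x))" using g has_derivative_bounded_linear by blast
      have "frechet_derivative g (at (f x)) (\<Sum>b\<in>Basis. (w \<bullet> b) *\<^sub>R b) = (\<Sum>b\<in>Basis. (w \<bullet> b) *\<^sub>R frechet_derivative g (at (f x)) b)"
        by (simp add: sum scaleR)
      then show ?thesis by (simp add: euclidean_representation)
    qed
    ultimately show "((\<lambda>x. g (f x)) has_derivative ?D x) (at x)"
      by (rule has_derivative_eq_rhs[OF _ ext])
  next
    fix v
    have "Ck_on k U (\<lambda>x. frechet_derivative g (at (f x)) b)" for b
      using Suc.IH[OF Ck_on_Suc_imp[OF Suc.prems(1)], of "\<lambda>y. frechet_derivative g (at y) b"] Suc.prems(2)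
      by simp
    moreover have "Ck_on k U (\<lambda>x. frechet_derivative f (at x) v \<bullet> b)" for b
      by (rule Ck_on_bounded_linear[OF assms(1) bounded_linear_inner_left Ck_on_Suc_frechet_derivative[OF Suc.prems(1)]])
    ultimately show "Ck_on k U (\<lambda>x. ?D x v)"
      by (intro Ck_on_sum[OF assms(1)] Ck_on_bounded_bilinear[OF assms(1) bounded_bilinear_scaleR])
  qed
qed

text \<open>The derivative of the inverse contains the inverse again, but one order of smoothness
  lower, which is the induction hypothesis.\<close>

lemma Ck_on_inverse:
  fixes f :: "'a::real_normed_vector \<Rightarrow> complex"
  assumes "open U" "Ck_on k U f" "\<And>x. x \<in> U \<Longrightarrow> f x \<noteq> 0"
  shows "Ck_on k U (\<lambda>x. inverse (f x))"
  using assms(2)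
proof (induction k)
  case 0
  then show ?case using assms(3) by (simp add: continuous_on_inverse)
next
  case (Suc k)
  let ?D = "\<lambda>x v. - (inverse (f x) * frechet_derivative f (at x) v * inverse (f x))"
  have "((\<lambda>x. inverse (f x)) has_derivative ?D x) (at x)" if "x \<in> U" for x
    by (rule Deriv.has_derivative_inverse[OF assms(3)[OF that] Ck_on_Suc_has_derivative[OF assms(1) Suc.prems that]])
  moreover have "Ck_on k U (\<lambda>x. ?D x v)" for v
  proof -
    have 1: "Ck_on k U (\<lambda>x. inverse (f x))" by (rule Suc.IH[OF Ck_on_Suc_imp[OF Suc.prems]])
    have 2: "Ck_on k U (\<lambda>x. frechet_derivative f (at x) v)"
      by (rule Ck_on_Suc_frechet_derivative[OF Suc.prems])
    have "Ck_on k U (\<lambda>x. inverse (f x) * frechet_derivative f (at x) v * inverse (f x))"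
      by (rule Ck_on_bounded_bilinear[OF assms(1) bounded_bilinear_mult
            Ck_on_bounded_bilinear[OF assms(1) bounded_bilinear_mult 1 2] 1])
    then show ?thesis
      by (rule Ck_on_bounded_linear[OF assms(1) bounded_linear_minus[OF bounded_linear_ident]])
  qed
  ultimately show ?case by (rule Ck_on_SucI[where D = ?D, OF assms(1)])
qed

section \<open>Closure properties of smooth functions\<close>

lemma smooth_onI: "(\<And>k. Ck_on k U f) \<Longrightarrow> smooth_on U f"
  by (simp add: smooth_on_def)

lemma smooth_onD: "smooth_on U f \<Longrightarrow> Ck_on k U f"
  by (simp add: smooth_on_def)

lemma smooth_on_subset:
  assumes "open U" "open V" "V \<subseteq> U" "smooth_on U f"
  shows "smooth_on V f"
  unfolding smooth_on_def
proof
  fix k show "Ck_on k V f"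
    using Ck_on_subset[OF assms(1-3), where k = k and f = f] assms(4) by (simp add: smooth_on_def)
qed

lemma smooth_on_cong:
  assumes "open U" "\<And>y. y \<in> U \<Longrightarrow> f y = g y" "smooth_on U f"
  shows "smooth_on U g"
  unfolding smooth_on_def
proof
  fix k show "Ck_on k U g"
    using Ck_on_cong[OF assms(1,2), where k = k] assms(3) by (simp add: smooth_on_def)
qed

lemma smooth_on_frechet_derivative: "smooth_on U f \<Longrightarrow> smooth_on U (\<lambda>x. frechet_derivative f (at x) v)"
  by (rule smooth_onI, rule Ck_on_Suc_frechet_derivative, erule smooth_onD)

lemma smooth_on_has_derivative:
  "open U \<Longrightarrow> smooth_on U f \<Longrightarrow> x \<in> U \<Longrightarrow> (f has_derivative frechet_derivative f (at x)) (at x)"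
  by (rule Ck_on_Suc_has_derivative[OF _ smooth_onD])

lemma smooth_on_continuous_on: "smooth_on U f \<Longrightarrow> continuous_on U f"
  by (rule Ck_on_continuous, erule smooth_onD)

lemma smooth_on_const: "open U \<Longrightarrow> smooth_on U (\<lambda>x. c)"
  by (rule smooth_onI, rule Ck_on_const)

lemma smooth_on_add: "open U \<Longrightarrow> smooth_on U f \<Longrightarrow> smooth_on U g \<Longrightarrow> smooth_on U (\<lambda>x. f x + g x)"
  by (rule smooth_onI, rule Ck_on_add) (assumption | erule smooth_onD)+

lemma smooth_on_bounded_linear: "open U \<Longrightarrow> bounded_linear h \<Longrightarrow> smooth_on U f \<Longrightarrow> smooth_on U (\<lambda>x. h (f x))"
  by (rule smooth_onI, rule Ck_on_bounded_linear[where h = h]) (assumption | erule smooth_onD)+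

lemma smooth_on_mult:
  fixes f g :: "'a::real_normed_vector \<Rightarrow> complex"
  shows "open U \<Longrightarrow> smooth_on U f \<Longrightarrow> smooth_on U g \<Longrightarrow> smooth_on U (\<lambda>x. f x * g x)"
  by (rule smooth_onI, rule Ck_on_bounded_bilinear[OF _ bounded_bilinear_mult]) (assumption | erule smooth_onD)+

lemma smooth_on_uminus: "open U \<Longrightarrow> smooth_on U f \<Longrightarrow> smooth_on U (\<lambda>x. - f x)"
  by (rule smooth_on_bounded_linear[OF _ bounded_linear_minus[OF bounded_linear_ident]])

lemma smooth_on_diff:
  assumes "open U" "smooth_on U f" "smooth_on U g"
  shows "smooth_on U (\<lambda>x. f x - g x)"
  unfolding diff_conv_add_uminus by (intro smooth_on_add smooth_on_uminus assms)

lemma smooth_on_sum: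
  assumes "open U" "\<And>i. i \<in> I \<Longrightarrow> smooth_on U (f i)"
  shows "smooth_on U (\<lambda>x. \<Sum>i\<in>I. f i x)"
  by (rule smooth_onI, rule Ck_on_sum[OF assms(1)], rule smooth_onD[OF assms(2)])

lemma smooth_on_prod:
  fixes f :: "'i \<Rightarrow> 'a::real_normed_vector \<Rightarrow> complex"
  assumes "open U" "\<And>i. i \<in> I \<Longrightarrow> smooth_on U (f i)"
  shows "smooth_on U (\<lambda>x. \<Prod>i\<in>I. f i x)"
  using assms(2)
proof (induction I rule: infinite_finite_induct)
  case (insert i I)
  have "smooth_on U (\<lambda>x. f i x * (\<Prod>i\<in>I. f i x))"
    by (rule smooth_on_mult[OF assms(1)]) (use insert in simp_all)
  then show ?case using insert by simp
qed (simp_all add: smooth_on_const[OF assms(1)])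

lemma smooth_on_compose:
  fixes f :: "'a::real_normed_vector \<Rightarrow> 'b::euclidean_space"
  assumes "open U" "open V" "f ` U \<subseteq> V" "smooth_on U f" "smooth_on V g"
  shows "smooth_on U (\<lambda>x. g (f x))"
  by (rule smooth_onI, rule Ck_on_compose[OF assms(1-3) smooth_onD smooth_onD]) (rule assms)+

lemma smooth_on_inverse:
  fixes f :: "'a::real_normed_vector \<Rightarrow> complex"
  assumes "open U" "smooth_on U f" "\<And>x. x \<in> U \<Longrightarrow> f x \<noteq> 0"
  shows "smooth_on U (\<lambda>x. inverse (f x))"
  by (rule smooth_onI, rule Ck_on_inverse[OF assms(1) smooth_onD assms(3)]) (rule assms)+

lemma smooth_on_divide:
  fixes f :: "'a::real_normed_vector \<Rightarrow> complex"
  assumes "open U" "smooth_on U f" "smooth_on U g" "\<And>x. x \<in> U \<Longrightarrow> g x \<noteq> 0"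
  shows "smooth_on U (\<lambda>x. f x / g x)"
  unfolding divide_inverse by (rule smooth_on_mult[OF assms(1,2) smooth_on_inverse[OF assms(1,3,4)]])

lemma bounded_linear_axis: "bounded_linear (axis i :: 'a::euclidean_space \<Rightarrow> 'a^'n)"
  by (rule linear_conv_bounded_linear[THEN iffD1], rule linearI) (auto simp: axis_def vec_eq_iff)

lemma smooth_on_vec_lambda:
  fixes f :: "'n::finite \<Rightarrow> 'a::real_normed_vector \<Rightarrow> 'b::euclidean_space"
  assumes "open U" "\<And>i. smooth_on U (f i)"
  shows "smooth_on U (\<lambda>x. \<chi> i. f i x)"
proof -
  have eq: "(\<chi> i. f i x) = (\<Sum>i\<in>UNIV. axis i (f i x))" for x
    by (simp add: vec_eq_iff axis_def)
  have "smooth_on U (\<lambda>x. \<Sum>i\<in>UNIV. axis i (f i x))"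
    by (rule smooth_on_sum[OF assms(1) smooth_on_bounded_linear[OF assms(1) bounded_linear_axis assms(2)]])
  then show ?thesis unfolding eq .
qed

lemma smooth_on_vec_nth: "open U \<Longrightarrow> smooth_on U f \<Longrightarrow> smooth_on U (\<lambda>x. f x $ i)"
  by (rule smooth_on_bounded_linear[OF _ bounded_linear_vec_nth])

lemma smooth_on_of_real: "open U \<Longrightarrow> smooth_on U f \<Longrightarrow> smooth_on U (\<lambda>x. complex_of_real (f x))"
  by (rule smooth_on_bounded_linear[OF _ bounded_linear_of_real])

lemma smooth_on_det:
  fixes A :: "'a::real_normed_vector \<Rightarrow> complex^'n::finite^'n"
  assumes "open U" "\<And>i j. smooth_on U (\<lambda>x. A x $ i $ j)"
  shows "smooth_on U (\<lambda>x. det (A x))"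
  unfolding det_def
  by (intro smooth_on_sum smooth_on_mult smooth_on_prod smooth_on_const assms)

lemma smooth_on_Pair:
  fixes f :: "'a::real_normed_vector \<Rightarrow> 'b::real_normed_vector" and g :: "'a \<Rightarrow> 'c::real_normed_vector"
  assumes "open U" "smooth_on U f" "smooth_on U g"
  shows "smooth_on U (\<lambda>x. (f x, g x))"
proof -
  have 1: "bounded_linear (\<lambda>y::'b. (y, 0::'c))" by (rule bounded_linear_Pair[OF bounded_linear_ident bounded_linear_zero])
  have 2: "bounded_linear (\<lambda>y::'c. (0::'b, y))" by (rule bounded_linear_Pair[OF bounded_linear_zero bounded_linear_ident])
  have "smooth_on U (\<lambda>x. (f x, 0) + (0, g x))"
    by (rule smooth_on_add[OF assms(1) smooth_on_bounded_linear[OF assms(1) 1 assms(2)] smooth_on_bounded_linear[OF assms(1) 2 assms(3)]])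
  then show ?thesis by simp
qed

lemma smooth_on_fst: "open U \<Longrightarrow> smooth_on U f \<Longrightarrow> smooth_on U (\<lambda>x. fst (f x))"
  by (rule smooth_on_bounded_linear[OF _ bounded_linear_fst])

lemma smooth_on_snd: "open U \<Longrightarrow> smooth_on U f \<Longrightarrow> smooth_on U (\<lambda>x. snd (f x))"
  by (rule smooth_on_bounded_linear[OF _ bounded_linear_snd])

section \<open>Smooth dependence of inverse matrices\<close>

lemma matrix_mul_matrix_inv:
  fixes A :: "complex^'n::finite^'n"
  assumes "det A \<noteq> 0"
  shows "A ** matrix_inv A = mat 1" "matrix_inv A ** A = mat 1"
proof -
  have "A ** matrix_inv A = mat 1 \<and> matrix_inv A ** A = mat 1" using assms
    unfolding invertible_det_nz[symmetric] invertible_def matrix_inv_def by (rule someI_ex)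
  then show "A ** matrix_inv A = mat 1" "matrix_inv A ** A = mat 1" by simp_all
qed

text \<open>Quotients of determinants are built from the entries by sums, products and one inverse,
  so this form makes the smoothness of \<open>matrix_inv\<close> visible.\<close>

lemma matrix_inv_mult_cramer:
  fixes A :: "complex^'n::finite^'n"
  assumes "det A \<noteq> 0"
  shows "matrix_inv A *v b = (\<chi> k. det (\<chi> i j. if j = k then b $ i else A $ i $ j) / det A)"
proof -
  have "A *v (matrix_inv A *v b) = b" by (simp add: matrix_vector_mul_assoc matrix_mul_matrix_inv[OF assms])
  then show ?thesis using cramer[OF assms] by blast
qed

lemma smooth_on_matrix_inv_mult:
  fixes A :: "'a::real_normed_vector \<Rightarrow> complex^'n::finite^'n"
  assumes "open U" "\<And>i j. smooth_on U (\<lambda>x. A x $ i $ j)" "\<And>i. smooth_on U (\<lambda>x. b x $ i)"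
    and "\<And>x. x \<in> U \<Longrightarrow> det (A x) \<noteq> 0"
  shows "smooth_on U (\<lambda>x. matrix_inv (A x) *v b x)"
proof -
  have "smooth_on U (\<lambda>x. (\<chi> i j. if j = k then b x $ i else A x $ i $ j) $ i $ j)" for i j k
    using assms(2)[of i j] assms(3)[of i] by (cases "j = k") simp_all
  then have "smooth_on U (\<lambda>x. det (\<chi> i j. if j = k then b x $ i else A x $ i $ j) / det (A x))" for k
    by (rule smooth_on_divide[OF assms(1) smooth_on_det[OF assms(1)] smooth_on_det[OF assms(1,2)] assms(4)])
  then have "smooth_on U (\<lambda>x. \<chi> k. det (\<chi> i j. if j = k then b x $ i else A x $ i $ j) / det (A x))"
    by (rule smooth_on_vec_lambda[OF assms(1)])
  then show ?thesis
    by (rule smooth_on_cong[OF assms(1) matrix_inv_mult_cramer[OF assms(4), symmetric], rotated])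
qed

section \<open>Integral curves and second derivatives\<close>

text \<open>Picard iteration as a contraction on bounded continuous functions. A global Lipschitz
  condition frees the iteration from any domain that the curve would have to stay in; local fields
  are reduced to this case afterwards.\<close>

lemma global_picard:
  fixes F :: "'a::euclidean_space \<Rightarrow> 'a"
  assumes lip: "\<And>x y. norm (F x - F y) \<le> K * norm (x - y)" and K: "K \<ge> 0"
  shows "\<exists>\<epsilon>>0. \<exists>\<gamma>. \<gamma> 0 = z0 \<and> (\<forall>t\<in>{-\<epsilon><..<\<epsilon>}. (\<gamma> has_vector_derivative F (\<gamma> t)) (at t))"
proof -
  \<comment> \<open>The contraction factor will be \<open>3 * \<epsilon> * K\<close>, which this
    choice keeps below one half; the summand 1 covers \<open>K = 0\<close>.\<close>
  define \<epsilon> where "\<epsilon> = 1 / (6 * (K + 1))"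
  have \<epsilon>: "\<epsilon> > 0" "3 * \<epsilon> * K \<le> 1 / 2" using K by (simp_all add: \<epsilon>_def field_simps)
  have contF: "continuous_on UNIV F"
  proof (rule lipschitz_on_continuous_on)
    show "K-lipschitz_on UNIV F" using lip K by (simp add: lipschitz_on_def dist_norm)
  qed
  \<comment> \<open>Clamping the time extends the integral operator to the whole line, so that it
    acts on the complete space \<open>bcontfun\<close>.\<close>
  define cl where "cl t = max (-\<epsilon>) (min \<epsilon> t)" for t :: real
  have cl: "cl t \<in> {-\<epsilon>..\<epsilon>}" for t using \<epsilon> by (simp add: cl_def)
  have clcont: "continuous_on UNIV cl" unfolding cl_def by (intro continuous_intros)
  \<comment> \<open>Integrating from \<open>-\<epsilon>\<close> covers both signs of
    \<open>t\<close> with one formula. The value at 0 is subtracted in \<open>T\<close>, and these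
    two integrals, of lengths at most \<open>2 * \<epsilon>\<close> and \<open>\<epsilon>\<close>,
    give the factor 3.\<close>
  define I where "I g t = integral {-\<epsilon>..t} (\<lambda>s. F (g s))" for g :: "real \<Rightarrow> 'a" and t
  have cFg: "continuous_on S (\<lambda>s. F (apply_bcontfun g s))" for g :: "real \<Rightarrow>\<^sub>C 'a" and S
    by (rule continuous_on_compose2[OF contF]) auto
  have Icont: "continuous_on {-\<epsilon>..\<epsilon>} (I (apply_bcontfun g))" for g :: "real \<Rightarrow>\<^sub>C 'a"
    unfolding I_def by (rule indefinite_integral_continuous_1, rule integrable_continuous_real, rule cFg)
  define T where "T g t = z0 + (I (apply_bcontfun g) (cl t) - I (apply_bcontfun g) 0)" for g :: "real \<Rightarrow>\<^sub>C 'a" and t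
  have Tb: "T g \<in> bcontfun" for g
  proof -
    have c: "continuous_on {-\<epsilon>..\<epsilon>} (\<lambda>t. z0 + (I (apply_bcontfun g) t - I (apply_bcontfun g) 0))"
      by (intro continuous_intros Icont)
    have Teq: "T g = (\<lambda>t. z0 + (I (apply_bcontfun g) t - I (apply_bcontfun g) 0)) \<circ> cl" by (simp add: T_def fun_eq_iff)
    have "continuous_on UNIV (T g)" unfolding Teq
      by (rule continuous_on_compose[OF clcont continuous_on_subset[OF c]]) (use cl in blast)
    moreover have "bounded (range (T g))"
    proof (rule bounded_subset)
      show "bounded ((\<lambda>t. z0 + (I (apply_bcontfun g) t - I (apply_bcontfun g) 0)) ` {-\<epsilon>..\<epsilon>})"
        by (rule compact_imp_bounded[OF compact_continuous_image[OF c]]) simp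
      show "range (T g) \<subseteq> (\<lambda>t. z0 + (I (apply_bcontfun g) t - I (apply_bcontfun g) 0)) ` {-\<epsilon>..\<epsilon>}"
        unfolding Teq using cl by force
    qed
    ultimately show ?thesis by (simp add: bcontfun_def)
  qed
  have Tapp: "apply_bcontfun (Bcontfun (T g)) = T g" for g by (rule Bcontfun_inverse[OF Tb])
  have Idiff: "norm (I (apply_bcontfun g) c - I (apply_bcontfun h) c) \<le> K * dist g h * (c + \<epsilon>)"
    if "c \<in> {-\<epsilon>..\<epsilon>}" for g h :: "real \<Rightarrow>\<^sub>C 'a" and c
  proof -
    have "I (apply_bcontfun g) c - I (apply_bcontfun h) c = integral {-\<epsilon>..c} (\<lambda>s. F (apply_bcontfun g s) - F (apply_bcontfun h s))"
      unfolding I_def by (rule integral_diff[symmetric]; rule integrable_continuous_real; rule cFg)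
    moreover have "norm (integral {-\<epsilon>..c} (\<lambda>s. F (apply_bcontfun g s) - F (apply_bcontfun h s))) \<le> K * dist g h * (c - (-\<epsilon>))"
    proof (rule integral_bound)
      show "-\<epsilon> \<le> c" using that by simp
      show "continuous_on {-\<epsilon>..c} (\<lambda>s. F (apply_bcontfun g s) - F (apply_bcontfun h s))"
        by (intro continuous_on_diff cFg)
      fix t
      have "norm (apply_bcontfun g t - apply_bcontfun h t) \<le> dist g h"
        using dist_bounded[of g t h] by (simp add: dist_norm)
      then show "norm (F (apply_bcontfun g t) - F (apply_bcontfun h t)) \<le> K * dist g h"
        using lip[of "apply_bcontfun g t" "apply_bcontfun h t"] K by (meson mult_left_mono order_trans)
    qed
    ultimately show ?thesis by simp
  qed
  have "\<exists>!g. Bcontfun (T g) = g"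
  proof (rule banach_fix_type[where c = "1/2"])
    show "\<forall>g h. dist (Bcontfun (T g)) (Bcontfun (T h)) \<le> 1 / 2 * dist g h"
    proof (intro allI)
      fix g h
      show "dist (Bcontfun (T g)) (Bcontfun (T h)) \<le> 1 / 2 * dist g h"
      proof (rule dist_bound)
        fix t
        have "norm (T g t - T h t) \<le> norm (I (apply_bcontfun g) (cl t) - I (apply_bcontfun h) (cl t)) +
            norm (I (apply_bcontfun g) 0 - I (apply_bcontfun h) 0)"
          unfolding T_def using norm_triangle_ineq4[of "I (apply_bcontfun g) (cl t) - I (apply_bcontfun h) (cl t)"
              "I (apply_bcontfun g) 0 - I (apply_bcontfun h) 0"] by (simp add: algebra_simps)
        also have "\<dots> \<le> K * dist g h * (cl t + \<epsilon>) + K * dist g h * (0 + \<epsilon>)"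
          using Idiff[OF cl] Idiff[of 0 g h] \<epsilon>(1) by (intro add_mono) simp_all
        also have "\<dots> = K * dist g h * (cl t + 2 * \<epsilon>)" by (simp add: algebra_simps)
        also have "\<dots> \<le> K * dist g h * (3 * \<epsilon>)"
          using cl[of t] K by (intro mult_left_mono) simp_all
        also have "\<dots> = (3 * \<epsilon> * K) * dist g h" by simp
        also have "\<dots> \<le> 1 / 2 * dist g h" by (rule mult_right_mono[OF \<epsilon>(2)]) simp
        finally show "dist (apply_bcontfun (Bcontfun (T g)) t) (apply_bcontfun (Bcontfun (T h)) t) \<le> 1 / 2 * dist g h"
          by (simp add: Tapp dist_norm)
      qed
    qed
  qed simp_all
  then obtain g where g: "Bcontfun (T g) = g" by blast
  define \<gamma> where "\<gamma> = apply_bcontfun g"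
  have \<gamma>: "\<gamma> t = T g t" for t unfolding \<gamma>_def using Tapp[of g] g by simp
  have "\<gamma> 0 = z0" using \<epsilon>(1) by (simp add: \<gamma> T_def cl_def)
  moreover have "(\<gamma> has_vector_derivative F (\<gamma> t)) (at t)" if t: "t \<in> {-\<epsilon><..<\<epsilon>}" for t
  proof -
    have "(I \<gamma> has_vector_derivative F (\<gamma> t)) (at t within {-\<epsilon>..\<epsilon>})"
      unfolding I_def \<gamma>_def by (rule integral_has_vector_derivative[OF cFg]) (use t in simp)
    then have "(I \<gamma> has_vector_derivative F (\<gamma> t)) (at t within {-\<epsilon><..<\<epsilon>})"
      by (rule has_vector_derivative_within_subset) auto
    then have "(I \<gamma> has_vector_derivative F (\<gamma> t)) (at t)"
      using t at_within_open[OF t open_greaterThanLessThan] by simp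
    then have "((\<lambda>t. z0 + (I \<gamma> t - I \<gamma> 0)) has_vector_derivative 0 + (F (\<gamma> t) - 0)) (at t)"
      by (intro has_vector_derivative_add has_vector_derivative_diff has_vector_derivative_const)
    then have "((\<lambda>t. z0 + (I \<gamma> t - I \<gamma> 0)) has_vector_derivative F (\<gamma> t)) (at t)" by simp
    then show ?thesis
    proof (rule has_vector_derivative_transform_within_open[OF _ open_greaterThanLessThan t])
      fix s assume "s \<in> {-\<epsilon><..<\<epsilon>}"
      then have "cl s = s" by (simp add: cl_def)
      then show "z0 + (I \<gamma> s - I \<gamma> 0) = \<gamma> s" by (simp add: \<gamma> T_def) (simp add: \<gamma>_def)
    qed
  qed
  ultimately show ?thesis using \<epsilon>(1) by blast
qed

text \<open>Compactness bounds the derivative in each basis direction, the sum of these bounds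
  controls the operator norm, and convexity of the ball allows the mean value inequality.\<close>

lemma Ck_on_lipschitz_cball:
  fixes F :: "'a::euclidean_space \<Rightarrow> 'b::real_normed_vector"
  assumes "open U" "cball z r \<subseteq> U" "Ck_on (Suc 0) U F"
  shows "\<exists>K\<ge>0. \<forall>x\<in>cball z r. \<forall>y\<in>cball z r. norm (F x - F y) \<le> K * norm (x - y)"
proof -
  have "\<exists>M. \<forall>x\<in>cball z r. norm (frechet_derivative F (at x) b) \<le> M" for b
  proof -
    have "continuous_on (cball z r) (\<lambda>x. frechet_derivative F (at x) b)"
      by (rule continuous_on_subset[OF Ck_on_continuous[OF Ck_on_Suc_frechet_derivative[OF assms(3)]] assms(2)])
    then have "bounded ((\<lambda>x. frechet_derivative F (at x) b) ` cball z r)"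
      by (intro compact_imp_bounded compact_continuous_image) simp_all
    then show ?thesis by (auto simp: bounded_iff)
  qed
  then obtain M where M: "\<And>b x. x \<in> cball z r \<Longrightarrow> norm (frechet_derivative F (at x) b) \<le> M b" by metis
  define K where "K = max 0 (\<Sum>b\<in>Basis. M b)"
  have der: "(F has_derivative frechet_derivative F (at x)) (at x)" if "x \<in> cball z r" for x
    by (rule Ck_on_Suc_has_derivative[OF assms(1,3)]) (use that assms(2) in blast)
  have "norm (frechet_derivative F (at x) v) \<le> K * norm v" if x: "x \<in> cball z r" for x v
  proof -
    interpret bounded_linear "frechet_derivative F (at x)" using der[OF x] by (rule has_derivative_bounded_linear)
    have "frechet_derivative F (at x) v = frechet_derivative F (at x) (\<Sum>b\<in>Basis. (v \<bullet> b) *\<^sub>R b)"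
      by (simp add: euclidean_representation)
    also have "\<dots> = (\<Sum>b\<in>Basis. (v \<bullet> b) *\<^sub>R frechet_derivative F (at x) b)"
      by (simp add: sum scaleR)
    also have "norm \<dots> \<le> (\<Sum>b\<in>Basis. norm v * M b)"
    proof (rule sum_norm_le)
      fix b :: 'a assume "b \<in> Basis"
      then show "norm ((v \<bullet> b) *\<^sub>R frechet_derivative F (at x) b) \<le> norm v * M b"
        using M[OF x, of b] Basis_le_norm[of b v] by (auto intro: mult_mono)
    qed
    also have "\<dots> = (\<Sum>b\<in>Basis. M b) * norm v" by (simp add: sum_distrib_left mult.commute)
    also have "\<dots> \<le> K * norm v" by (rule mult_right_mono) (simp_all add: K_def)
    finally show ?thesis .
  qed
  then have on: "onorm (frechet_derivative F (at x)) \<le> K" if "x \<in> cball z r" for x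
    using that by (intro onorm_le) blast
  have "norm (F x - F y) \<le> K * norm (x - y)" if "x \<in> cball z r" "y \<in> cball z r" for x y
    by (rule differentiable_bound[OF convex_cball has_derivative_at_withinI[OF der] on]) (use that in blast)+
  then show ?thesis by (intro exI[of _ K]) (auto simp: K_def)
qed

lemma local_flow_curve:
  fixes F :: "'a::euclidean_space \<Rightarrow> 'a"
  assumes U: "open U" "z0 \<in> U" and F: "smooth_on U F"
  shows "\<exists>\<epsilon>>0. \<exists>\<gamma>. smooth_on {-\<epsilon><..<\<epsilon>} \<gamma> \<and> \<gamma> 0 = z0 \<and>
    (\<forall>t\<in>{-\<epsilon><..<\<epsilon>}. \<gamma> t \<in> U \<and> (\<gamma> has_vector_derivative F (\<gamma> t)) (at t))"
proof -
  obtain r where r: "r > 0" "cball z0 r \<subseteq> U" using open_contains_cball[of U] U by blast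
  obtain K where K: "K \<ge> 0" "\<And>x y. x \<in> cball z0 r \<Longrightarrow> y \<in> cball z0 r \<Longrightarrow> norm (F x - F y) \<le> K * norm (x - y)"
    using Ck_on_lipschitz_cball[OF U(1) r(2) smooth_onD[OF F]] by blast
  \<comment> \<open>The nearest point projection does not increase distances, so \<open>F\<close>
    composed with it is globally Lipschitz and agrees with \<open>F\<close> on the ball. By
    continuity the solution stays in the ball for a short time, where it solves the original
    equation.\<close>
  let ?c = "closest_point (cball z0 r)"
  have c: "?c x \<in> cball z0 r" for x using closest_point_in_set[of "cball z0 r"] r(1) by simp
  have "norm (F (?c x) - F (?c y)) \<le> K * norm (x - y)" for x y
  proof -
    have "norm (?c x - ?c y) \<le> norm (x - y)"
      using closest_point_lipschitz[of "cball z0 r" x y] r(1) by (simp add: dist_norm)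
    then show ?thesis using K(2)[OF c c, of x y] K(1) by (meson mult_left_mono order_trans)
  qed
  from global_picard[of "\<lambda>x. F (?c x)", OF this K(1), of z0] obtain \<epsilon> \<gamma> where
    \<epsilon>: "\<epsilon> > 0" and \<gamma>0: "\<gamma> 0 = z0" and \<gamma>: "\<And>t. t \<in> {-\<epsilon><..<\<epsilon>} \<Longrightarrow> (\<gamma> has_vector_derivative F (?c (\<gamma> t))) (at t)"
    by blast
  have "continuous (at 0) \<gamma>" using \<gamma>[of 0] \<epsilon> has_vector_derivative_continuous by force
  then obtain \<delta> where \<delta>: "\<delta> > 0" "\<And>t. \<bar>t\<bar> < \<delta> \<Longrightarrow> dist (\<gamma> t) z0 < r"
    using r(1) \<gamma>0 unfolding continuous_at_eps_delta by (auto simp: dist_real_def)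
  define e where "e = min \<epsilon> \<delta>"
  have e: "e > 0" using \<epsilon> \<delta> by (simp add: e_def)
  have inb: "\<gamma> t \<in> cball z0 r" if "t \<in> {-e<..<e}" for t
  proof -
    have "\<bar>t\<bar> < \<delta>" using that by (auto simp: e_def)
    then show ?thesis using \<delta>(2)[of t] by (simp add: dist_commute less_eq_real_def)
  qed
  have der: "(\<gamma> has_vector_derivative F (\<gamma> t)) (at t)" if t: "t \<in> {-e<..<e}" for t
  proof -
    have "t \<in> {-\<epsilon><..<\<epsilon>}" using t by (auto simp: e_def)
    then show ?thesis using \<gamma>[of t] closest_point_self[OF inb[OF t]] by simp
  qed
  \<comment> \<open>Bootstrapping: the derivative of \<open>\<gamma>\<close> is \<open>F\<close>
    composed with \<open>\<gamma>\<close>, so each order of smoothness of the curve yields the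
    next.\<close>
  have "Ck_on k {-e<..<e} \<gamma>" for k
  proof (induction k)
    case 0
    have "continuous (at t) \<gamma>" if "t \<in> {-e<..<e}" for t using has_vector_derivative_continuous[OF der[OF that]] .
    then show ?case by (simp add: continuous_at_imp_continuous_on)
  next
    case (Suc k)
    have "Ck_on k {-e<..<e} (\<lambda>t. F (\<gamma> t))"
      by (rule Ck_on_compose[OF open_greaterThanLessThan U(1) _ Suc smooth_onD[OF F]]) (use inb r(2) in blast)
    then have "Ck_on k {-e<..<e} (\<lambda>t. v *\<^sub>R F (\<gamma> t))" for v
      by (rule Ck_on_bounded_linear[OF open_greaterThanLessThan bounded_linear_scaleR_right])
    then show ?case
      using der unfolding has_vector_derivative_def
      by (intro Ck_on_SucI[where D = "\<lambda>t v. v *\<^sub>R F (\<gamma> t)", OF open_greaterThanLessThan]) blast+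
  qed
  then have "smooth_on {-e<..<e} \<gamma>" by (rule smooth_onI)
  moreover have "\<forall>t\<in>{-e<..<e}. \<gamma> t \<in> U \<and> (\<gamma> has_vector_derivative F (\<gamma> t)) (at t)"
    using der inb r(2) by blast
  ultimately show ?thesis using e \<gamma>0 by blast
qed

section \<open>Symmetry of second derivatives\<close>

text \<open>The mean value theorem, applied first along \<open>u\<close> and then along
  \<open>v\<close>, turns the quotient into the mixed derivative at a point of the small
  parallelogram. The numerator is symmetric in \<open>u\<close> and \<open>v\<close>, which is the
  source of the symmetry of the limit. The values are real because of the mean value
  theorem.\<close>

lemma second_difference_quotient:
  fixes g :: "'a::real_normed_vector \<Rightarrow> real"
  assumes U: "open U" "x \<in> U" and g: "smooth_on U g" and e: "e > 0"
  shows "\<exists>\<delta>>0. \<forall>s. 0 < s \<and> s < \<delta> \<longrightarrow>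
    \<bar>(g (x + s *\<^sub>R u + s *\<^sub>R v) - g (x + s *\<^sub>R u) - g (x + s *\<^sub>R v) + g x) / s\<^sup>2
      - frechet_derivative (\<lambda>y. frechet_derivative g (at y) u) (at x) v\<bar> < e"
proof -
  let ?gu = "\<lambda>y. frechet_derivative g (at y) u"
  let ?guv = "\<lambda>y. frechet_derivative ?gu (at y) v"
  have "continuous_on U ?guv" using g by (intro smooth_on_continuous_on smooth_on_frechet_derivative)
  then have "continuous (at x) ?guv" using U continuous_on_eq_continuous_at by blast
  then obtain d1 where d1: "d1 > 0" "\<And>y. dist y x < d1 \<Longrightarrow> \<bar>?guv y - ?guv x\<bar> < e"
    unfolding continuous_at_eps_delta using e by (auto simp: dist_real_def)
  obtain d2 where d2: "d2 > 0" "ball x d2 \<subseteq> U" using U open_contains_ball by blast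
  define d where "d = min d1 d2"
  define \<delta> where "\<delta> = d / (norm u + norm v + 1)"
  have dpos: "d > 0" using d1 d2 by (simp add: d_def)
  have npos: "norm u + norm v + 1 > 0" by (smt (verit) norm_ge_zero)
  have \<delta>: "\<delta> > 0" using dpos npos by (simp add: \<delta>_def)
  have near: "dist (x + a *\<^sub>R u + b *\<^sub>R v) x < d" if "0 \<le> a" "a \<le> s" "0 \<le> b" "b \<le> s" "s < \<delta>" for a b s
  proof -
    have "norm (a *\<^sub>R u + b *\<^sub>R v) \<le> a * norm u + b * norm v"
      using norm_triangle_ineq[of "a *\<^sub>R u" "b *\<^sub>R v"] that by simp
    also have "\<dots> \<le> s * norm u + s * norm v" using that by (intro add_mono mult_right_mono) simp_all
    also have "\<dots> \<le> s * (norm u + norm v + 1)" using that by (simp add: algebra_simps)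
    also have "\<dots> < \<delta> * (norm u + norm v + 1)" using that npos by (intro mult_strict_right_mono) simp_all
    also have "\<dots> = d" using npos by (simp add: \<delta>_def)
    finally show ?thesis by (simp add: dist_norm add.assoc)
  qed
  show ?thesis
  proof (intro exI[of _ \<delta>] conjI allI impI \<delta>)
    fix s assume s: "0 < s \<and> s < \<delta>"
    have inU: "x + a *\<^sub>R u + b *\<^sub>R v \<in> U" if "0 \<le> a" "a \<le> s" "0 \<le> b" "b \<le> s" for a b
      using near[OF that] s d2(2) by (auto simp: d_def dist_commute)
    have der1: "((\<lambda>a. g (x + a *\<^sub>R u + b *\<^sub>R v)) has_real_derivative ?gu (x + a *\<^sub>R u + b *\<^sub>R v)) (at a)"
      if "0 \<le> a" "a \<le> s" "0 \<le> b" "b \<le> s" for a b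
    proof -
      have 1: "((\<lambda>a. x + a *\<^sub>R u + b *\<^sub>R v) has_derivative (\<lambda>h. h *\<^sub>R u)) (at a)"
        by (auto intro!: derivative_eq_intros)
      have 2: "(g has_derivative frechet_derivative g (at (x + a *\<^sub>R u + b *\<^sub>R v))) (at (x + a *\<^sub>R u + b *\<^sub>R v))"
        by (rule smooth_on_has_derivative[OF U(1) g inU[OF that]])
      have "((\<lambda>a. g (x + a *\<^sub>R u + b *\<^sub>R v)) has_derivative (\<lambda>h. frechet_derivative g (at (x + a *\<^sub>R u + b *\<^sub>R v)) (h *\<^sub>R u))) (at a)"
        by (rule has_derivative_compose[OF 1 2])
      then show ?thesis
        unfolding has_field_derivative_def
        by (rule has_derivative_eq_rhs)
          (simp add: fun_eq_iff linear_cmul[OF has_derivative_linear[OF 2]] mult.commute)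
    qed
    have der2: "((\<lambda>b. ?gu (x + a *\<^sub>R u + b *\<^sub>R v)) has_real_derivative ?guv (x + a *\<^sub>R u + b *\<^sub>R v)) (at b)"
      if "0 \<le> a" "a \<le> s" "0 \<le> b" "b \<le> s" for a b
    proof -
      have 1: "((\<lambda>b. x + a *\<^sub>R u + b *\<^sub>R v) has_derivative (\<lambda>h. h *\<^sub>R v)) (at b)"
        by (auto intro!: derivative_eq_intros)
      have 2: "(?gu has_derivative frechet_derivative ?gu (at (x + a *\<^sub>R u + b *\<^sub>R v))) (at (x + a *\<^sub>R u + b *\<^sub>R v))"
        by (rule smooth_on_has_derivative[OF U(1) smooth_on_frechet_derivative[OF g] inU[OF that]])
      have "((\<lambda>b. ?gu (x + a *\<^sub>R u + b *\<^sub>R v)) has_derivative (\<lambda>h. frechet_derivative ?gu (at (x + a *\<^sub>R u + b *\<^sub>R v)) (h *\<^sub>R v))) (at b)"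
        by (rule has_derivative_compose[OF 1 2])
      then show ?thesis
        unfolding has_field_derivative_def
        by (rule has_derivative_eq_rhs)
          (simp add: fun_eq_iff linear_cmul[OF has_derivative_linear[OF 2]] mult.commute)
    qed
    have "\<exists>a>0. a < s \<and> (g (x + s *\<^sub>R u + s *\<^sub>R v) - g (x + s *\<^sub>R u + 0 *\<^sub>R v)) - (g (x + 0 *\<^sub>R u + s *\<^sub>R v) - g (x + 0 *\<^sub>R u + 0 *\<^sub>R v))
        = (s - 0) * (?gu (x + a *\<^sub>R u + s *\<^sub>R v) - ?gu (x + a *\<^sub>R u + 0 *\<^sub>R v))"
      by (rule MVT2[where f = "\<lambda>a. g (x + a *\<^sub>R u + s *\<^sub>R v) - g (x + a *\<^sub>R u + 0 *\<^sub>R v)"])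
        (use s in \<open>simp, intro DERIV_diff der1, linarith+\<close>)
    then obtain a where a: "0 < a" "a < s" "g (x + s *\<^sub>R u + s *\<^sub>R v) - g (x + s *\<^sub>R u) - g (x + s *\<^sub>R v) + g x
        = s * (?gu (x + a *\<^sub>R u + s *\<^sub>R v) - ?gu (x + a *\<^sub>R u))" by (auto simp: algebra_simps)
    have "\<exists>b>0. b < s \<and> ?gu (x + a *\<^sub>R u + s *\<^sub>R v) - ?gu (x + a *\<^sub>R u + 0 *\<^sub>R v) = (s - 0) * ?guv (x + a *\<^sub>R u + b *\<^sub>R v)"
      by (rule MVT2[where f = "\<lambda>b. ?gu (x + a *\<^sub>R u + b *\<^sub>R v)"]) (use s a in \<open>simp, intro der2, linarith+\<close>)
    then obtain b where b: "0 < b" "b < s" "?gu (x + a *\<^sub>R u + s *\<^sub>R v) - ?gu (x + a *\<^sub>R u) = s * ?guv (x + a *\<^sub>R u + b *\<^sub>R v)"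
      by auto
    have "(g (x + s *\<^sub>R u + s *\<^sub>R v) - g (x + s *\<^sub>R u) - g (x + s *\<^sub>R v) + g x) / s\<^sup>2 = ?guv (x + a *\<^sub>R u + b *\<^sub>R v)"
      unfolding a(3) b(3) using s by (simp add: power2_eq_square)
    moreover have "\<bar>?guv (x + a *\<^sub>R u + b *\<^sub>R v) - ?guv x\<bar> < e"
      using near[of a s b] a b s by (intro d1(2)) (simp add: d_def)
    ultimately show "\<bar>(g (x + s *\<^sub>R u + s *\<^sub>R v) - g (x + s *\<^sub>R u) - g (x + s *\<^sub>R v) + g x) / s\<^sup>2 - ?guv x\<bar> < e"
      by simp
  qed
qed

lemma symmetric_second_derivative_real:
  fixes g :: "'a::real_normed_vector \<Rightarrow> real"
  assumes U: "open U" "x \<in> U" and g: "smooth_on U g"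
  shows "frechet_derivative (\<lambda>y. frechet_derivative g (at y) u) (at x) v
    = frechet_derivative (\<lambda>y. frechet_derivative g (at y) v) (at x) u" (is "?a = ?b")
proof (rule ccontr)
  assume "?a \<noteq> ?b"
  \<comment> \<open>Half the gap: a single number cannot be closer than this to both values.\<close>
  define e where "e = \<bar>?a - ?b\<bar> / 2"
  have e: "e > 0" using \<open>?a \<noteq> ?b\<close> by (simp add: e_def)
  obtain d1 where d1: "d1 > 0" "\<And>s. 0 < s \<Longrightarrow> s < d1 \<Longrightarrow>
      \<bar>(g (x + s *\<^sub>R u + s *\<^sub>R v) - g (x + s *\<^sub>R u) - g (x + s *\<^sub>R v) + g x) / s\<^sup>2 - ?a\<bar> < e"
    using second_difference_quotient[OF U g e, of u v] by blast
  obtain d2 where d2: "d2 > 0" "\<And>s. 0 < s \<Longrightarrow> s < d2 \<Longrightarrow>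
      \<bar>(g (x + s *\<^sub>R v + s *\<^sub>R u) - g (x + s *\<^sub>R v) - g (x + s *\<^sub>R u) + g x) / s\<^sup>2 - ?b\<bar> < e"
    using second_difference_quotient[OF U g e, of v u] by blast
  define s where "s = min d1 d2 / 2"
  have s: "0 < s" "s < d1" "s < d2" using d1 d2 by (auto simp: s_def)
  have eq: "g (x + s *\<^sub>R v + s *\<^sub>R u) - g (x + s *\<^sub>R v) - g (x + s *\<^sub>R u) + g x
    = g (x + s *\<^sub>R u + s *\<^sub>R v) - g (x + s *\<^sub>R u) - g (x + s *\<^sub>R v) + g x"
    by (simp add: algebra_simps)
  have "False" if "\<bar>q - a\<bar> < \<bar>a - b\<bar> / 2" "\<bar>q - b\<bar> < \<bar>a - b\<bar> / 2" for q a b :: real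
  proof -
    have "\<bar>a - b\<bar> \<le> \<bar>q - a\<bar> + \<bar>q - b\<bar>" by linarith
    then show False using that by argo
  qed
  from this[OF d1(2)[OF s(1,2), unfolded e_def] d2(2)[OF s(1,3), unfolded eq e_def]] show False .
qed

lemma frechet_derivative_bounded_linear:
  assumes "bounded_linear h" "f differentiable at x"
  shows "frechet_derivative (\<lambda>y. h (f y)) (at x) v = h (frechet_derivative f (at x) v)"
  using frechet_derivative_at[OF bounded_linear.has_derivative[OF assms(1) assms(2)[unfolded frechet_derivative_works]]]
  by metis

lemma smooth_on_differentiable: "open U \<Longrightarrow> smooth_on U f \<Longrightarrow> x \<in> U \<Longrightarrow> f differentiable at x"
  using smooth_on_has_derivative differentiable_def by blast

lemma symmetric_second_derivative:
  fixes f :: "'a::real_normed_vector \<Rightarrow> 'b::euclidean_space"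
  assumes U: "open U" "x \<in> U" and f: "smooth_on U f"
  shows "frechet_derivative (\<lambda>y. frechet_derivative f (at y) u) (at x) v
    = frechet_derivative (\<lambda>y. frechet_derivative f (at y) v) (at x) u"
proof (rule euclidean_eqI)
  fix b :: 'b assume "b \<in> Basis"
  have bl: "bounded_linear (\<lambda>y. y \<bullet> b)" by (rule bounded_linear_inner_left)
  have *: "frechet_derivative (\<lambda>y. frechet_derivative (\<lambda>z. f z \<bullet> b) (at y) w) (at x) w'
     = frechet_derivative (\<lambda>y. frechet_derivative f (at y) w) (at x) w' \<bullet> b" for w w'
  proof -
    have "frechet_derivative (\<lambda>y. frechet_derivative (\<lambda>z. f z \<bullet> b) (at y) w) (at x)
      = frechet_derivative (\<lambda>y. frechet_derivative f (at y) w \<bullet> b) (at x)"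
      by (rule frechet_derivative_cong[OF U])
        (rule frechet_derivative_bounded_linear[OF bl smooth_on_differentiable[OF U(1) f]])
    then show ?thesis
      by (simp add: frechet_derivative_bounded_linear[OF bl
            smooth_on_differentiable[OF U(1) smooth_on_frechet_derivative[OF f] U(2)]])
  qed
  show "frechet_derivative (\<lambda>y. frechet_derivative f (at y) u) (at x) v \<bullet> b
    = frechet_derivative (\<lambda>y. frechet_derivative f (at y) v) (at x) u \<bullet> b"
    unfolding *[symmetric]
    by (rule symmetric_second_derivative_real[OF U smooth_on_bounded_linear[OF U(1) bl f]])
qed

section \<open>Holomorphic functions of several variables\<close>

definition hol_on :: "(complex^'n::finite) set \<Rightarrow> (complex^'n \<Rightarrow> complex) \<Rightarrow> bool" where
  "hol_on U f \<longleftrightarrow> (\<forall>z\<in>U. \<exists>a::complex^'n. (f has_derivative (\<lambda>v. \<Sum>j\<in>UNIV. a $ j * v $ j)) (at z))"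

lemma sum_mult_axis: "(\<Sum>k\<in>UNIV. a k * axis j c $ k) = a j * (c::complex)"
proof -
  have "(\<Sum>k\<in>UNIV. a k * axis j c $ k) = (\<Sum>k\<in>UNIV. if k = j then a j * c else 0)"
    by (rule sum.cong) (auto simp: axis_def)
  then show ?thesis by simp
qed

lemma d_z_eqI:
  assumes "(f has_derivative (\<lambda>v. \<Sum>j\<in>UNIV. a $ j * v $ j)) (at z)"
  shows "d_z j f z = a $ j" "d_zbar j f z = 0"
  unfolding d_z_def d_zbar_def frechet_derivative_at[OF assms, symmetric] sum_mult_axis by (simp_all add: mult.commute)

lemma hol_on_has_derivative:
  assumes "hol_on U f" "z \<in> U"
  shows "(f has_derivative (\<lambda>v. \<Sum>j\<in>UNIV. d_z j f z * v $ j)) (at z)"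
proof -
  obtain a where a: "(f has_derivative (\<lambda>v. \<Sum>j\<in>UNIV. a $ j * v $ j)) (at z)"
    using assms by (auto simp: hol_on_def)
  then show ?thesis using d_z_eqI(1)[OF a] by simp
qed

lemma hol_on_d_zbar: "hol_on U f \<Longrightarrow> z \<in> U \<Longrightarrow> d_zbar j f z = 0"
  unfolding hol_on_def using d_z_eqI(2) by blast

lemma hol_on_subset: "hol_on U f \<Longrightarrow> V \<subseteq> U \<Longrightarrow> hol_on V f"
  by (auto simp: hol_on_def)

lemma hol_on_continuous: "hol_on U f \<Longrightarrow> continuous_on U f"
  by (rule continuous_at_imp_continuous_on) (use hol_on_has_derivative has_derivative_continuous in blast)

lemma norm_smult_complex: "norm (c *s v) = cmod c * norm (v :: complex^'n::finite)"
  by (simp add: norm_vec_def norm_mult L2_set_right_distrib)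

lemma hol_onI:
  assumes "\<And>z. z \<in> U \<Longrightarrow> (f has_derivative (\<lambda>v. \<Sum>j\<in>UNIV. a z j * v $ j)) (at z)"
  shows "hol_on U f"
  unfolding hol_on_def
proof
  fix z assume "z \<in> U"
  then show "\<exists>b::complex^'a. (f has_derivative (\<lambda>v. \<Sum>j\<in>UNIV. b $ j * v $ j)) (at z)"
    using assms[of z] by (intro exI[of _ "\<chi> j. a z j"]) simp
qed

lemma hol_on_const: "hol_on U (\<lambda>z. c)"
  by (rule hol_onI[where a = "\<lambda>_ _. 0"]) simp

lemma hol_on_add:
  assumes "hol_on U f" "hol_on U g"
  shows "hol_on U (\<lambda>z. f z + g z)"
proof (rule hol_onI[where a = "\<lambda>z j. d_z j f z + d_z j g z"])
  fix z assume z: "z \<in> U"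
  show "((\<lambda>z. f z + g z) has_derivative (\<lambda>v. \<Sum>j\<in>UNIV. (d_z j f z + d_z j g z) * v $ j)) (at z)"
    using has_derivative_add[OF hol_on_has_derivative[OF assms(1) z] hol_on_has_derivative[OF assms(2) z]]
    by (simp add: distrib_right sum.distrib)
qed

lemma hol_on_mult:
  assumes "hol_on U f" "hol_on U g"
  shows "hol_on U (\<lambda>z. f z * g z)"
proof (rule hol_onI[where a = "\<lambda>z j. f z * d_z j g z + d_z j f z * g z"])
  fix z assume z: "z \<in> U"
  have "((\<lambda>z. f z * g z) has_derivative
      (\<lambda>v. f z * (\<Sum>j\<in>UNIV. d_z j g z * v $ j) + (\<Sum>j\<in>UNIV. d_z j f z * v $ j) * g z)) (at z)"
    by (rule has_derivative_mult[OF hol_on_has_derivative[OF assms(1) z] hol_on_has_derivative[OF assms(2) z]])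
  then show "((\<lambda>z. f z * g z) has_derivative (\<lambda>v. \<Sum>j\<in>UNIV. (f z * d_z j g z + d_z j f z * g z) * v $ j)) (at z)"
    by (rule has_derivative_eq_rhs)
      (simp add: fun_eq_iff sum_distrib_left sum_distrib_right sum.distrib[symmetric] algebra_simps)
qed

lemma hol_on_sum:
  assumes "\<And>i. i \<in> I \<Longrightarrow> hol_on U (f i)"
  shows "hol_on U (\<lambda>z. \<Sum>i\<in>I. f i z)"
  using assms
proof (induction I rule: infinite_finite_induct)
  case (insert i I)
  have "hol_on U (\<lambda>z. f i z + (\<Sum>i\<in>I. f i z))" by (rule hol_on_add) (use insert in simp_all)
  then show ?case using insert by simp
qed (simp_all add: hol_on_const)

lemma hol_on_prod:
  assumes "\<And>i. i \<in> I \<Longrightarrow> hol_on U (f i)"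
  shows "hol_on U (\<lambda>z. \<Prod>i\<in>I. f i z)"
  using assms
proof (induction I rule: infinite_finite_induct)
  case (insert i I)
  have "hol_on U (\<lambda>z. f i z * (\<Prod>i\<in>I. f i z))" by (rule hol_on_mult) (use insert in simp_all)
  then show ?case using insert by simp
qed (simp_all add: hol_on_const)

lemma hol_on_det:
  fixes A :: "complex^'n::finite \<Rightarrow> complex^'m::finite^'m"
  assumes "\<And>i j. hol_on U (\<lambda>z. A z $ i $ j)"
  shows "hol_on U (\<lambda>z. det (A z))"
  unfolding det_def by (intro hol_on_sum hol_on_mult hol_on_prod hol_on_const assms)

section \<open>Restriction to complex lines and Cauchy estimates\<close>

text \<open>On a complex line one-variable complex analysis applies; the estimates and the identity
  theorem below are all obtained on such lines.\<close>

lemma hol_on_line: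
  assumes "hol_on U f" "z + w *s v \<in> U"
  shows "((\<lambda>w. f (z + w *s v)) has_field_derivative (\<Sum>j\<in>UNIV. d_z j f (z + w *s v) * v $ j)) (at w)"
proof -
  have bl: "bounded_linear (\<lambda>w::complex. w *s v)"
    by (rule linear_conv_bounded_linear[THEN iffD1], rule linearI) (auto simp: vec_eq_iff algebra_simps)
  have 1: "((\<lambda>w. z + w *s v) has_derivative (\<lambda>w. w *s v)) (at w)"
    using has_derivative_add[OF has_derivative_const bounded_linear_imp_has_derivative[OF bl]] by simp
  have "((\<lambda>w. f (z + w *s v)) has_derivative (\<lambda>h. \<Sum>j\<in>UNIV. d_z j f (z + w *s v) * (h *s v) $ j)) (at w)"
    by (rule has_derivative_compose[OF 1 hol_on_has_derivative[OF assms]])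
  then show ?thesis unfolding has_field_derivative_def
    by (rule has_derivative_eq_rhs) (simp add: fun_eq_iff sum_distrib_left sum_distrib_right mult_ac)
qed

lemma hol_on_line_holomorphic:
  assumes "hol_on U f" "\<And>w. w \<in> S \<Longrightarrow> z + w *s v \<in> U"
  shows "(\<lambda>w. f (z + w *s v)) holomorphic_on S"
  unfolding holomorphic_on_def field_differentiable_def
  using hol_on_line[OF assms(1)] assms(2) has_field_derivative_at_within by blast

lemma hol_on_cauchy_bound:
  assumes f: "hol_on U f" and U: "cball z s \<subseteq> U" "s > 0" and B: "\<And>y. y \<in> cball z s \<Longrightarrow> cmod (f y) \<le> B"
  shows "cmod (d_z j f z) \<le> B / s"
proof -
  have inb: "z + w *s axis j 1 \<in> cball z s" if "w \<in> cball 0 s" for w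
    using that by (simp add: dist_norm norm_smult_complex norm_axis_1)
  then have inU: "z + w *s axis j 1 \<in> U" if "w \<in> cball 0 s" for w using U that by blast
  have "cmod ((deriv ^^ 1) (\<lambda>w. f (z + w *s axis j 1)) 0) \<le> fact 1 * B / s ^ 1"
  proof (rule Cauchy_inequality)
    have hol: "(\<lambda>w. f (z + w *s axis j 1)) holomorphic_on cball 0 s"
      by (rule hol_on_line_holomorphic[OF f inU])
    show "(\<lambda>w. f (z + w *s axis j 1)) holomorphic_on ball 0 s"
      by (rule holomorphic_on_subset[OF hol]) simp
    show "continuous_on (cball 0 s) (\<lambda>w. f (z + w *s axis j 1))"
      by (rule holomorphic_on_imp_continuous_on[OF hol])
    fix x :: complex assume "cmod (0 - x) = s"
    then show "cmod (f (z + x *s axis j 1)) \<le> B" by (intro B inb) simp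
  qed (rule U(2))
  moreover have "deriv (\<lambda>w. f (z + w *s axis j 1)) 0 = d_z j f z"
    using DERIV_imp_deriv[OF hol_on_line[OF f inU[of 0]]] U(2) by (simp add: sum_mult_axis)
  ultimately show ?thesis by simp
qed

text \<open>Taylor's formula of first order along the line in direction \<open>axis j 1\<close>.
  Cauchy's estimate on discs of radius \<open>r\<close> centred in a disc of radius \<open>r\<close>
  bounds the second derivative by \<open>2 * B / r\<^sup>2\<close>, whence the ball of radius
  \<open>2 * r\<close>. The bound depends on \<open>z\<close> only through \<open>B\<close> and
  \<open>r\<close>, so it is uniform.\<close>

lemma hol_on_difference_quotient:
  assumes f: "hol_on U f" and r: "r > 0" "cball z (2 * r) \<subseteq> U"
    and B: "\<And>y. y \<in> cball z (2 * r) \<Longrightarrow> cmod (f y) \<le> B" and h: "0 < h" "h \<le> r"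
  shows "cmod ((f (z + complex_of_real h *s axis j 1) - f z) / complex_of_real h - d_z j f z) \<le> 2 * B / r\<^sup>2 * h"
proof -
  let ?\<phi> = "\<lambda>w. f (z + w *s axis j 1)"
  have inb: "z + w *s axis j 1 \<in> cball z (2 * r)" if "w \<in> cball 0 (2 * r)" for w
    using that by (simp add: dist_norm norm_smult_complex norm_axis_1)
  then have inU: "z + w *s axis j 1 \<in> U" if "w \<in> cball 0 (2 * r)" for w using r that by blast
  have hol: "?\<phi> holomorphic_on cball 0 (2 * r)" by (rule hol_on_line_holomorphic[OF f inU])
  have holb: "?\<phi> holomorphic_on ball 0 (2 * r)" by (rule holomorphic_on_subset[OF hol]) simp
  have sub: "cball w r \<subseteq> cball 0 (2 * r)" if "w \<in> cball 0 r" for w :: complex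
  proof
    fix y assume "y \<in> cball w r"
    then show "y \<in> cball 0 (2 * r)" using that norm_triangle_ineq2[of y w] by (simp add: dist_norm norm_minus_commute)
  qed
  have "cmod ((deriv ^^ 0) ?\<phi> (complex_of_real h) -
      (\<Sum>i\<le>1. (deriv ^^ i) ?\<phi> 0 * (complex_of_real h - 0) ^ i / fact i))
      \<le> 2 * B / r\<^sup>2 * cmod (complex_of_real h - 0) ^ Suc 1 / fact 1"
  proof (rule complex_Taylor[where S = "cball 0 r" and f = "\<lambda>i. (deriv ^^ i) ?\<phi>"])
    fix i x assume x: "x \<in> cball (0::complex) r"
    have "(deriv ^^ i) ?\<phi> holomorphic_on ball 0 (2 * r)"
      by (rule holomorphic_higher_deriv[OF holb open_ball])
    moreover have "x \<in> ball 0 (2 * r)" using x r by simp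
    ultimately have "((deriv ^^ i) ?\<phi> has_field_derivative deriv ((deriv ^^ i) ?\<phi>) x) (at x)"
      using holomorphic_derivI[OF _ open_ball] by blast
    then show "((deriv ^^ i) ?\<phi> has_field_derivative (deriv ^^ Suc i) ?\<phi> x) (at x within cball 0 r)"
      by (simp add: has_field_derivative_at_within)
  next
    fix x assume x: "x \<in> cball (0::complex) r"
    have "cmod ((deriv ^^ 2) ?\<phi> x) \<le> fact 2 * B / r ^ 2"
    proof (rule Cauchy_inequality)
      have hx: "?\<phi> holomorphic_on cball x r" by (rule holomorphic_on_subset[OF hol sub[OF x]])
      show "?\<phi> holomorphic_on ball x r" by (rule holomorphic_on_subset[OF hx]) simp
      show "continuous_on (cball x r) ?\<phi>" by (rule holomorphic_on_imp_continuous_on[OF hx])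
      fix y assume "cmod (x - y) = r"
      then have "y \<in> cball x r" by (simp add: dist_norm)
      then show "cmod (?\<phi> y) \<le> B" using sub[OF x] by (intro B inb) blast
    qed (rule r(1))
    then show "cmod ((deriv ^^ Suc 1) ?\<phi> x) \<le> 2 * B / r\<^sup>2" by (simp add: numeral_2_eq_2)
  qed (use r h in \<open>simp_all\<close>)
  moreover have "deriv ?\<phi> 0 = d_z j f z"
    using DERIV_imp_deriv[OF hol_on_line[OF f inU[of 0]]] r(1) by (simp add: sum_mult_axis)
  ultimately have le: "cmod (f (z + complex_of_real h *s axis j 1) - (f z + d_z j f z * complex_of_real h)) \<le> 2 * B / r\<^sup>2 * h\<^sup>2"
    using h by (simp add: power2_eq_square)
  have "(f (z + complex_of_real h *s axis j 1) - f z) / complex_of_real h - d_z j f z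
    = (f (z + complex_of_real h *s axis j 1) - (f z + d_z j f z * complex_of_real h)) / complex_of_real h"
    using h by (simp add: field_simps)
  then have "cmod ((f (z + complex_of_real h *s axis j 1) - f z) / complex_of_real h - d_z j f z)
    = cmod (f (z + complex_of_real h *s axis j 1) - (f z + d_z j f z * complex_of_real h)) / h"
    using h by (simp add: norm_divide)
  also have "\<dots> \<le> (2 * B / r\<^sup>2 * h\<^sup>2) / h" using le h by (intro divide_right_mono) simp_all
  also have "\<dots> = 2 * B / r\<^sup>2 * h" using h by (simp add: power2_eq_square)
  finally show ?thesis .
qed

lemma hol_on_translate:
  assumes "hol_on U f" "\<And>z. z \<in> V \<Longrightarrow> z + c \<in> U"
  shows "hol_on V (\<lambda>z. f (z + c))"
proof (rule hol_onI)
  fix z assume "z \<in> V"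
  have 1: "((\<lambda>z. z + c) has_derivative (\<lambda>v. v)) (at z)"
    using has_derivative_add[OF has_derivative_ident has_derivative_const] by simp
  show "((\<lambda>z. f (z + c)) has_derivative (\<lambda>v. \<Sum>j\<in>UNIV. d_z j f (z + c) * v $ j)) (at z)"
    by (rule has_derivative_compose[OF 1 hol_on_has_derivative[OF assms(1) assms(2)[OF \<open>z \<in> V\<close>]]])
qed

text \<open>The difference quotients in the direction \<open>e\<^sub>j\<close> converge uniformly by Taylor's formula, hence
  so do their derivatives by Cauchy's estimate.\<close>
lemma hol_on_d_z:
  fixes f :: "complex^'n::finite \<Rightarrow> complex"
  assumes U: "open U" and f: "hol_on U f"
  shows "hol_on U (d_z j f)"
  unfolding hol_on_def
proof
  fix z0 assume "z0 \<in> U"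
  then obtain R where R: "R > 0" "cball z0 R \<subseteq> U" using U open_contains_cball by blast
  \<comment> \<open>Nested balls: derivatives are compared on radius \<open>r\<close>, the
    difference quotients live on \<open>2 * r\<close>, and Taylor's formula at a point there reaches
    \<open>2 * r\<close> further.\<close>
  define r where "r = R / 4"
  have r: "r > 0" "cball z0 (4 * r) \<subseteq> U" using R by (simp_all add: r_def)
  have "bounded (f ` cball z0 (4 * r))"
    using continuous_on_subset[OF hol_on_continuous[OF f] r(2)]
    by (intro compact_imp_bounded compact_continuous_image) simp_all
  then obtain B where B: "\<And>y. y \<in> cball z0 (4 * r) \<Longrightarrow> cmod (f y) \<le> B"
    unfolding bounded_iff by blast
  have "B \<ge> 0" using B[of z0] r(1) norm_ge_zero[of "f z0"] by (simp add: order_trans[OF norm_ge_zero])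
  define h where "h n = r / (real n + 1)" for n
  have h: "0 < h n" "h n \<le> r" for n using r(1) by (simp_all add: h_def divide_le_eq)
  have hlim: "h \<longlonglongrightarrow> 0"
    unfolding h_def using LIMSEQ_inverse_real_of_nat[THEN tendsto_mult_left, of r]
    by (simp add: divide_inverse add.commute)
  define c where "c n = complex_of_real (h n) *s (axis j 1 :: complex^'n)" for n
  have c: "norm (c n) \<le> r" for n using h[of n] by (simp add: c_def norm_smult_complex norm_axis_1)
  \<comment> \<open>The difference quotient is spelled with sums and products so that the closure
    rules of \<open>hol_on\<close> apply to it literally.\<close>
  define g where "g n z = (f (z + c n) + - 1 * f z) * (1 / complex_of_real (h n))" for n z
  have g_eq: "g n z = (f (z + complex_of_real (h n) *s axis j 1) - f z) / complex_of_real (h n)" for n z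
    by (simp add: g_def c_def)
  have tri: "y \<in> cball z0 (a + b)" if "z \<in> cball z0 a" "y \<in> cball z b" for y z :: "complex^'n" and a b
    using that dist_triangle[of z0 y z] by (simp add: dist_commute)
  have gh: "hol_on (ball z0 (2 * r)) (g n)" for n
    unfolding g_def
  proof (intro hol_on_mult hol_on_add hol_on_const)
    show "hol_on (ball z0 (2 * r)) (\<lambda>z. f (z + c n))"
    proof (rule hol_on_translate[OF f])
      fix z assume "z \<in> ball z0 (2 * r)"
      then have "z + c n \<in> cball z0 (2 * r + r)" using c[of n] by (intro tri[where z = z]) (simp_all add: dist_norm)
      then have "z + c n \<in> cball z0 (4 * r)" using r(1) by simp
      then show "z + c n \<in> U" using r(2) by blast
    qed
    have "ball z0 (2 * r) \<subseteq> cball z0 (4 * r)" using r(1) by auto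
    then show "hol_on (ball z0 (2 * r)) f" using hol_on_subset[OF f] r(2) by blast
  qed
  define C where "C = 2 * B / r\<^sup>2"
  have C: "C \<ge> 0" using \<open>B \<ge> 0\<close> by (simp add: C_def)
  have gd: "cmod (g n z - d_z j f z) \<le> C * h n" if z: "z \<in> cball z0 (2 * r)" for n z
    unfolding g_eq C_def
  proof (rule hol_on_difference_quotient[OF f r(1) _ _ h])
    have "cball z (2 * r) \<subseteq> cball z0 (4 * r)" using tri[OF z, of _ "2 * r"] by auto
    then show "cball z (2 * r) \<subseteq> U" "\<And>y. y \<in> cball z (2 * r) \<Longrightarrow> cmod (f y) \<le> B" using r(2) B by blast+
  qed
  have gconv: "(\<lambda>n. g n z) \<longlonglongrightarrow> d_z j f z" if z: "z \<in> cball z0 (2 * r)" for z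
  proof (rule LIM_zero_cancel, rule Lim_null_comparison)
    show "\<forall>\<^sub>F n in sequentially. norm (g n z - d_z j f z) \<le> C * h n"
      by (rule always_eventually, rule allI, rule gd[OF z])
    have "(\<lambda>n. C * h n) \<longlonglongrightarrow> C * 0" by (intro tendsto_intros hlim)
    then show "(\<lambda>n. C * h n) \<longlonglongrightarrow> 0" by simp
  qed
  have gg: "cmod (g n z - g m z) \<le> C * (h n + h m)" if z: "z \<in> cball z0 (2 * r)" for n m z
    using gd[OF z, of n] gd[OF z, of m] norm_triangle_ineq4[of "g n z - d_z j f z" "g m z - d_z j f z"]
    by (simp add: algebra_simps)
  have dzdiff: "d_z k (\<lambda>z. g n z + - 1 * g m z) z = d_z k (g n) z - d_z k (g m) z"
    if z: "z \<in> ball z0 (2 * r)" for k n m z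
  proof -
    have "((\<lambda>z. g n z + - 1 * g m z) has_derivative (\<lambda>v. (\<Sum>k\<in>UNIV. d_z k (g n) z * v $ k)
        + - 1 * (\<Sum>k\<in>UNIV. d_z k (g m) z * v $ k))) (at z)"
      by (intro has_derivative_add has_derivative_mult_right hol_on_has_derivative[OF gh z])
    then have "((\<lambda>z. g n z + - 1 * g m z) has_derivative
        (\<lambda>v. \<Sum>k\<in>UNIV. (\<chi> k. d_z k (g n) z - d_z k (g m) z) $ k * v $ k)) (at z)"
      by (rule has_derivative_eq_rhs) (simp add: fun_eq_iff sum_subtractf left_diff_distrib)
    from d_z_eqI(1)[OF this] show ?thesis by simp
  qed
  have dd: "cmod (d_z k (g n) z - d_z k (g m) z) \<le> C * (h n + h m) / r * 2" if z: "z \<in> ball z0 r" for k n m z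
  proof -
    have z2: "z \<in> ball z0 (2 * r)" using z r(1) by simp
    have sub: "cball z (r / 2) \<subseteq> ball z0 (2 * r)"
    proof
      fix y assume "y \<in> cball z (r / 2)"
      then show "y \<in> ball z0 (2 * r)" using z dist_triangle[of z0 y z] r(1) by (simp add: dist_commute)
    qed
    have "cmod (d_z k (\<lambda>z. g n z + - 1 * g m z) z) \<le> C * (h n + h m) / (r / 2)"
    proof (rule hol_on_cauchy_bound[OF _ sub])
      show "hol_on (ball z0 (2 * r)) (\<lambda>z. g n z + - 1 * g m z)"
        by (intro hol_on_add hol_on_mult hol_on_const gh)
      fix y assume "y \<in> cball z (r / 2)"
      then have "y \<in> cball z0 (2 * r)" using sub by (force simp: less_imp_le)
      then show "cmod (g n y + - 1 * g m y) \<le> C * (h n + h m)" using gg by simp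
    qed (use r in simp)
    then show ?thesis unfolding dzdiff[OF z2] by simp
  qed
  have conv: "\<exists>L. (\<lambda>n. d_z k (g n) z) \<longlonglongrightarrow> L" if z: "z \<in> ball z0 r" for k z
  proof -
    have "Cauchy (\<lambda>n. d_z k (g n) z)"
    proof (rule CauchyI)
      fix e :: real assume e: "e > 0"
      have "(\<lambda>n. C * (h n + h n) / r * 2) \<longlonglongrightarrow> C * (0 + 0) / r * 2"
        by (intro tendsto_intros hlim) (use r in simp)
      then have "(\<lambda>n. C * (h n + h n) / r * 2) \<longlonglongrightarrow> 0" by simp
      then have "\<forall>\<^sub>F n in sequentially. C * (h n + h n) / r * 2 < e" by (rule order_tendstoD(2)[OF _ e])
      then obtain N where N: "C * (h N + h N) / r * 2 < e" unfolding eventually_sequentially by blast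
      have "norm (d_z k (g n) z - d_z k (g m) z) < e" if "N \<le> n" "N \<le> m" for n m
      proof -
        have "h n \<le> h N" "h m \<le> h N" using that r(1) by (auto simp: h_def intro!: divide_left_mono)
        then have "C * (h n + h m) / r * 2 \<le> C * (h N + h N) / r * 2"
          using C r(1) by (intro mult_right_mono divide_right_mono mult_left_mono) simp_all
        then show ?thesis using dd[OF z, of k n m] N by linarith
      qed
      then show "\<exists>M. \<forall>m\<ge>M. \<forall>n\<ge>M. norm (d_z k (g m) z - d_z k (g n) z) < e" by blast
    qed
    then show ?thesis by (simp add: Cauchy_convergent_iff convergent_def)
  qed
  define A where "A z k = lim (\<lambda>n. d_z k (g n) z)" for z k
  have A: "(\<lambda>n. d_z k (g n) z) \<longlonglongrightarrow> A z k" if "z \<in> ball z0 r" for k z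
    using conv[OF that, of k] unfolding A_def convergent_LIMSEQ_iff[symmetric] convergent_def by simp
  have dA: "cmod (d_z k (g n) z - A z k) \<le> C * h n / r * 2" if z: "z \<in> ball z0 r" for k n z
  proof (rule LIMSEQ_le)
    show "(\<lambda>m. cmod (d_z k (g n) z - d_z k (g m) z)) \<longlonglongrightarrow> cmod (d_z k (g n) z - A z k)"
      by (intro tendsto_intros A z)
    have "(\<lambda>m. C * (h n + h m) / r * 2) \<longlonglongrightarrow> C * (h n + 0) / r * 2"
      by (intro tendsto_intros hlim) (use r in simp)
    then show "(\<lambda>m. C * (h n + h m) / r * 2) \<longlonglongrightarrow> C * h n / r * 2" by simp
    show "\<exists>N. \<forall>m\<ge>N. cmod (d_z k (g n) z - d_z k (g m) z) \<le> C * (h n + h m) / r * 2"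
      using dd[OF z] by blast
  qed
  \<comment> \<open>Termwise differentiation under uniform convergence of the differentials. Their
    limit is given by the coefficients \<open>A z k\<close>, hence again complex linear; the factor
    \<open>CARD('n)\<close> below comes from adding the coordinatewise bounds.\<close>
  have "\<exists>G. \<forall>z\<in>ball z0 r. (\<lambda>n. g n z) \<longlonglongrightarrow> G z \<and>
      (G has_derivative (\<lambda>v. \<Sum>k\<in>UNIV. A z k * v $ k)) (at z within ball z0 r)"
  proof (rule has_derivative_sequence[where f' = "\<lambda>n z v. \<Sum>k\<in>UNIV. d_z k (g n) z * v $ k"])
    fix n z assume "z \<in> ball z0 r"
    then have "z \<in> ball z0 (2 * r)" using r(1) by simp
    then show "(g n has_derivative (\<lambda>v. \<Sum>k\<in>UNIV. d_z k (g n) z * v $ k)) (at z within ball z0 r)"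
      by (rule has_derivative_at_withinI[OF hol_on_has_derivative[OF gh]])
  next
    fix e :: real assume e: "e > 0"
    have "(\<lambda>n. real CARD('n) * (C * h n / r * 2)) \<longlonglongrightarrow> real CARD('n) * (C * 0 / r * 2)"
      by (intro tendsto_intros hlim) (use r in simp)
    then have "(\<lambda>n. real CARD('n) * (C * h n / r * 2)) \<longlonglongrightarrow> 0" by simp
    then have "\<forall>\<^sub>F n in sequentially. real CARD('n) * (C * h n / r * 2) < e"
      by (rule order_tendstoD(2)[OF _ e])
    then show "\<forall>\<^sub>F n in sequentially. \<forall>z\<in>ball z0 r. \<forall>v. norm ((\<Sum>k\<in>UNIV. d_z k (g n) z * v $ k)
        - (\<Sum>k\<in>UNIV. A z k * v $ k)) \<le> e * norm v"
    proof eventually_elim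
      case (elim n)
      show ?case
      proof (intro ballI allI)
        fix z and v :: "complex^'n" assume z: "z \<in> ball z0 r"
        have "norm ((\<Sum>k\<in>UNIV. d_z k (g n) z * v $ k) - (\<Sum>k\<in>UNIV. A z k * v $ k))
          = norm (\<Sum>k\<in>UNIV. (d_z k (g n) z - A z k) * v $ k)"
          by (simp add: sum_subtractf left_diff_distrib)
        also have "\<dots> \<le> (\<Sum>k\<in>(UNIV::'n set). C * h n / r * 2 * norm v)"
        proof (rule sum_norm_le)
          fix k
          show "norm ((d_z k (g n) z - A z k) * v $ k) \<le> C * h n / r * 2 * norm v"
            unfolding norm_mult
            by (rule mult_mono[OF dA[OF z] Finite_Cartesian_Product.norm_nth_le _ norm_ge_zero])
              (rule order_trans[OF norm_ge_zero dA[OF z]])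
        qed
        also have "\<dots> = real CARD('n) * (C * h n / r * 2) * norm v" by simp
        also have "\<dots> \<le> e * norm v" by (rule mult_right_mono[OF less_imp_le[OF elim] norm_ge_zero])
        finally show "norm ((\<Sum>k\<in>UNIV. d_z k (g n) z * v $ k) - (\<Sum>k\<in>UNIV. A z k * v $ k)) \<le> e * norm v" .
      qed
    qed
  next
    show "(\<lambda>n. g n z0) \<longlonglongrightarrow> d_z j f z0" by (rule gconv) (use r(1) in simp)
  qed (use r in simp_all)
  then obtain G where G: "\<And>z. z \<in> ball z0 r \<Longrightarrow> (\<lambda>n. g n z) \<longlonglongrightarrow> G z"
    "\<And>z. z \<in> ball z0 r \<Longrightarrow> (G has_derivative (\<lambda>v. \<Sum>k\<in>UNIV. A z k * v $ k)) (at z within ball z0 r)" by blast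
  have Geq: "G z = d_z j f z" if z: "z \<in> ball z0 r" for z
  proof (rule LIMSEQ_unique[OF G(1)[OF z]])
    show "(\<lambda>n. g n z) \<longlonglongrightarrow> d_z j f z" by (rule gconv) (use z r(1) in simp)
  qed
  have z0: "z0 \<in> ball z0 r" using r(1) by simp
  have "(G has_derivative (\<lambda>v. \<Sum>k\<in>UNIV. A z0 k * v $ k)) (at z0)"
    using G(2)[OF z0] unfolding at_within_open[OF z0 open_ball] .
  then have "(d_z j f has_derivative (\<lambda>v. \<Sum>k\<in>UNIV. A z0 k * v $ k)) (at z0)"
    by (rule has_derivative_transform_within_open[OF _ open_ball z0 Geq])
  then show "\<exists>a::complex^'n. (d_z j f has_derivative (\<lambda>v. \<Sum>k\<in>UNIV. a $ k * v $ k)) (at z0)"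
    by (intro exI[of _ "\<chi> k. A z0 k"]) simp
qed

lemma hol_on_smooth_on:
  assumes U: "open U" and f: "hol_on U f"
  shows "smooth_on U f"
proof (rule smooth_onI)
  fix k show "Ck_on k U f" using f
  proof (induction k arbitrary: f)
    case 0
    then show ?case by (simp add: hol_on_continuous)
  next
    case (Suc k)
    have "Ck_on k U (\<lambda>z. \<Sum>j\<in>UNIV. d_z j f z * v $ j)" for v
      by (intro Ck_on_sum[OF U] Ck_on_bounded_bilinear[OF U bounded_bilinear_mult] Ck_on_const[OF U]
          Suc.IH hol_on_d_z[OF U Suc.prems])
    then show ?case
      using Ck_on_SucI[where D = "\<lambda>z v. \<Sum>j\<in>UNIV. d_z j f z * v $ j", OF U hol_on_has_derivative[OF Suc.prems]]
      by blast
  qed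
qed

text \<open>Closure of the class \<open>P\<close> under directional derivatives makes every
  derivative at \<open>p\<close> along the line through \<open>p\<close> and \<open>z\<close>
  vanish, and the one-variable identity theorem applies. An abstract class lets the vanishing come
  from any differential argument, later from words in vector fields.\<close>

lemma hol_on_eq_zero:
  fixes p :: "complex^'n::finite"
  assumes U: "ball p r \<subseteq> U"
    and P: "\<And>h. P h \<Longrightarrow> hol_on U h" "\<And>h. P h \<Longrightarrow> h p = 0"
      "\<And>h v. P h \<Longrightarrow> P (\<lambda>z. \<Sum>j\<in>UNIV. d_z j h z * v $ j)"
    and f: "P f" and z: "z \<in> ball p r"
  shows "f z = 0"
proof (cases "z = p")
  case True
  then show ?thesis using P(2)[OF f] by simp
next
  case False
  define v where "v = z - p"
  have v: "norm v > 0" "norm v < r" using z False by (simp_all add: v_def dist_norm norm_minus_commute)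
  \<comment> \<open>The point \<open>z\<close> has parameter 1 on the line, and
    \<open>\<rho> > 1\<close> is the radius of the parameter disc that the line maps into the
    ball.\<close>
  define \<rho> where "\<rho> = r / norm v"
  have \<rho>: "\<rho> > 1" using v by (simp add: \<rho>_def)
  have inU: "p + w *s v \<in> U" if "w \<in> ball 0 \<rho>" for w
  proof -
    have "cmod w * norm v < r" using that v by (simp add: \<rho>_def less_divide_eq)
    then have "p + w *s v \<in> ball p r" by (simp add: dist_norm norm_smult_complex)
    then show ?thesis using U by blast
  qed
  let ?D = "\<lambda>h z. \<Sum>j\<in>UNIV. d_z j h z * v $ j"
  have PD: "P ((?D ^^ n) f)" for n by (induction n) (use f P(3) in simp_all)
  have der: "(deriv ^^ n) (\<lambda>w. f (p + w *s v)) w = (?D ^^ n) f (p + w *s v)" if "w \<in> ball 0 \<rho>" for n w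
    using that
  proof (induction n arbitrary: w)
    case (Suc n)
    have "((\<lambda>w. (?D ^^ n) f (p + w *s v)) has_field_derivative ?D ((?D ^^ n) f) (p + w *s v)) (at w)"
      by (rule hol_on_line[OF P(1)[OF PD] inU[OF Suc.prems]])
    then have "((deriv ^^ n) (\<lambda>w. f (p + w *s v)) has_field_derivative ?D ((?D ^^ n) f) (p + w *s v)) (at w)"
      by (rule has_field_derivative_transform_within_open[OF _ open_ball Suc.prems]) (simp add: Suc.IH)
    then show ?case by (simp add: DERIV_imp_deriv)
  qed simp
  have "(\<lambda>w. f (p + w *s v)) 1 = 0"
  proof (rule holomorphic_fun_eq_0_on_ball[where f = "\<lambda>w. f (p + w *s v)" and r = \<rho> and z = 0 and w = 1])
    show "(\<lambda>w. f (p + w *s v)) holomorphic_on ball 0 \<rho>"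
      by (rule hol_on_line_holomorphic[OF P(1)[OF f] inU])
    show "1 \<in> ball (0::complex) \<rho>" using \<rho> by simp
    fix n show "(deriv ^^ n) (\<lambda>w. f (p + w *s v)) 0 = 0"
      using der[of 0 n] P(2)[OF PD, of n] \<rho> by simp
  qed
  then show ?thesis by (simp add: v_def)
qed

section \<open>Moving frames and tangent spaces of generic submanifolds\<close>

text \<open>Substituting for \<open>\<alpha> k\<close> leaves sums in which
  \<open>\<alpha> l\<close> occurs at both positions \<open>k\<close> and \<open>l\<close>.
  Composing the permutation with the transposition of these positions changes only the sign, so each
  sum equals its negative.\<close>

lemma wedge_eq_0:
  assumes k: "k < d" and dep: "\<And>v. \<alpha> k v = (\<Sum>l\<in>{..<d} - {k}. c l * \<alpha> l v)"
  shows "wedge d \<alpha> v = 0"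
proof -
  let ?P = "{\<pi>. \<pi> permutes {..<d}}"
  let ?I = "{..<d} - {k}"
  define F where "F l \<pi> = of_int (sign \<pi>) * (\<alpha> l (v (\<pi> k)) * (\<Prod>i\<in>?I. \<alpha> i (v (\<pi> i))))" for l and \<pi> :: "nat \<Rightarrow> nat"
  have prod_k: "(\<Prod>i<d. \<alpha> i (v (\<pi> i))) = (\<Sum>l\<in>?I. c l * (\<alpha> l (v (\<pi> k)) * (\<Prod>i\<in>?I. \<alpha> i (v (\<pi> i)))))" for \<pi>
  proof -
    have "(\<Prod>i<d. \<alpha> i (v (\<pi> i))) = \<alpha> k (v (\<pi> k)) * (\<Prod>i\<in>?I. \<alpha> i (v (\<pi> i)))"
      using k by (intro prod.remove) simp_all
    then show ?thesis unfolding dep[of "v (\<pi> k)"] sum_distrib_right mult.assoc .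
  qed
  have F0: "(\<Sum>\<pi>\<in>?P. F l \<pi>) = 0" if l: "l \<in> ?I" for l
  proof -
    let ?t = "Transposition.transpose k l"
    have t: "?t permutes {..<d}" using k l by (intro permutes_swap_id) simp_all
    have F_split: "F l \<pi> = of_int (sign \<pi>) * (\<alpha> l (v (\<pi> k)) * (\<alpha> l (v (\<pi> l)) * (\<Prod>i\<in>?I - {l}. \<alpha> i (v (\<pi> i)))))" for \<pi>
      unfolding F_def using l by (subst prod.remove[of ?I l]) simp_all
    have "F l (\<pi> \<circ> ?t) = - F l \<pi>" if \<pi>: "\<pi> \<in> ?P" for \<pi>
    proof -
      have "sign (\<pi> \<circ> ?t) = sign \<pi> * sign ?t"
        by (rule sign_compose) (use \<pi> t in \<open>auto intro: permutes_imp_permutation[of "{..<d}"]\<close>)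
      then have s: "sign (\<pi> \<circ> ?t) = - sign \<pi>" using l by (simp add: sign_swap_id)
      have p: "(\<Prod>i\<in>?I - {l}. \<alpha> i (v ((\<pi> \<circ> ?t) i))) = (\<Prod>i\<in>?I - {l}. \<alpha> i (v (\<pi> i)))"
        by (rule prod.cong) (auto simp: transpose_def)
      show ?thesis unfolding F_split p s by simp
    qed
    then have "(\<Sum>\<pi>\<in>?P. F l (\<pi> \<circ> ?t)) = - (\<Sum>\<pi>\<in>?P. F l \<pi>)"
      by (simp add: sum_negf)
    then have "(\<Sum>\<pi>\<in>?P. F l \<pi>) = - (\<Sum>\<pi>\<in>?P. F l \<pi>)"
      using sum_permutations_compose_right[OF t, of "F l"] by simp
    then show ?thesis by simp
  qed
  have "wedge d \<alpha> v = (\<Sum>\<pi>\<in>?P. \<Sum>l\<in>?I. c l * F l \<pi>)"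
    unfolding wedge_def prod_k sum_distrib_left F_def by (simp add: mult.left_commute)
  also have "\<dots> = (\<Sum>l\<in>?I. c l * (\<Sum>\<pi>\<in>?P. F l \<pi>))"
    unfolding sum_distrib_left by (rule sum.swap)
  also have "\<dots> = 0" using F0 by simp
  finally show ?thesis .
qed

lemma wedge_nonzero_independent:
  fixes r :: "nat \<Rightarrow> complex^'n::finite"
  assumes w: "wedge d (\<lambda>i v. \<Sum>j\<in>UNIV. r i $ j * v $ j) \<noteq> (\<lambda>v. 0)"
    and u: "(\<Sum>i<d. u i *s r i) = 0" and k: "k < d"
  shows "u k = 0"
proof (rule ccontr)
  assume uk: "u k \<noteq> 0"
  let ?I = "{..<d} - {k}"
  have a: "(\<Sum>i<d. u i * r i $ j) = 0" for j
    using arg_cong[OF u, of "\<lambda>x. x $ j"] by (simp add: sum_component)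
  have b: "(\<Sum>i<d. u i * r i $ j) = u k * r k $ j + (\<Sum>i\<in>?I. u i * r i $ j)" for j
    using k by (intro sum.remove) simp_all
  have e: "u k * r k $ j = - (\<Sum>i\<in>?I. u i * r i $ j)" for j
    unfolding eq_neg_iff_add_eq_0 b[symmetric] by (rule a)
  have rk: "r k $ j = (\<Sum>i\<in>?I. (- u i / u k) * r i $ j)" for j
  proof -
    have "r k $ j = (u k * r k $ j) / u k" using uk by simp
    also have "\<dots> = (\<Sum>i\<in>?I. (- u i / u k) * r i $ j)"
      unfolding e by (simp add: sum_divide_distrib sum_negf)
    finally show ?thesis .
  qed
  have "wedge d (\<lambda>i v. \<Sum>j\<in>UNIV. r i $ j * v $ j) v = 0" for v
  proof (rule wedge_eq_0[OF k])
    fix v :: "complex^'n"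
    show "(\<Sum>j\<in>UNIV. r k $ j * v $ j) = (\<Sum>l\<in>?I. (- u l / u k) * (\<Sum>j\<in>UNIV. r l $ j * v $ j))"
      unfolding rk sum_distrib_right sum_distrib_left mult.assoc by (rule sum.swap)
  qed
  with w show False by auto
qed

text \<open>The rows are completed to a basis and distributed so that the given ones occupy a
  prescribed set \<open>S\<close> of positions. Prescribing \<open>S\<close> allows coframes of both
  manifolds to be indexed alike; the bound on \<open>d\<close> provides such an
  \<open>S\<close>.\<close>

lemma extend_rows:
  fixes r :: "nat \<Rightarrow> complex^'n::finite"
  assumes ind: "\<And>u k. (\<Sum>i<d. u i *s r i) = 0 \<Longrightarrow> k < d \<Longrightarrow> u k = 0"
  shows "d \<le> CARD('n)"
    and "bij_betw s {..<d} S \<Longrightarrow> \<exists>B. det (\<chi> j. if j \<in> S then r (inv_into {..<d} s j) else B $ j) \<noteq> 0"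
proof -
  have inj: "inj_on r {..<d}"
  proof (rule inj_onI, rule ccontr)
    fix a b assume ab: "a \<in> {..<d}" "b \<in> {..<d}" "r a = r b" "a \<noteq> b"
    \<comment> \<open>If two rows coincided, their difference would be a vanishing combination with
      a coefficient 1.\<close>
    define u where "u i = (if i = a then 1 else 0) - (if i = b then 1 else (0::complex))" for i
    have *: "(\<Sum>i<d. (if i = c then 1 else 0) *s r i) = r c" if "c \<in> {..<d}" for c
    proof -
      have "(\<Sum>i<d. (if i = c then 1 else 0) *s r i) = (\<Sum>i<d. if i = c then r c else 0)"
        by (rule sum.cong) simp_all
      then show ?thesis using that by simp
    qed
    have "(\<Sum>i<d. u i *s r i) = r a - r b"
      unfolding u_def vec.scale_left_diff_distrib sum_subtractf *[OF ab(1)] *[OF ab(2)] ..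
    then have "u a = 0" using ab by (intro ind) simp_all
    then show False using ab(4) by (simp add: u_def)
  qed
  have ind': "vec.independent (r ` {..<d})"
  proof
    assume "vec.dependent (r ` {..<d})"
    then obtain u where u: "(\<Sum>v\<in>r ` {..<d}. u v *s v) = 0" "\<exists>v\<in>r ` {..<d}. u v \<noteq> 0"
      using vec.dependent_finite[of "r ` {..<d}"] by auto
    have "(\<Sum>i<d. u (r i) *s r i) = 0" using u(1) by (simp add: sum.reindex[OF inj])
    then show False using ind[of "\<lambda>i. u (r i)"] u(2) by auto
  qed
  obtain C where C: "r ` {..<d} \<subseteq> C" "vec.independent C" "UNIV \<subseteq> vec.span C"
    by (rule vec.maximal_independent_subset_extend[OF subset_UNIV ind'])
  have finC: "finite C" by (rule vec.finiteI_independent[OF C(2)])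
  have cardC: "card C = CARD('n)"
    unfolding vec.basis_card_eq_dim[OF subset_UNIV C(3,2)] by (rule vec_dim_card)
  have cardr: "card (r ` {..<d}) = d" using card_image[OF inj] by simp
  show "d \<le> CARD('n)" using card_mono[OF finC C(1)] cardC cardr by simp
  assume s: "bij_betw s {..<d} S"
  have cardS: "card S = d" using bij_betw_same_card[OF s] by simp
  have "card (UNIV - S) = card (C - r ` {..<d})"
    using cardS cardr cardC card_Diff_subset[of S UNIV] card_Diff_subset[OF _ C(1)] by simp
  then obtain g where g: "bij_betw g (UNIV - S) (C - r ` {..<d})"
    using finite_same_card_bij[of "UNIV - S" "C - r ` {..<d}"] finC by auto
  let ?s' = "inv_into {..<d} s"
  define f where "f j = (if j \<in> S then r (?s' j) else g j)" for j
  have "bij_betw (r \<circ> ?s') S (r ` {..<d})"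
    by (rule bij_betw_trans[OF bij_betw_inv_into[OF s]]) (simp add: bij_betw_def inj)
  then have f1: "bij_betw f S (r ` {..<d})" by (rule bij_betw_cong[THEN iffD1, rotated]) (simp add: f_def)
  have f2: "bij_betw f (UNIV - S) (C - r ` {..<d})"
    by (rule bij_betw_cong[THEN iffD1, OF _ g]) (simp add: f_def)
  have "bij_betw f (S \<union> (UNIV - S)) (r ` {..<d} \<union> (C - r ` {..<d}))"
    by (rule bij_betw_combine[OF f1 f2]) blast
  then have f: "bij_betw f UNIV C" using C(1) by (simp add: Un_absorb1)
  let ?A = "(\<chi> j. if j \<in> S then r (?s' j) else (\<chi> j. g j) $ j) :: complex^'n^'n"
  have row: "row i ?A = f i" for i by (simp add: row_def f_def vec_eq_iff)
  have "\<exists>B. ?A ** B = mat 1"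
    unfolding matrix_right_invertible_independent_rows row
  proof (intro allI impI)
    fix c i assume c: "(\<Sum>i\<in>UNIV. c i *s f i) = 0"
    let ?u = "\<lambda>v. c (inv_into UNIV f v)"
    have inv: "inv_into UNIV f (f i) = i" for i using f by (simp add: bij_betw_def)
    have "(\<Sum>v\<in>C. ?u v *s v) = (\<Sum>i\<in>UNIV. c i *s f i)"
      using sum.reindex_bij_betw[OF f, of "\<lambda>v. ?u v *s v"] by (simp add: inv)
    then have u0: "(\<Sum>v\<in>C. ?u v *s v) = 0" using c by simp
    have fi: "f i \<in> C" using f by (auto simp: bij_betw_def)
    have "?u (f i) = 0"
    proof (rule ccontr)
      assume "?u (f i) \<noteq> 0"
      with fi have "\<exists>v\<in>C. ?u v \<noteq> 0" by (rule bexI[rotated])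
      with u0 have "vec.dependent C" unfolding vec.dependent_finite[OF finC] by (intro exI[of _ ?u] conjI)
      with C(2) show False by (rule notE)
    qed
    then show "c i = 0" by (simp add: inv)
  qed
  then have "det ?A \<noteq> 0" using invertible_det_nz invertible_right_inverse by blast
  then show "\<exists>B. det (\<chi> j. if j \<in> S then r (?s' j) else B $ j) \<noteq> 0" by blast
qed

section \<open>Adapted coframes of generic submanifolds\<close>

lemma smooth_on_d_z: "open U \<Longrightarrow> smooth_on U f \<Longrightarrow> smooth_on U (d_z j f)"
  unfolding d_z_def[abs_def]
  by (intro smooth_on_divide smooth_on_diff smooth_on_mult smooth_on_const smooth_on_frechet_derivative) simp_all

lemma smooth_on_d_zbar: "open U \<Longrightarrow> smooth_on U f \<Longrightarrow> smooth_on U (d_zbar j f)"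
  unfolding d_zbar_def[abs_def]
  by (intro smooth_on_divide smooth_on_add smooth_on_mult smooth_on_const smooth_on_frechet_derivative) simp_all

text \<open>The rows are (1,0) covectors, so \<open>frame S \<sigma> B z *v v\<close> lists the
  coordinates of \<open>v\<close> in a moving coframe. Constant complementary rows suffice, since
  invertibility at one point persists nearby.\<close>

definition frame ::
    "'n set \<Rightarrow> ('n \<Rightarrow> complex^'n::finite \<Rightarrow> real) \<Rightarrow> complex^'n^'n \<Rightarrow> complex^'n \<Rightarrow> complex^'n^'n" where
  "frame S \<sigma> B z = (\<chi> j. if j \<in> S then \<chi> l. d_z l (\<lambda>z. complex_of_real (\<sigma> j z)) z else B $ j)"

lemma smooth_on_frame:
  assumes "open U" "\<And>j. j \<in> S \<Longrightarrow> smooth_on U (\<sigma> j)"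
  shows "smooth_on U (\<lambda>z. frame S \<sigma> B z $ i $ j)"
proof (cases "i \<in> S")
  case True
  then have "smooth_on U (d_z j (\<lambda>z. complex_of_real (\<sigma> i z)))"
    by (intro smooth_on_d_z smooth_on_of_real assms)
  then show ?thesis using True by (simp add: frame_def)
next
  case False
  then show ?thesis using assms(1) by (simp add: frame_def smooth_on_const)
qed

text \<open>Invertibility is demanded on all of \<open>U\<close>, not only on \<open>M\<close>,
  because the inverse matrix serves as a smooth function on an open set.\<close>

definition adapted_frame ::
    "(complex^'n::finite) set \<Rightarrow> (complex^'n) set \<Rightarrow> 'n set \<Rightarrow> ('n \<Rightarrow> complex^'n \<Rightarrow> real) \<Rightarrow> complex^'n^'n \<Rightarrow> bool" where
  "adapted_frame M U S \<sigma> B \<longleftrightarrow> open U \<and> (\<forall>j\<in>S. smooth_on U (\<sigma> j)) \<and>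
     M \<inter> U = {z\<in>U. \<forall>j\<in>S. \<sigma> j z = 0} \<and> (\<forall>z\<in>U. det (frame S \<sigma> B z) \<noteq> 0)"

lemma generic_submanifold_rows_independent:
  assumes "wedge d (\<lambda>i. del (\<rho> i) z) \<noteq> (\<lambda>v. 0)"
    and "(\<Sum>i<d. u i *s (\<chi> l. d_z l (\<lambda>z. complex_of_real (\<rho> i z)) z)) = 0" "k < d"
  shows "u k = 0"
  by (rule wedge_nonzero_independent[OF _ assms(2,3)]) (use assms(1) in \<open>simp add: del_def[abs_def]\<close>)

lemma generic_submanifold_codim_le:
  fixes M :: "(complex^'n::finite) set"
  assumes "generic_submanifold d M" "q \<in> M"
  shows "d \<le> CARD('n)"
proof -
  obtain U and \<rho> :: "nat \<Rightarrow> complex^'n \<Rightarrow> real" where U: "q \<in> U"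
    and wd: "\<forall>z\<in>M \<inter> U. wedge d (\<lambda>i. del (\<rho> i) z) \<noteq> (\<lambda>v. 0)"
    using bspec[OF assms(1)[unfolded generic_submanifold_def] assms(2)] by (elim exE conjE)
  have w: "wedge d (\<lambda>i. del (\<rho> i) q) \<noteq> (\<lambda>v. 0)" by (rule bspec[OF wd]) (use U assms(2) in simp)
  show ?thesis
    by (rule extend_rows(1)[where r = "\<lambda>i. \<chi> l. d_z l (\<lambda>z. complex_of_real (\<rho> i z)) q"])
      (rule generic_submanifold_rows_independent[OF w])
qed

lemma adapted_frame_exists:
  fixes M :: "(complex^'n::finite) set"
  assumes M: "generic_submanifold d M" and q: "q \<in> M" and S: "card S = d"
  shows "\<exists>U \<sigma> B. q \<in> U \<and> adapted_frame M U S \<sigma> B"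
proof -
  obtain U and \<rho> :: "nat \<Rightarrow> complex^'n \<Rightarrow> real" where U: "open U" "q \<in> U"
    and \<rho>': "\<forall>i<d. smooth_on U (\<rho> i)" and MU: "M \<inter> U = {z\<in>U. \<forall>i<d. \<rho> i z = 0}"
    and wd: "\<forall>z\<in>M \<inter> U. wedge d (\<lambda>i. del (\<rho> i) z) \<noteq> (\<lambda>v. 0)"
    using bspec[OF M[unfolded generic_submanifold_def] q] by (elim exE conjE)
  have \<rho>: "smooth_on U (\<rho> i)" if "i < d" for i using \<rho>' that by simp
  have w: "wedge d (\<lambda>i. del (\<rho> i) q) \<noteq> (\<lambda>v. 0)" by (rule bspec[OF wd]) (use U q in simp)
  obtain s where s: "bij_betw s {..<d} S" using S ex_bij_betw_nat_finite[of S] by (auto simp: atLeast0LessThan)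
  let ?s' = "inv_into {..<d} s"
  have s': "bij_betw ?s' S {..<d}" by (rule bij_betw_inv_into[OF s])
  then have s'lt: "?s' j < d" if "j \<in> S" for j using that by (auto simp: bij_betw_def)
  define \<sigma> where "\<sigma> j = \<rho> (?s' j)" for j
  have "\<exists>B :: complex^'n^'n. det (\<chi> j. if j \<in> S then \<chi> l. d_z l (\<lambda>z. complex_of_real (\<rho> (?s' j) z)) q else B $ j) \<noteq> 0"
    by (rule extend_rows(2)[where r = "\<lambda>i. \<chi> l. d_z l (\<lambda>z. complex_of_real (\<rho> i z)) q", OF _ s])
      (rule generic_submanifold_rows_independent[OF w])
  then obtain B :: "complex^'n^'n"
    where B: "det (\<chi> j. if j \<in> S then \<chi> l. d_z l (\<lambda>z. complex_of_real (\<rho> (?s' j) z)) q else B $ j) \<noteq> 0" ..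
  then have Bq: "det (frame S \<sigma> B q) \<noteq> 0" unfolding frame_def \<sigma>_def .
  have \<sigma>: "smooth_on U (\<sigma> j)" if "j \<in> S" for j unfolding \<sigma>_def by (rule \<rho>[OF s'lt[OF that]])
  have "continuous_on U (\<lambda>z. det (frame S \<sigma> B z))"
    by (rule smooth_on_continuous_on[OF smooth_on_det[OF U(1) smooth_on_frame[OF U(1) \<sigma>]]])
  then have oV: "open (U \<inter> (\<lambda>z. det (frame S \<sigma> B z)) -` (- {0}))"
    by (rule continuous_open_preimage[OF _ U(1)]) auto
  let ?V = "U \<inter> (\<lambda>z. det (frame S \<sigma> B z)) -` (- {0})"
  have MU': "M \<inter> U = {z\<in>U. \<forall>j\<in>S. \<sigma> j z = 0}"
  proof -
    have "(\<forall>i<d. \<rho> i z = 0) \<longleftrightarrow> (\<forall>j\<in>S. \<sigma> j z = 0)" for z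
    proof -
      have "(\<forall>i<d. \<rho> i z = 0) \<longleftrightarrow> (\<forall>i\<in>?s' ` S. \<rho> i z = 0)" using s' by (auto simp: bij_betw_def)
      then show ?thesis by (simp add: \<sigma>_def)
    qed
    then show ?thesis using MU by simp
  qed
  then have "M \<inter> ?V = {z\<in>?V. \<forall>j\<in>S. \<sigma> j z = 0}" by blast
  moreover have "\<forall>j\<in>S. smooth_on ?V (\<sigma> j)" using smooth_on_subset[OF U(1) oV _ \<sigma>] by blast
  ultimately have "adapted_frame M ?V S \<sigma> B" using oV by (auto simp: adapted_frame_def)
  moreover have "q \<in> ?V" using U Bq by simp
  ultimately show ?thesis by (intro exI[of _ ?V] exI[of _ \<sigma>] exI[of _ B] conjI)
qed

section \<open>Real differentials, Wirtinger derivatives and tangent vectors\<close>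

lemma complex_vec_real_expansion:
  fixes v :: "complex^'n::finite"
  shows "v = (\<Sum>l\<in>UNIV. Re (v $ l) *\<^sub>R axis l 1 + Im (v $ l) *\<^sub>R axis l \<i>)"
proof -
  have "(\<Sum>l\<in>UNIV. Re (v $ l) *\<^sub>R axis l 1 + Im (v $ l) *\<^sub>R axis l \<i>) $ k
    = (\<Sum>l\<in>UNIV. if l = k then v $ k else 0)" for k
    unfolding sum_component by (rule sum.cong) (auto simp: axis_def complex_eq_iff)
  then show ?thesis by (simp add: vec_eq_iff)
qed

lemma wirtinger_combination:
  "c * ((a - \<i> * b) / 2) + cnj c * ((a + \<i> * b) / 2) = Re c *\<^sub>R a + Im c *\<^sub>R b"
proof -
  have "c * ((a - \<i> * b) / 2) + cnj c * ((a + \<i> * b) / 2) = (c + cnj c) / 2 * a - \<i> * (c - cnj c) / 2 * b"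
    by (simp add: field_simps)
  also have "\<dots> = Re c *\<^sub>R a + Im c *\<^sub>R b"
    unfolding complex_add_cnj complex_diff_cnj by (simp add: scaleR_conv_of_real mult_ac)
  finally show ?thesis .
qed

lemma frechet_derivative_eq_ct_apply:
  fixes f :: "complex^'n::finite \<Rightarrow> complex"
  assumes "f differentiable at z"
  shows "frechet_derivative f (at z) v = ct_apply (ct_of_real v) f z"
proof -
  interpret bounded_linear "frechet_derivative f (at z)"
    using assms by (simp add: frechet_derivative_works has_derivative_bounded_linear)
  have "frechet_derivative f (at z) v
    = frechet_derivative f (at z) (\<Sum>l\<in>UNIV. Re (v $ l) *\<^sub>R axis l 1 + Im (v $ l) *\<^sub>R axis l \<i>)"
    by (rule arg_cong[OF complex_vec_real_expansion])
  also have "\<dots> = (\<Sum>l\<in>UNIV. Re (v $ l) *\<^sub>R frechet_derivative f (at z) (axis l 1) + Im (v $ l) *\<^sub>R frechet_derivative f (at z) (axis l \<i>))"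
    unfolding sum add scaleR ..
  also have "\<dots> = ct_apply (ct_of_real v) f z"
    unfolding ct_apply_def ct_of_real_def d_z_def d_zbar_def vcnj_def
  proof (rule sum.cong[OF refl])
    fix l :: 'n
    show "Re (v $ l) *\<^sub>R frechet_derivative f (at z) (axis l 1) + Im (v $ l) *\<^sub>R frechet_derivative f (at z) (axis l \<i>)
      = fst (v, \<chi> j. cnj (v $ j)) $ l * ((frechet_derivative f (at z) (axis l 1) - \<i> * frechet_derivative f (at z) (axis l \<i>)) / 2) +
        snd (v, \<chi> j. cnj (v $ j)) $ l * ((frechet_derivative f (at z) (axis l 1) + \<i> * frechet_derivative f (at z) (axis l \<i>)) / 2)"
      by (simp only: wirtinger_combination fst_conv snd_conv vec_lambda_beta)
  qed
  finally show ?thesis .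
qed

lemma frechet_derivative_cnj:
  assumes "f differentiable at z"
  shows "frechet_derivative (\<lambda>z. cnj (f z)) (at z) v = cnj (frechet_derivative f (at z) v)"
  by (rule frechet_derivative_bounded_linear[OF bounded_linear_cnj assms])

lemma d_z_cnj: "f differentiable at z \<Longrightarrow> d_z j (\<lambda>z. cnj (f z)) z = cnj (d_zbar j f z)"
  and d_zbar_cnj: "f differentiable at z \<Longrightarrow> d_zbar j (\<lambda>z. cnj (f z)) z = cnj (d_z j f z)"
  by (simp_all add: d_z_def d_zbar_def frechet_derivative_cnj)

text \<open>For a real function the (0,1) part of the differential is conjugate to the (1,0) part.
  Tangency to \<open>M\<close> thus becomes a condition on coordinates: those with index in
  \<open>S\<close> must be purely imaginary.\<close>

lemma frechet_derivative_frame: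
  assumes \<sigma>: "\<sigma> j differentiable at z" and j: "j \<in> S"
  shows "frechet_derivative (\<sigma> j) (at z) v = 2 * Re ((frame S \<sigma> B z *v v) $ j)"
proof -
  let ?f = "\<lambda>z. complex_of_real (\<sigma> j z)"
  have diff: "?f differentiable at z"
    using \<sigma> bounded_linear.has_derivative[OF bounded_linear_of_real] unfolding differentiable_def by blast
  have zbar: "d_zbar l ?f z = cnj (d_z l ?f z)" for l
    using d_zbar_cnj[OF diff, of l] by simp
  have "complex_of_real (frechet_derivative (\<sigma> j) (at z) v) = frechet_derivative ?f (at z) v"
    by (rule frechet_derivative_bounded_linear[OF bounded_linear_of_real \<sigma>, symmetric])
  also have "\<dots> = (\<Sum>l\<in>UNIV. v $ l * d_z l ?f z + cnj (v $ l * d_z l ?f z))"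
    unfolding frechet_derivative_eq_ct_apply[OF diff] ct_apply_def ct_of_real_def vcnj_def by (simp add: zbar)
  also have "\<dots> = (\<Sum>l\<in>UNIV. complex_of_real (2 * Re (v $ l * d_z l ?f z)))"
    by (rule sum.cong) (simp_all only: complex_add_cnj)
  also have "\<dots> = complex_of_real (2 * Re (\<Sum>l\<in>UNIV. d_z l ?f z * v $ l))"
    by (simp add: sum_distrib_left mult.commute)
  also have "(\<Sum>l\<in>UNIV. d_z l ?f z * v $ l) = (frame S \<sigma> B z *v v) $ j"
    using j by (simp add: matrix_vector_mult_def frame_def)
  finally show ?thesis by (simp only: of_real_eq_iff)
qed

lemma matrix_inv_mult:
  fixes A :: "complex^'n::finite^'n"
  assumes "det A \<noteq> 0"
  shows "A *v (matrix_inv A *v v) = v" "matrix_inv A *v (A *v v) = v"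
  by (simp_all add: matrix_vector_mul_assoc matrix_mul_matrix_inv[OF assms])

text \<open>The curve is an integral curve of the field that is constant in the moving frame.\<close>
lemma tangent_spaceI:
  assumes fr: "adapted_frame M U S \<sigma> B" and z: "z \<in> M \<inter> U"
    and v: "\<And>j. j \<in> S \<Longrightarrow> Re ((frame S \<sigma> B z *v v) $ j) = 0"
  shows "v \<in> tangent_space M z"
proof -
  have U: "open U" "z \<in> U" and \<sigma>: "\<And>j. j \<in> S \<Longrightarrow> smooth_on U (\<sigma> j)"
    and MU: "M \<inter> U = {z\<in>U. \<forall>j\<in>S. \<sigma> j z = 0}" and det: "\<And>z. z \<in> U \<Longrightarrow> det (frame S \<sigma> B z) \<noteq> 0"
    using fr z by (auto simp: adapted_frame_def)
  \<comment> \<open>With the coordinates frozen at \<open>u\<close>, the derivative of each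
    \<open>\<sigma> j\<close> along the curve is \<open>2 * Re (u $ j) = 0\<close>, so the curve
    cannot leave \<open>M\<close>.\<close>
  define u where "u = frame S \<sigma> B z *v v"
  define F where "F y = matrix_inv (frame S \<sigma> B y) *v u" for y
  have F: "smooth_on U F" unfolding F_def
    by (intro smooth_on_matrix_inv_mult smooth_on_frame smooth_on_const U \<sigma> det)
  obtain \<epsilon> \<gamma> where \<epsilon>: "\<epsilon> > 0" and \<gamma>: "smooth_on {-\<epsilon><..<\<epsilon>} \<gamma>" "\<gamma> 0 = z"
    "\<And>t. t \<in> {-\<epsilon><..<\<epsilon>} \<Longrightarrow> \<gamma> t \<in> U" "\<And>t. t \<in> {-\<epsilon><..<\<epsilon>} \<Longrightarrow> (\<gamma> has_vector_derivative F (\<gamma> t)) (at t)"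
    using local_flow_curve[OF U F] by blast
  have zero: "\<sigma> j (\<gamma> t) = 0" if t: "t \<in> {-\<epsilon><..<\<epsilon>}" and j: "j \<in> S" for t j
  proof -
    have d: "((\<lambda>t. \<sigma> j (\<gamma> t)) has_derivative (\<lambda>h. 0)) (at t within {-\<epsilon><..<\<epsilon>})" if t: "t \<in> {-\<epsilon><..<\<epsilon>}" for t
    proof -
      have 1: "(\<gamma> has_derivative (\<lambda>h. h *\<^sub>R F (\<gamma> t))) (at t)" using \<gamma>(4)[OF t] by (simp add: has_vector_derivative_def)
      have 2: "(\<sigma> j has_derivative frechet_derivative (\<sigma> j) (at (\<gamma> t))) (at (\<gamma> t))"
        by (rule smooth_on_has_derivative[OF U(1) \<sigma>[OF j] \<gamma>(3)[OF t]])
      have "frechet_derivative (\<sigma> j) (at (\<gamma> t)) (F (\<gamma> t)) = 2 * Re (u $ j)"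
        unfolding frechet_derivative_frame[where \<sigma> = \<sigma> and j = j and S = S and B = B, OF smooth_on_differentiable[OF U(1) \<sigma>[OF j] \<gamma>(3)[OF t]] j] F_def
        by (simp add: matrix_inv_mult[OF det[OF \<gamma>(3)[OF t]]])
      also have "\<dots> = 0" using v[OF j] by (simp add: u_def)
      finally have "frechet_derivative (\<sigma> j) (at (\<gamma> t)) (h *\<^sub>R F (\<gamma> t)) = 0" for h
        by (simp add: linear_cmul[OF has_derivative_linear[OF 2]])
      then have "((\<lambda>t. \<sigma> j (\<gamma> t)) has_derivative (\<lambda>h. 0)) (at t)"
        using has_derivative_compose[OF 1 2] by simp
      then show ?thesis by (rule has_derivative_at_withinI)
    qed
    have "\<sigma> j (\<gamma> t) = \<sigma> j (\<gamma> 0)"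
      by (rule has_derivative_zero_unique[where f = "\<lambda>t. \<sigma> j (\<gamma> t)", OF _ d t])
        (use \<epsilon> in simp_all)
    also have "\<dots> = 0" using z MU j \<gamma>(2) by blast
    finally show ?thesis .
  qed
  have "\<gamma> ` {-\<epsilon><..<\<epsilon>} \<subseteq> M" using zero \<gamma>(3) MU by blast
  moreover have "F z = v" unfolding F_def u_def by (rule matrix_inv_mult(2)[OF det[OF U(2)]])
  then have "(\<gamma> has_vector_derivative v) (at 0)" using \<gamma>(2) \<gamma>(4)[of 0] \<epsilon> by simp
  ultimately show ?thesis unfolding tangent_space_def using \<epsilon> \<gamma>(1,2) by blast
qed

text \<open>Along a curve in \<open>M\<close> with velocity \<open>v\<close> the function is
  eventually zero, so its derivative at time 0 is both zero and the value of the differential on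
  \<open>v\<close>.\<close>

lemma tangent_space_frechet_derivative_eq_0:
  fixes f :: "complex^'n::finite \<Rightarrow> 'b::real_normed_vector"
  assumes v: "v \<in> tangent_space M z" and f: "f differentiable at z"
    and zero: "\<forall>\<^sub>F y in nhds z. y \<in> M \<longrightarrow> f y = 0"
  shows "frechet_derivative f (at z) v = 0"
proof -
  obtain \<epsilon> \<gamma> where \<epsilon>: "\<epsilon> > 0" and \<gamma>: "\<gamma> ` {-\<epsilon><..<\<epsilon>} \<subseteq> M" "\<gamma> 0 = z" "(\<gamma> has_vector_derivative v) (at 0)"
    using v unfolding tangent_space_def by blast
  have "continuous (at 0) \<gamma>" by (rule has_vector_derivative_continuous[OF \<gamma>(3)])
  then have "filterlim \<gamma> (nhds z) (at 0)" unfolding continuous_at \<gamma>(2) .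
  then have 1: "\<forall>\<^sub>F t in at 0. \<gamma> t \<in> M \<longrightarrow> f (\<gamma> t) = 0" by (rule eventually_compose_filterlim[OF zero])
  have 2: "\<forall>\<^sub>F t in at 0. t \<in> {-\<epsilon><..<\<epsilon>}"
    by (rule eventually_at_topological[THEN iffD2], rule exI[of _ "{-\<epsilon><..<\<epsilon>}"]) (use \<epsilon> in simp)
  have 3: "\<forall>\<^sub>F t in at 0. f (\<gamma> t) = 0" using 1 2 by eventually_elim (use \<gamma>(1) in blast)
  have "f z = 0" using eventually_nhds_x_imp_x[OF zero] \<gamma>(1,2) \<epsilon> by force
  have d: "((\<lambda>t. f (\<gamma> t)) has_derivative (\<lambda>h. frechet_derivative f (at z) (h *\<^sub>R v))) (at 0)"
    by (rule has_derivative_compose[of \<gamma> "\<lambda>h. h *\<^sub>R v"])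
      (use \<gamma>(2,3) f in \<open>simp_all add: has_vector_derivative_def frechet_derivative_works\<close>)
  have "((\<lambda>t. 0::'b) has_derivative (\<lambda>h. frechet_derivative f (at z) (h *\<^sub>R v))) (at 0)"
    by (rule has_derivative_transform_eventually[OF d 3]) (use \<open>f z = 0\<close> \<gamma>(2) in simp_all)
  then have "(\<lambda>h. frechet_derivative f (at z) (h *\<^sub>R v)) = (\<lambda>h. 0)"
    using has_derivative_unique[OF _ has_derivative_const] by blast
  from fun_cong[OF this, of 1] show ?thesis by simp
qed

lemma ct_apply_add: "ct_apply (X + Y) f z = ct_apply X f z + ct_apply Y f z"
  by (simp add: ct_apply_def sum.distrib distrib_right)

lemma ct_apply_scale: "ct_apply (ct_scale c X) f z = c * ct_apply X f z"
  by (simp add: ct_apply_def ct_scale_def sum_distrib_left algebra_simps)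

lemma CT_ct_apply_eq_0:
  assumes X: "X \<in> CT M z" and f: "f differentiable at z" and zero: "\<forall>\<^sub>F y in nhds z. y \<in> M \<longrightarrow> f y = 0"
  shows "ct_apply X f z = 0"
proof -
  obtain v w where "X = ct_of_real v + ct_scale \<i> (ct_of_real w)" "v \<in> tangent_space M z" "w \<in> tangent_space M z"
    using X unfolding CT_def by blast
  then show ?thesis
    using tangent_space_frechet_derivative_eq_0[OF _ f zero]
    by (simp add: ct_apply_add ct_apply_scale frechet_derivative_eq_ct_apply[OF f, symmetric])
qed

text \<open>Genericity in the form used with finite type: the complexified tangent space projects
  onto all (1,0) vectors.\<close>

lemma fst_CT:
  assumes fr: "adapted_frame M U S \<sigma> B" and z: "z \<in> M \<inter> U"
  shows "\<exists>X\<in>CT M z. fst X = b"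
proof -
  have det: "det (frame S \<sigma> B z) \<noteq> 0" using fr z by (simp add: adapted_frame_def)
  let ?A = "frame S \<sigma> B z"
  define y where "y = ?A *v b"
  \<comment> \<open>Both vectors get purely imaginary coordinates, hence are tangent. In
    \<open>v + \<i> *s w\<close> the vector \<open>v\<close> contributes the imaginary part of
    \<open>y\<close> and \<open>w\<close> the real part.\<close>
  define v where "v = matrix_inv ?A *v (\<chi> j. \<i> * complex_of_real (Im (y $ j)))"
  define w where "w = matrix_inv ?A *v (\<chi> j. - \<i> * complex_of_real (Re (y $ j)))"
  have v: "v \<in> tangent_space M z"
    by (rule tangent_spaceI[OF fr z]) (simp add: v_def matrix_inv_mult[OF det])
  have w: "w \<in> tangent_space M z"
    by (rule tangent_spaceI[OF fr z]) (simp add: w_def matrix_inv_mult[OF det])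
  have "?A *v (v + \<i> *s w) = y"
    unfolding matrix_vector_right_distrib vector_scalar_commute
    by (simp add: v_def w_def matrix_inv_mult[OF det] vec_eq_iff complex_eq_iff)
  then have "matrix_inv ?A *v (?A *v (v + \<i> *s w)) = matrix_inv ?A *v (?A *v b)" by (simp add: y_def)
  then have "v + \<i> *s w = b" by (simp only: matrix_inv_mult[OF det])
  then have "fst (ct_of_real v + ct_scale \<i> (ct_of_real w)) = b" by (simp add: ct_of_real_def ct_scale_def)
  then show ?thesis using v w unfolding CT_def by blast
qed

text \<open>The vanishing of complex coordinates is preserved under complex multiples, so every
  multiple of \<open>v\<close> is a real tangent vector; the (0,1) part of \<open>v\<close> then
  lies in \<open>CT M z\<close>, and its conjugate is \<open>(v, 0)\<close>.\<close>

lemma T10_ofI: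
  assumes fr: "adapted_frame M U S \<sigma> B" and z: "z \<in> M \<inter> U"
    and v: "\<And>j. j \<in> S \<Longrightarrow> (frame S \<sigma> B z *v v) $ j = 0"
  shows "(v, 0) \<in> T10_of M z"
proof -
  have tan: "c *s v \<in> tangent_space M z" for c
    by (rule tangent_spaceI[OF fr z]) (simp add: vector_scalar_commute v)
  \<comment> \<open>The projection to the (0,1) part: half of \<open>v\<close> plus
    \<open>\<i>\<close> times its image under the complex structure. The (1,0) components
    cancel.\<close>
  have eq: "ct_of_real ((1/2) *s v) + ct_scale \<i> (ct_of_real ((\<i>/2) *s v)) = (0, vcnj v)"
    by (simp add: ct_of_real_def ct_scale_def vcnj_def vec_eq_iff complex_eq_iff)
  have "(0, vcnj v) \<in> CT M z" unfolding CT_def using tan eq by (metis (mono_tags, lifting) mem_Collect_eq)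
  then have "(0, vcnj v) \<in> T01_of M z" by (simp add: T01_of_def T01_def)
  moreover have "ct_cnj (0, vcnj v) = (v, 0)" by (simp add: ct_cnj_def vcnj_def vec_eq_iff)
  ultimately show ?thesis unfolding T10_of_def by (metis image_eqI)
qed

lemma T10_of_subset: "T10_of M z \<subseteq> T10"
  by (auto simp: T10_of_def T01_of_def T10_def T01_def ct_cnj_def vcnj_def vec_eq_iff)

section \<open>Words in vector fields\<close>

lemma frechet_derivative_add:
  assumes "f differentiable at z" "g differentiable at z"
  shows "frechet_derivative (\<lambda>z. f z + g z) (at z) v = frechet_derivative f (at z) v + frechet_derivative g (at z) v"
  using frechet_derivative_at[OF has_derivative_add[OF assms[unfolded frechet_derivative_works]], symmetric]
  by (rule fun_cong[THEN trans]) simp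

lemma frechet_derivative_mult:
  fixes f g :: "'a::real_normed_vector \<Rightarrow> complex"
  assumes "f differentiable at z" "g differentiable at z"
  shows "frechet_derivative (\<lambda>z. f z * g z) (at z) v = f z * frechet_derivative g (at z) v + frechet_derivative f (at z) v * g z"
  using frechet_derivative_at[OF has_derivative_mult[OF assms[unfolded frechet_derivative_works]], symmetric]
  by (rule fun_cong[THEN trans]) simp

lemma d_z_add:
  assumes "f differentiable at z" "g differentiable at z"
  shows "d_z j (\<lambda>z. f z + g z) z = d_z j f z + d_z j g z"
    and "d_zbar j (\<lambda>z. f z + g z) z = d_zbar j f z + d_zbar j g z"
  by (simp_all add: d_z_def d_zbar_def frechet_derivative_add[OF assms] field_simps)

lemma d_z_mult:
  assumes "f differentiable at z" "g differentiable at z"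
  shows "d_z j (\<lambda>z. f z * g z) z = f z * d_z j g z + d_z j f z * g z"
    and "d_zbar j (\<lambda>z. f z * g z) z = f z * d_zbar j g z + d_zbar j f z * g z"
  by (simp_all add: d_z_def d_zbar_def frechet_derivative_mult[OF assms] field_simps)

lemma d_z_const: "d_z j (\<lambda>z. c) z = 0" "d_zbar j (\<lambda>z. c) z = 0"
  by (simp_all add: d_z_def d_zbar_def frechet_derivative_const)

lemma ct_apply_fun_add:
  assumes "f differentiable at z" "g differentiable at z"
  shows "ct_apply X (\<lambda>z. f z + g z) z = ct_apply X f z + ct_apply X g z"
  unfolding ct_apply_def d_z_add[OF assms] by (simp add: algebra_simps sum.distrib)

lemma ct_apply_fun_mult:
  assumes "f differentiable at z" "g differentiable at z"
  shows "ct_apply X (\<lambda>z. f z * g z) z = f z * ct_apply X g z + ct_apply X f z * g z"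
  unfolding ct_apply_def d_z_mult[OF assms] sum_distrib_left sum_distrib_right
  by (simp add: algebra_simps sum.distrib)

lemma ct_apply_const: "ct_apply X (\<lambda>z. c) z = 0"
  by (simp add: ct_apply_def d_z_const)

lemma ct_apply_fun_sum:
  assumes "\<And>i. i \<in> I \<Longrightarrow> f i differentiable at z"
  shows "ct_apply X (\<lambda>z. \<Sum>i\<in>I. f i z) z = (\<Sum>i\<in>I. ct_apply X (f i) z)"
  using assms
proof (induction I rule: infinite_finite_induct)
  case (insert i I)
  have "ct_apply X (\<lambda>z. f i z + (\<Sum>i\<in>I. f i z)) z = ct_apply X (f i) z + ct_apply X (\<lambda>z. \<Sum>i\<in>I. f i z) z"
    by (rule ct_apply_fun_add[OF insert.prems differentiable_sum]) (use insert in simp_all)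
  then show ?case using insert by simp
qed (simp_all add: ct_apply_const)

lemma ct_apply_cnj:
  assumes "f differentiable at z"
  shows "ct_apply (ct_cnj X) (\<lambda>z. cnj (f z)) z = cnj (ct_apply X f z)"
  by (simp add: ct_apply_def ct_cnj_def vcnj_def d_z_cnj[OF assms] d_zbar_cnj[OF assms] add.commute)

lemma ct_apply_cong:
  assumes "\<forall>\<^sub>F y in nhds z. f y = g y"
  shows "ct_apply X f z = ct_apply X g z"
proof -
  obtain U where U: "open U" "z \<in> U" "\<And>y. y \<in> U \<Longrightarrow> f y = g y"
    using assms unfolding eventually_nhds by blast
  have e: "frechet_derivative f (at z) = frechet_derivative g (at z)" by (rule frechet_derivative_cong[OF U])
  show ?thesis unfolding ct_apply_def d_z_def d_zbar_def e ..
qed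

lemma frechet_derivative_d_z:
  assumes U: "open U" "z \<in> U" and f: "smooth_on U f"
  shows "frechet_derivative (d_z j f) (at z) v = (frechet_derivative (\<lambda>y. frechet_derivative f (at y) (axis j 1)) (at z) v
      - \<i> * frechet_derivative (\<lambda>y. frechet_derivative f (at y) (axis j \<i>)) (at z) v) / 2"
    and "frechet_derivative (d_zbar j f) (at z) v = (frechet_derivative (\<lambda>y. frechet_derivative f (at y) (axis j 1)) (at z) v
      + \<i> * frechet_derivative (\<lambda>y. frechet_derivative f (at y) (axis j \<i>)) (at z) v) / 2"
proof -
  have D: "((\<lambda>y. frechet_derivative f (at y) u) has_derivative frechet_derivative (\<lambda>y. frechet_derivative f (at y) u) (at z)) (at z)" for u
    by (rule smooth_on_has_derivative[OF U(1) smooth_on_frechet_derivative[OF f] U(2)])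
  have "(d_z j f has_derivative (\<lambda>v. (frechet_derivative (\<lambda>y. frechet_derivative f (at y) (axis j 1)) (at z) v
      - \<i> * frechet_derivative (\<lambda>y. frechet_derivative f (at y) (axis j \<i>)) (at z) v) / 2)) (at z)"
    unfolding d_z_def[abs_def]
    by (rule bounded_linear.has_derivative[OF bounded_linear_divide])
      (intro has_derivative_diff has_derivative_mult_right D)
  from frechet_derivative_at[OF this, symmetric]
  show "frechet_derivative (d_z j f) (at z) v = (frechet_derivative (\<lambda>y. frechet_derivative f (at y) (axis j 1)) (at z) v
      - \<i> * frechet_derivative (\<lambda>y. frechet_derivative f (at y) (axis j \<i>)) (at z) v) / 2" by (rule fun_cong)
  have "(d_zbar j f has_derivative (\<lambda>v. (frechet_derivative (\<lambda>y. frechet_derivative f (at y) (axis j 1)) (at z) v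
      + \<i> * frechet_derivative (\<lambda>y. frechet_derivative f (at y) (axis j \<i>)) (at z) v) / 2)) (at z)"
    unfolding d_zbar_def[abs_def]
    by (rule bounded_linear.has_derivative[OF bounded_linear_divide])
      (intro has_derivative_add has_derivative_mult_right D)
  from frechet_derivative_at[OF this, symmetric]
  show "frechet_derivative (d_zbar j f) (at z) v = (frechet_derivative (\<lambda>y. frechet_derivative f (at y) (axis j 1)) (at z) v
      + \<i> * frechet_derivative (\<lambda>y. frechet_derivative f (at y) (axis j \<i>)) (at z) v) / 2" by (rule fun_cong)
qed

text \<open>Here \<open>a\<close>, \<open>b\<close>, \<open>c\<close>, \<open>d\<close> stand for
  second derivatives in the real coordinates; interchanging two Wirtinger operators exchanges
  \<open>b\<close> with \<open>c\<close> along with the signs.\<close>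

lemma second_order_combinations:
  fixes a b c d :: complex
  shows "((a - \<i> * b) / 2 - \<i> * ((c - \<i> * d) / 2)) / 2 = ((a - \<i> * c) / 2 - \<i> * ((b - \<i> * d) / 2)) / 2"
    and "((a - \<i> * b) / 2 + \<i> * ((c - \<i> * d) / 2)) / 2 = ((a + \<i> * c) / 2 - \<i> * ((b + \<i> * d) / 2)) / 2"
    and "((a + \<i> * b) / 2 + \<i> * ((c + \<i> * d) / 2)) / 2 = ((a + \<i> * c) / 2 + \<i> * ((b + \<i> * d) / 2)) / 2"
  by (simp_all add: right_diff_distrib distrib_left diff_divide_distrib add_divide_distrib)

lemma d_z_commute:
  fixes f :: "complex^'n::finite \<Rightarrow> complex"
  assumes U: "open U" "z \<in> U" and f: "smooth_on U f"
  shows "d_z k (d_z j f) z = d_z j (d_z k f) z"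
    and "d_zbar k (d_z j f) z = d_z j (d_zbar k f) z"
    and "d_zbar k (d_zbar j f) z = d_zbar j (d_zbar k f) z"
proof -
  let ?D = "\<lambda>u v. frechet_derivative (\<lambda>y. frechet_derivative f (at y) u) (at z) v"
  have s: "?D (axis k c) (axis j c') = ?D (axis j c') (axis k c)" for c c'
    by (rule symmetric_second_derivative[OF U f])
  have e1: "d_z k (d_z j f) z = ((?D (axis j 1) (axis k 1) - \<i> * ?D (axis j \<i>) (axis k 1)) / 2
      - \<i> * ((?D (axis j 1) (axis k \<i>) - \<i> * ?D (axis j \<i>) (axis k \<i>)) / 2)) / 2" for k j
    by (subst d_z_def) (simp only: frechet_derivative_d_z[OF U f])
  have e2: "d_zbar k (d_z j f) z = ((?D (axis j 1) (axis k 1) - \<i> * ?D (axis j \<i>) (axis k 1)) / 2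
      + \<i> * ((?D (axis j 1) (axis k \<i>) - \<i> * ?D (axis j \<i>) (axis k \<i>)) / 2)) / 2" for k j
    by (subst d_zbar_def) (simp only: frechet_derivative_d_z[OF U f])
  have e3: "d_z k (d_zbar j f) z = ((?D (axis j 1) (axis k 1) + \<i> * ?D (axis j \<i>) (axis k 1)) / 2
      - \<i> * ((?D (axis j 1) (axis k \<i>) + \<i> * ?D (axis j \<i>) (axis k \<i>)) / 2)) / 2" for k j
    by (subst d_z_def) (simp only: frechet_derivative_d_z[OF U f])
  have e4: "d_zbar k (d_zbar j f) z = ((?D (axis j 1) (axis k 1) + \<i> * ?D (axis j \<i>) (axis k 1)) / 2
      + \<i> * ((?D (axis j 1) (axis k \<i>) + \<i> * ?D (axis j \<i>) (axis k \<i>)) / 2)) / 2" for k j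
    by (subst d_zbar_def) (simp only: frechet_derivative_d_z[OF U f])
  show "d_z k (d_z j f) z = d_z j (d_z k f) z"
    unfolding e1 s[of 1 1] s[of 1 \<i>] s[of \<i> 1] s[of \<i> \<i>] by (rule second_order_combinations)
  show "d_zbar k (d_z j f) z = d_z j (d_zbar k f) z"
    unfolding e2 e3 s[of 1 1] s[of 1 \<i>] s[of \<i> 1] s[of \<i> \<i>] by (rule second_order_combinations)
  show "d_zbar k (d_zbar j f) z = d_zbar j (d_zbar k f) z"
    unfolding e4 s[of 1 1] s[of 1 \<i>] s[of \<i> 1] s[of \<i> \<i>] by (rule second_order_combinations)
qed

definition vf :: "(complex^'n \<Rightarrow> 'n::finite ctvec) \<Rightarrow> (complex^'n \<Rightarrow> complex) \<Rightarrow> complex^'n \<Rightarrow> complex" where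
  "vf X f q = ct_apply (X q) f q"

lemma smooth_on_vf:
  assumes "open U" "smooth_on U X" "smooth_on U f"
  shows "smooth_on U (vf X f)"
  unfolding vf_def[abs_def] ct_apply_def
  by (intro smooth_on_sum smooth_on_add smooth_on_mult smooth_on_vec_nth smooth_on_fst smooth_on_snd
      smooth_on_d_z smooth_on_d_zbar assms)

lemma smooth_on_lie_bracket:
  assumes "open U" "smooth_on U X" "smooth_on U Y"
  shows "smooth_on U (lie_bracket X Y)"
proof -
  have "smooth_on U (\<lambda>q. (\<chi> i. vf X (\<lambda>z. fst (Y z) $ i) q - vf Y (\<lambda>z. fst (X z) $ i) q,
      \<chi> i. vf X (\<lambda>z. snd (Y z) $ i) q - vf Y (\<lambda>z. snd (X z) $ i) q))"
    by (intro smooth_on_Pair smooth_on_vec_lambda smooth_on_diff smooth_on_vf smooth_on_vec_nth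
        smooth_on_fst smooth_on_snd assms)
  then show ?thesis unfolding lie_bracket_def[abs_def] vf_def .
qed

text \<open>The composite of two fields is a first-order part plus the second-order form
  \<open>Q\<close>. The latter is symmetric because Wirtinger derivatives commute, so it drops out
  of the commutator.\<close>

lemma vf_lie_bracket:
  assumes U: "open U" "z \<in> U" and X: "smooth_on U X" and Y: "smooth_on U Y" and f: "smooth_on U f"
  shows "vf (lie_bracket X Y) f z = vf X (vf Y f) z - vf Y (vf X f) z"
proof -
  define Q where "Q A B = (\<Sum>j\<in>UNIV. fst B $ j * ct_apply A (d_z j f) z + snd B $ j * ct_apply A (d_zbar j f) z)" for A B
  have Qsym: "Q A B = Q B A" for A B
  proof -
    have "Q A B = (\<Sum>j\<in>UNIV. \<Sum>k\<in>UNIV. fst B $ j * fst A $ k * d_z k (d_z j f) z + fst B $ j * snd A $ k * d_zbar k (d_z j f) z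
        + snd B $ j * fst A $ k * d_z k (d_zbar j f) z + snd B $ j * snd A $ k * d_zbar k (d_zbar j f) z)" for A B
      unfolding Q_def ct_apply_def by (simp add: sum_distrib_left sum.distrib algebra_simps)
    note e = this
    have "Q A B = (\<Sum>k\<in>UNIV. \<Sum>j\<in>UNIV. fst B $ j * fst A $ k * d_z k (d_z j f) z + fst B $ j * snd A $ k * d_zbar k (d_z j f) z
        + snd B $ j * fst A $ k * d_z k (d_zbar j f) z + snd B $ j * snd A $ k * d_zbar k (d_zbar j f) z)"
      unfolding e by (rule sum.swap)
    also have "\<dots> = Q B A"
      unfolding e
    proof (intro sum.cong refl)
      fix k j
      show "fst B $ j * fst A $ k * d_z k (d_z j f) z + fst B $ j * snd A $ k * d_zbar k (d_z j f) z
        + snd B $ j * fst A $ k * d_z k (d_zbar j f) z + snd B $ j * snd A $ k * d_zbar k (d_zbar j f) z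
        = fst A $ k * fst B $ j * d_z j (d_z k f) z + fst A $ k * snd B $ j * d_zbar j (d_z k f) z
        + snd A $ k * fst B $ j * d_z j (d_zbar k f) z + snd A $ k * snd B $ j * d_zbar j (d_zbar k f) z"
        unfolding d_z_commute(1)[OF U f, of k j] d_z_commute(2)[OF U f, of k j] d_z_commute(2)[OF U f, of j k]
          d_z_commute(3)[OF U f, of k j] by (simp add: algebra_simps)
    qed
    finally show ?thesis .
  qed
  have expand: "vf X (vf Y f) z = (\<Sum>j\<in>UNIV. ct_apply (X z) (\<lambda>q. fst (Y q) $ j) z * d_z j f z
      + ct_apply (X z) (\<lambda>q. snd (Y q) $ j) z * d_zbar j f z) + Q (X z) (Y z)"
    if X: "smooth_on U X" and Y: "smooth_on U Y" for X Y :: "complex^'a \<Rightarrow> 'a ctvec"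
  proof -
    have d1: "(\<lambda>q. fst (Y q) $ j) differentiable at z" "(\<lambda>q. snd (Y q) $ j) differentiable at z"
      "d_z j f differentiable at z" "d_zbar j f differentiable at z" for j
      by (rule smooth_on_differentiable[OF U(1) _ U(2)];
          intro smooth_on_vec_nth smooth_on_fst smooth_on_snd smooth_on_d_z smooth_on_d_zbar U(1) Y f)+
    have "vf X (vf Y f) z = ct_apply (X z) (\<lambda>q. \<Sum>j\<in>UNIV. fst (Y q) $ j * d_z j f q + snd (Y q) $ j * d_zbar j f q) z"
      unfolding vf_def[abs_def] ct_apply_def ..
    also have "\<dots> = (\<Sum>j\<in>UNIV. ct_apply (X z) (\<lambda>q. fst (Y q) $ j * d_z j f q + snd (Y q) $ j * d_zbar j f q) z)"
      by (rule ct_apply_fun_sum) (intro differentiable_add differentiable_mult d1)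
    also have "\<dots> = (\<Sum>j\<in>UNIV. (fst (Y z) $ j * ct_apply (X z) (d_z j f) z + ct_apply (X z) (\<lambda>q. fst (Y q) $ j) z * d_z j f z)
       + (snd (Y z) $ j * ct_apply (X z) (d_zbar j f) z + ct_apply (X z) (\<lambda>q. snd (Y q) $ j) z * d_zbar j f z))"
    proof (rule sum.cong[OF refl])
      fix j
      have "ct_apply (X z) (\<lambda>q. fst (Y q) $ j * d_z j f q + snd (Y q) $ j * d_zbar j f q) z
        = ct_apply (X z) (\<lambda>q. fst (Y q) $ j * d_z j f q) z + ct_apply (X z) (\<lambda>q. snd (Y q) $ j * d_zbar j f q) z"
        by (rule ct_apply_fun_add) (intro differentiable_mult d1)+
      then show "ct_apply (X z) (\<lambda>q. fst (Y q) $ j * d_z j f q + snd (Y q) $ j * d_zbar j f q) z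
        = (fst (Y z) $ j * ct_apply (X z) (d_z j f) z + ct_apply (X z) (\<lambda>q. fst (Y q) $ j) z * d_z j f z)
       + (snd (Y z) $ j * ct_apply (X z) (d_zbar j f) z + ct_apply (X z) (\<lambda>q. snd (Y q) $ j) z * d_zbar j f z)"
        by (simp only: ct_apply_fun_mult[OF d1(1) d1(3)] ct_apply_fun_mult[OF d1(2) d1(4)])
    qed
    finally show ?thesis unfolding Q_def by (simp add: sum.distrib algebra_simps)
  qed
  show ?thesis
    unfolding expand[OF X Y] expand[OF Y X] Qsym[of "Y z"]
    unfolding vf_def ct_apply_def[of "lie_bracket X Y z"]
    by (simp add: lie_bracket_def sum.distrib sum_subtractf algebra_simps)
qed

section \<open>Germs at a point and iterated derivatives\<close>

text \<open>Every vector field and function comes with a neighbourhood of its own; speaking of germs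
  keeps these neighbourhoods out of the inductions over words.\<close>

definition smooth_near :: "'a::real_normed_vector \<Rightarrow> ('a \<Rightarrow> 'b::real_normed_vector) \<Rightarrow> bool" where
  "smooth_near p f \<longleftrightarrow> (\<exists>U. open U \<and> p \<in> U \<and> smooth_on U f)"

definition eq_near :: "'a::topological_space \<Rightarrow> ('a \<Rightarrow> 'b) \<Rightarrow> ('a \<Rightarrow> 'b) \<Rightarrow> bool" where
  "eq_near p f g \<longleftrightarrow> (\<forall>\<^sub>F z in nhds p. f z = g z)"

lemma smooth_near2:
  assumes "smooth_near p f" "smooth_near p g"
  shows "\<exists>U. open U \<and> p \<in> U \<and> smooth_on U f \<and> smooth_on U g"
proof -
  obtain U V where U: "open U" "p \<in> U" "smooth_on U f" and V: "open V" "p \<in> V" "smooth_on V g"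
    using assms unfolding smooth_near_def by (elim exE conjE)
  have o: "open (U \<inter> V)" using U(1) V(1) by (rule open_Int)
  show ?thesis
    using o U(2) V(2) smooth_on_subset[OF U(1) o Int_lower1 U(3)] smooth_on_subset[OF V(1) o Int_lower2 V(3)]
    by (intro exI[of _ "U \<inter> V"] conjI IntI)
qed

lemma smooth_near3:
  assumes "smooth_near p f" "smooth_near p g" "smooth_near p h"
  shows "\<exists>U. open U \<and> p \<in> U \<and> smooth_on U f \<and> smooth_on U g \<and> smooth_on U h"
proof -
  obtain U V where U: "open U" "p \<in> U" "smooth_on U f" "smooth_on U g" and V: "open V" "p \<in> V" "smooth_on V h"
    using smooth_near2[OF assms(1,2)] assms(3) unfolding smooth_near_def by (elim exE conjE)
  have o: "open (U \<inter> V)" using U(1) V(1) by (rule open_Int)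
  show ?thesis
    using o U(2) V(2) smooth_on_subset[OF U(1) o Int_lower1 U(3)] smooth_on_subset[OF U(1) o Int_lower1 U(4)]
      smooth_on_subset[OF V(1) o Int_lower2 V(3)]
    by (intro exI[of _ "U \<inter> V"] conjI IntI)
qed

lemma smooth_near_const: "smooth_near p (\<lambda>z. c)"
  unfolding smooth_near_def by (intro exI[of _ UNIV] conjI smooth_on_const) simp_all

lemma smooth_near_add: "smooth_near p f \<Longrightarrow> smooth_near p g \<Longrightarrow> smooth_near p (\<lambda>z. f z + g z)"
  using smooth_near2[of p f g] smooth_on_add unfolding smooth_near_def by metis

lemma smooth_near_mult:
  fixes f g :: "'a::real_normed_vector \<Rightarrow> complex"
  shows "smooth_near p f \<Longrightarrow> smooth_near p g \<Longrightarrow> smooth_near p (\<lambda>z. f z * g z)"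
  using smooth_near2[of p f g] smooth_on_mult unfolding smooth_near_def by metis

lemma smooth_near_bounded_linear: "bounded_linear h \<Longrightarrow> smooth_near p f \<Longrightarrow> smooth_near p (\<lambda>z. h (f z))"
  using smooth_on_bounded_linear unfolding smooth_near_def by metis

lemma smooth_near_cnj: "smooth_near p f \<Longrightarrow> smooth_near p (\<lambda>z. cnj (f z))"
  by (rule smooth_near_bounded_linear[OF bounded_linear_cnj])

lemma smooth_near_vf: "smooth_near p X \<Longrightarrow> smooth_near p f \<Longrightarrow> smooth_near p (vf X f)"
  using smooth_near2[of p X f] smooth_on_vf unfolding smooth_near_def by metis

lemma smooth_near_lie_bracket: "smooth_near p X \<Longrightarrow> smooth_near p Y \<Longrightarrow> smooth_near p (lie_bracket X Y)"
  using smooth_near2[of p X Y] smooth_on_lie_bracket unfolding smooth_near_def by metis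

lemma smooth_near_differentiable:
  assumes "smooth_near p f"
  shows "\<forall>\<^sub>F z in nhds p. f differentiable at z"
proof -
  obtain U where U: "open U" "p \<in> U" "smooth_on U f" using assms unfolding smooth_near_def by (elim exE conjE)
  have "\<forall>z\<in>U. f differentiable at z" by (rule ballI) (rule smooth_on_differentiable[OF U(1,3)])
  then show ?thesis unfolding eventually_nhds using U by (intro exI[of _ U] conjI)
qed

lemma smooth_near_cong:
  assumes "smooth_near p f" "eq_near p f g"
  shows "smooth_near p g"
proof -
  obtain U where U: "open U" "p \<in> U" "smooth_on U f" using assms(1) unfolding smooth_near_def by (elim exE conjE)
  obtain V where V: "open V" "p \<in> V" "\<And>z. z \<in> V \<Longrightarrow> f z = g z"
    using assms(2) unfolding eq_near_def eventually_nhds by blast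
  have "smooth_on (U \<inter> V) f" by (rule smooth_on_subset[OF U(1) open_Int[OF U(1) V(1)] Int_lower1 U(3)])
  then have "smooth_on (U \<inter> V) g" by (rule smooth_on_cong[OF open_Int[OF U(1) V(1)], rotated]) (use V in simp)
  then show ?thesis unfolding smooth_near_def using U V by (intro exI[of _ "U \<inter> V"]) auto
qed

lemma eq_near_refl: "eq_near p f f" by (simp add: eq_near_def)

lemma eq_near_sym: "eq_near p f g \<Longrightarrow> eq_near p g f" by (simp add: eq_near_def eq_commute)

lemma eq_near_trans: "eq_near p f g \<Longrightarrow> eq_near p g h \<Longrightarrow> eq_near p f h"
  unfolding eq_near_def by (erule (1) eventually_elim2) simp

lemma eq_near_at: "eq_near p f g \<Longrightarrow> f p = g p"
  unfolding eq_near_def by (rule eventually_nhds_x_imp_x)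

lemma eq_near_vf:
  assumes "eq_near p f g"
  shows "eq_near p (vf X f) (vf X g)"
proof -
  have "\<forall>\<^sub>F z in nhds p. \<forall>\<^sub>F y in nhds z. f y = g y" using assms unfolding eq_near_def eventually_eventually .
  then show ?thesis unfolding eq_near_def vf_def by eventually_elim (rule ct_apply_cong)
qed

lemma eq_near_vf_add:
  assumes "smooth_near p f" "smooth_near p g"
  shows "eq_near p (vf X (\<lambda>z. f z + g z)) (\<lambda>z. vf X f z + vf X g z)"
  using smooth_near_differentiable[OF assms(1)] smooth_near_differentiable[OF assms(2)]
  unfolding eq_near_def vf_def by eventually_elim (rule ct_apply_fun_add)

lemma eq_near_vf_mult:
  assumes "smooth_near p f" "smooth_near p g"
  shows "eq_near p (vf X (\<lambda>z. f z * g z)) (\<lambda>z. vf X f z * g z + f z * vf X g z)"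
  using smooth_near_differentiable[OF assms(1)] smooth_near_differentiable[OF assms(2)]
  unfolding eq_near_def vf_def by eventually_elim (simp add: ct_apply_fun_mult)

lemma eq_near_vf_cnj:
  assumes "smooth_near p f"
  shows "eq_near p (vf (\<lambda>q. ct_cnj (X q)) (\<lambda>z. cnj (f z))) (\<lambda>z. cnj (vf X f z))"
  using smooth_near_differentiable[OF assms] unfolding eq_near_def vf_def
  by eventually_elim (rule ct_apply_cnj)

lemma eq_near_vf_lie_bracket:
  assumes "smooth_near p X" "smooth_near p Y" "smooth_near p f"
  shows "eq_near p (vf (lie_bracket X Y) f) (\<lambda>z. vf X (vf Y f) z + - 1 * vf Y (vf X f) z)"
proof -
  obtain U where U: "open U" "p \<in> U" "smooth_on U X" "smooth_on U Y" "smooth_on U f"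
    using smooth_near3[OF assms] by (elim exE conjE)
  have "\<forall>z\<in>U. vf (lie_bracket X Y) f z = vf X (vf Y f) z + - 1 * vf Y (vf X f) z"
    using vf_lie_bracket[OF U(1) _ U(3-5)] by simp
  then show ?thesis unfolding eq_near_def eventually_nhds using U by (intro exI[of _ U]) simp
qed

text \<open>The head of the list acts first.\<close>
definition wd :: "(complex^'n \<Rightarrow> 'n::finite ctvec) list \<Rightarrow> (complex^'n \<Rightarrow> complex) \<Rightarrow> complex^'n \<Rightarrow> complex" where
  "wd w f = fold vf w f"

lemma wd_simps: "wd [] f = f" "wd (X # w) f = wd w (vf X f)"
  by (simp_all add: wd_def)

lemma eq_near_wd: "eq_near p f g \<Longrightarrow> eq_near p (wd w f) (wd w g)"
  by (induction w arbitrary: f g) (simp_all add: wd_simps eq_near_vf)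

lemma eq_near_wd_add:
  assumes "set w \<subseteq> Collect (smooth_near p)" "smooth_near p f" "smooth_near p g"
  shows "eq_near p (wd w (\<lambda>z. f z + g z)) (\<lambda>z. wd w f z + wd w g z)"
  using assms
proof (induction w arbitrary: f g)
  case (Cons X w)
  have X: "smooth_near p X" and w: "set w \<subseteq> Collect (smooth_near p)" using Cons.prems(1) by simp_all
  show ?case unfolding wd_simps
    by (rule eq_near_trans[OF eq_near_wd[OF eq_near_vf_add[OF Cons.prems(2,3)]]
          Cons.IH[OF w smooth_near_vf[OF X Cons.prems(2)] smooth_near_vf[OF X Cons.prems(3)]]])
qed (simp add: wd_simps eq_near_refl)

text \<open>By the Leibniz rule the letter that acts first falls on one of the two factors, which is
  the recursion of \<open>splits\<close>. This correspondence is the reason to let the head of the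
  list act first.\<close>

lemma wd_mult_at:
  assumes "set w \<subseteq> Collect (smooth_near p)" "smooth_near p f" "smooth_near p g"
  shows "wd w (\<lambda>z. f z * g z) p = shuffle_product (\<lambda>w. wd w f p) (\<lambda>w. wd w g p) w"
  using assms
proof (induction w arbitrary: f g)
  case Nil
  show ?case by (simp add: wd_simps shuffle_product_def)
next
  case (Cons X w)
  have X: "smooth_near p X" and w: "set w \<subseteq> Collect (smooth_near p)" using Cons.prems(1) by simp_all
  note f = Cons.prems(2) and g = Cons.prems(3)
  note Xf = smooth_near_vf[OF X f] and Xg = smooth_near_vf[OF X g]
  have "wd (X # w) (\<lambda>z. f z * g z) p = wd w (\<lambda>z. vf X f z * g z + f z * vf X g z) p"
    unfolding wd_simps by (rule eq_near_at[OF eq_near_wd[OF eq_near_vf_mult[OF f g]]])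
  also have "\<dots> = wd w (\<lambda>z. vf X f z * g z) p + wd w (\<lambda>z. f z * vf X g z) p"
    by (rule eq_near_at[OF eq_near_wd_add[OF w smooth_near_mult[OF Xf g] smooth_near_mult[OF f Xg]]])
  also have "\<dots> = shuffle_product (\<lambda>w. wd w f p) (\<lambda>w. wd w g p) (X # w)"
    unfolding Cons.IH[OF w Xf g] Cons.IH[OF w f Xg] shuffle_product_def
    by (simp add: wd_simps case_prod_unfold comp_def)
  finally show ?case .
qed

lemma eq_near_wd_cnj:
  assumes "set w \<subseteq> Collect (smooth_near p)" "smooth_near p f"
  shows "eq_near p (wd (map (\<lambda>X q. ct_cnj (X q)) w) (\<lambda>z. cnj (f z))) (\<lambda>z. cnj (wd w f z))"
  using assms
proof (induction w arbitrary: f)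
  case (Cons X w)
  have X: "smooth_near p X" and w: "set w \<subseteq> Collect (smooth_near p)" using Cons.prems(1) by simp_all
  show ?case unfolding list.map wd_simps
    by (rule eq_near_trans[OF eq_near_wd[OF eq_near_vf_cnj[OF Cons.prems(2)]]
          Cons.IH[OF w smooth_near_vf[OF X Cons.prems(2)]]])
qed (simp add: wd_simps eq_near_refl)

lemma vf_zero: "vf X (\<lambda>z. 0) = (\<lambda>z. 0)"
  by (simp add: vf_def fun_eq_iff ct_apply_const)

lemma wd_zero: "wd w (\<lambda>z. 0) = (\<lambda>z. 0)"
  by (induction w) (simp_all add: wd_simps vf_zero)

section \<open>Restriction of words to the submanifold\<close>

text \<open>Tangency is expressed by its effect on functions that vanish on \<open>M\<close>. This
  form passes directly to conjugate fields and applies to the difference of two functions that agree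
  on \<open>M\<close>.\<close>

definition tangential_near :: "(complex^'n::finite) set \<Rightarrow> complex^'n \<Rightarrow> (complex^'n \<Rightarrow> 'n ctvec) \<Rightarrow> bool" where
  "tangential_near M p X \<longleftrightarrow> smooth_near p X \<and> (\<forall>\<^sub>F z in nhds p. z \<in> M \<longrightarrow>
     (\<forall>f. f differentiable at z \<longrightarrow> (\<forall>\<^sub>F y in nhds z. y \<in> M \<longrightarrow> f y = 0) \<longrightarrow> ct_apply (X z) f z = 0))"

definition eq_on_near :: "'a::topological_space set \<Rightarrow> 'a \<Rightarrow> ('a \<Rightarrow> 'b) \<Rightarrow> ('a \<Rightarrow> 'b) \<Rightarrow> bool" where
  "eq_on_near M p f g \<longleftrightarrow> (\<forall>\<^sub>F z in nhds p. z \<in> M \<longrightarrow> f z = g z)"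

text \<open>A tangential field sees only the restriction of a function to \<open>M\<close>. The
  identities involving \<open>D\<close> hold on \<open>M\<close> only, and this carries them through
  words.\<close>

lemma eq_on_near_vf:
  assumes X: "tangential_near M p X" and f: "smooth_near p f" and g: "smooth_near p g"
    and eq: "eq_on_near M p f g"
  shows "eq_on_near M p (vf X f) (vf X g)"
proof -
  have 1: "\<forall>\<^sub>F z in nhds p. \<forall>\<^sub>F y in nhds z. y \<in> M \<longrightarrow> f y = g y"
    using eq unfolding eq_on_near_def eventually_eventually .
  have 2: "\<forall>\<^sub>F z in nhds p. z \<in> M \<longrightarrow>
     (\<forall>f. f differentiable at z \<longrightarrow> (\<forall>\<^sub>F y in nhds z. y \<in> M \<longrightarrow> f y = 0) \<longrightarrow> ct_apply (X z) f z = 0)"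
    using X by (simp add: tangential_near_def)
  show ?thesis unfolding eq_on_near_def
    using 1 2 smooth_near_differentiable[OF f] smooth_near_differentiable[OF g]
  proof eventually_elim
    case (elim z)
    show ?case
    proof
      assume z: "z \<in> M"
      have d: "(\<lambda>y. - 1 * g y) differentiable at z" using elim(4) by (intro differentiable_mult) simp_all
      have "\<forall>\<^sub>F y in nhds z. y \<in> M \<longrightarrow> f y + - 1 * g y = 0" using elim(1) by eventually_elim simp
      then have "ct_apply (X z) (\<lambda>y. f y + - 1 * g y) z = 0"
        using elim(2) z differentiable_add[OF elim(3) d] by blast
      then have "ct_apply (X z) f z + ct_apply (X z) (\<lambda>y. - 1 * g y) z = 0"
        unfolding ct_apply_fun_add[OF elim(3) d] .
      moreover have "ct_apply (X z) (\<lambda>y. - 1 * g y) z = - ct_apply (X z) g z"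
        using ct_apply_fun_mult[OF differentiable_const elim(4), of "X z" "-1"] by (simp add: ct_apply_const)
      ultimately show "vf X f z = vf X g z" by (simp add: vf_def)
    qed
  qed
qed

lemma eq_on_near_wd:
  assumes "set w \<subseteq> Collect (tangential_near M p)" "smooth_near p f" "smooth_near p g" "eq_on_near M p f g"
  shows "eq_on_near M p (wd w f) (wd w g)"
  using assms
proof (induction w arbitrary: f g)
  case (Cons X w)
  have X: "tangential_near M p X" and w: "set w \<subseteq> Collect (tangential_near M p)" using Cons.prems(1) by simp_all
  have sX: "smooth_near p X" using X by (simp add: tangential_near_def)
  show ?case unfolding wd_simps
    by (rule Cons.IH[OF w smooth_near_vf[OF sX Cons.prems(2)] smooth_near_vf[OF sX Cons.prems(3)]
          eq_on_near_vf[OF X Cons.prems(2-4)]])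
qed (simp add: wd_simps)

lemma eq_on_near_at: "eq_on_near M p f g \<Longrightarrow> p \<in> M \<Longrightarrow> f p = g p"
  unfolding eq_on_near_def using eventually_nhds_x_imp_x by fastforce

lemma smooth_near_ct_cnj:
  fixes X :: "'b::real_normed_vector \<Rightarrow> 'n::finite ctvec"
  assumes "smooth_near p X"
  shows "smooth_near p (\<lambda>q. ct_cnj (X q))"
proof -
  have "linear (ct_cnj :: 'n ctvec \<Rightarrow> _)"
    by (rule linearI) (simp_all add: ct_cnj_def vcnj_def vec_eq_iff prod_eq_iff)
  then have "bounded_linear (ct_cnj :: 'n ctvec \<Rightarrow> _)" by (simp add: linear_conv_bounded_linear)
  from smooth_near_bounded_linear[OF this assms] show ?thesis .
qed

lemma ct_cnj_ct_cnj: "ct_cnj (ct_cnj X) = X"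
  by (simp add: ct_cnj_def vcnj_def vec_eq_iff prod_eq_iff)

lemma cr_field_near_smooth: "cr_field_near M p X \<Longrightarrow> smooth_near p X"
  unfolding cr_field_near_def smooth_near_def by blast

lemma cr_field_near_T01: "cr_field_near M p X \<Longrightarrow> \<forall>\<^sub>F z in nhds p. z \<in> M \<longrightarrow> X z \<in> T01_of M z"
  unfolding cr_field_near_def eventually_nhds by blast

lemma cr_field_near_tangential:
  assumes "cr_field_near M p X"
  shows "tangential_near M p X" "tangential_near M p (\<lambda>q. ct_cnj (X q))"
proof -
  have X: "\<forall>\<^sub>F z in nhds p. z \<in> M \<longrightarrow> X z \<in> CT M z"
    using cr_field_near_T01[OF assms] by eventually_elim (simp add: T01_of_def)
  show "tangential_near M p X" unfolding tangential_near_def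
  proof
    show "\<forall>\<^sub>F z in nhds p. z \<in> M \<longrightarrow>
     (\<forall>f. f differentiable at z \<longrightarrow> (\<forall>\<^sub>F y in nhds z. y \<in> M \<longrightarrow> f y = 0) \<longrightarrow> ct_apply (X z) f z = 0)"
      using X by eventually_elim (use CT_ct_apply_eq_0 in blast)
  qed (rule cr_field_near_smooth[OF assms])
  show "tangential_near M p (\<lambda>q. ct_cnj (X q))" unfolding tangential_near_def
  proof
    show "\<forall>\<^sub>F z in nhds p. z \<in> M \<longrightarrow>
     (\<forall>f. f differentiable at z \<longrightarrow> (\<forall>\<^sub>F y in nhds z. y \<in> M \<longrightarrow> f y = 0) \<longrightarrow> ct_apply (ct_cnj (X z)) f z = 0)"
      using X
    proof eventually_elim
      case (elim z)
      show ?case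
      proof (intro impI allI)
        fix f :: "complex^'a \<Rightarrow> complex"
        assume z: "z \<in> M" and f: "f differentiable at z" and zero: "\<forall>\<^sub>F y in nhds z. y \<in> M \<longrightarrow> f y = 0"
        \<comment> \<open>The conjugate field applied to \<open>f\<close> is the conjugate of the
          field applied to \<open>cnj f\<close>, and \<open>cnj f\<close> vanishes on
          \<open>M\<close> as well.\<close>
        have fc: "(\<lambda>z. cnj (f z)) differentiable at z"
          using f bounded_linear.has_derivative[OF bounded_linear_cnj] unfolding differentiable_def by blast
        have "\<forall>\<^sub>F y in nhds z. y \<in> M \<longrightarrow> cnj (f y) = 0" using zero by eventually_elim simp
        then have "ct_apply (X z) (\<lambda>z. cnj (f z)) z = 0" by (rule CT_ct_apply_eq_0[OF elim[rule_format, OF z] fc])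
        then show "ct_apply (ct_cnj (X z)) f z = 0"
          using ct_apply_cnj[OF fc, of "X z"] by simp
      qed
    qed
  qed (rule smooth_near_ct_cnj[OF cr_field_near_smooth[OF assms]])
qed

section \<open>Functions on which all words vanish\<close>

definition cr_letters :: "(complex^'n::finite) set \<Rightarrow> complex^'n \<Rightarrow> (complex^'n \<Rightarrow> 'n ctvec) set" where
  "cr_letters M p = {X. cr_field_near M p X} \<union> (\<lambda>X q. ct_cnj (X q)) ` {X. cr_field_near M p X}"

lemma cr_letters_tangential: "cr_letters M p \<subseteq> Collect (tangential_near M p)"
  using cr_field_near_tangential by (auto simp: cr_letters_def)

lemma cr_letters_smooth: "cr_letters M p \<subseteq> Collect (smooth_near p)"
  using cr_letters_tangential[of M p] by (auto simp: tangential_near_def)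

text \<open>The kernel of the passage from smooth germs to words. It turns out to be an ideal stable
  under the generated Lie algebra.\<close>

definition flat_at :: "(complex^'n::finite) set \<Rightarrow> complex^'n \<Rightarrow> (complex^'n \<Rightarrow> complex) set" where
  "flat_at M p = {f. smooth_near p f \<and> (\<forall>w\<in>lists (cr_letters M p). wd w f p = 0)}"

lemma flat_at_smooth: "f \<in> flat_at M p \<Longrightarrow> smooth_near p f"
  by (simp add: flat_at_def)

lemma flat_at_wd: "f \<in> flat_at M p \<Longrightarrow> w \<in> lists (cr_letters M p) \<Longrightarrow> wd w f p = 0"
  unfolding flat_at_def by blast

lemma lists_cr_letters_smooth: "w \<in> lists (cr_letters M p) \<Longrightarrow> set w \<subseteq> Collect (smooth_near p)"
  using cr_letters_smooth[of M p] by (auto simp: in_lists_conv_set)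

lemma flat_atI:
  assumes "smooth_near p f" "\<And>w. w \<in> lists (cr_letters M p) \<Longrightarrow> wd w f p = 0"
  shows "f \<in> flat_at M p"
  unfolding flat_at_def using assms(1) by (auto intro: assms(2) simp del: in_lists_conv_set)

lemma flat_at_mult:
  assumes g: "smooth_near p g" and f: "f \<in> flat_at M p"
  shows "(\<lambda>z. g z * f z) \<in> flat_at M p"
proof (rule flat_atI)
  show "smooth_near p (\<lambda>z. g z * f z)" by (rule smooth_near_mult[OF g flat_at_smooth[OF f]])
  fix w assume w: "w \<in> lists (cr_letters M p)"
  show "wd w (\<lambda>z. g z * f z) p = 0"
    unfolding wd_mult_at[OF lists_cr_letters_smooth[OF w] g flat_at_smooth[OF f]]
    by (rule shuffle_product_zero_right[OF w]) (rule flat_at_wd[OF f])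
qed

lemma flat_at_add:
  assumes f: "f \<in> flat_at M p" and g: "g \<in> flat_at M p"
  shows "(\<lambda>z. f z + g z) \<in> flat_at M p"
proof (rule flat_atI)
  show "smooth_near p (\<lambda>z. f z + g z)" by (rule smooth_near_add[OF flat_at_smooth[OF f] flat_at_smooth[OF g]])
  fix w assume w: "w \<in> lists (cr_letters M p)"
  show "wd w (\<lambda>z. f z + g z) p = 0"
    using eq_near_at[OF eq_near_wd_add[OF lists_cr_letters_smooth[OF w] flat_at_smooth[OF f] flat_at_smooth[OF g]]]
      flat_at_wd[OF f w] flat_at_wd[OF g w] by simp
qed

lemma flat_at_cong:
  assumes f: "f \<in> flat_at M p" and eq: "eq_near p f g"
  shows "g \<in> flat_at M p"
proof (rule flat_atI)
  show "smooth_near p g" by (rule smooth_near_cong[OF flat_at_smooth[OF f] eq])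
  fix w assume w: "w \<in> lists (cr_letters M p)"
  show "wd w g p = 0" using eq_near_at[OF eq_near_wd[OF eq, of w]] flat_at_wd[OF f w] by simp
qed

lemma flat_at_zero: "(\<lambda>z. 0) \<in> flat_at M p"
  by (rule flat_atI) (simp_all add: smooth_near_const wd_zero)

lemma flat_at_sum:
  assumes "\<And>i. i \<in> I \<Longrightarrow> f i \<in> flat_at M p"
  shows "(\<lambda>z. \<Sum>i\<in>I. f i z) \<in> flat_at M p"
  using assms
proof (induction I rule: infinite_finite_induct)
  case (insert i I)
  have "(\<lambda>z. f i z + (\<Sum>i\<in>I. f i z)) \<in> flat_at M p" by (rule flat_at_add) (use insert in simp_all)
  then show ?case using insert by simp
qed (simp_all add: flat_at_zero)

lemma flat_at_letter:
  assumes X: "X \<in> cr_letters M p" and f: "f \<in> flat_at M p"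
  shows "vf X f \<in> flat_at M p"
proof (rule flat_atI)
  show "smooth_near p (vf X f)" by (rule smooth_near_vf[OF _ flat_at_smooth[OF f]]) (use X cr_letters_smooth in blast)
  fix w assume w: "w \<in> lists (cr_letters M p)"
  have "X # w \<in> lists (cr_letters M p)" using X w by simp
  from flat_at_wd[OF f this] show "wd w (vf X f) p = 0" by (simp add: wd_simps)
qed

lemma bounded_linear_ct_scale: "bounded_linear (ct_scale c :: 'n::finite ctvec \<Rightarrow> _)"
proof -
  have "linear (ct_scale c :: 'n ctvec \<Rightarrow> _)"
    by (rule linearI) (simp_all add: ct_scale_def vec_eq_iff prod_eq_iff distrib_left)
  then show ?thesis by (simp add: linear_conv_bounded_linear)
qed

text \<open>A letter prefixed to a word gives another word, so letters preserve flatness; sums,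
  multiples and commutators inherit this. Smoothness is carried through the induction because the
  commutator formula for the bracket relies on it.\<close>

lemma cr_lie_algebra_flat_at:
  assumes "Y \<in> cr_lie_algebra M p"
  shows "smooth_near p Y \<and> (\<forall>f\<in>flat_at M p. vf Y f \<in> flat_at M p)"
  using assms
proof induction
  case (cr X)
  have "X \<in> cr_letters M p" using cr by (simp add: cr_letters_def)
  then show ?case using cr_field_near_smooth[OF cr] flat_at_letter by blast
next
  case (cr_cnj X)
  have "(\<lambda>q. ct_cnj (X q)) \<in> cr_letters M p" unfolding cr_letters_def using cr_cnj by blast
  then show ?case using smooth_near_ct_cnj[OF cr_field_near_smooth[OF cr_cnj]] flat_at_letter by blast
next
  case (add X Y)
  have "vf (\<lambda>q. X q + Y q) f = (\<lambda>z. vf X f z + vf Y f z)" for f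
    by (simp add: vf_def fun_eq_iff ct_apply_add)
  moreover have "(\<lambda>z. vf X f z + vf Y f z) \<in> flat_at M p" if "f \<in> flat_at M p" for f
    by (rule flat_at_add) (use add.IH that in simp_all)
  ultimately show ?case using add.IH smooth_near_add[of p X Y] by simp
next
  case (scale X c)
  have "smooth_near p (\<lambda>q. ct_scale c (X q))"
    by (rule smooth_near_bounded_linear[OF bounded_linear_ct_scale]) (use scale.IH in simp)
  moreover have "vf (\<lambda>q. ct_scale c (X q)) f = (\<lambda>z. c * vf X f z)" for f
    by (simp add: vf_def fun_eq_iff ct_apply_scale)
  moreover have "(\<lambda>z. c * vf X f z) \<in> flat_at M p" if "f \<in> flat_at M p" for f
    by (rule flat_at_mult[OF smooth_near_const]) (use scale.IH that in simp)
  ultimately show ?case by simp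
next
  case (bracket X Y)
  have X: "smooth_near p X" and Y: "smooth_near p Y" using bracket.IH by simp_all
  have "vf (lie_bracket X Y) f \<in> flat_at M p" if f: "f \<in> flat_at M p" for f
  proof -
    have "vf X (vf Y f) \<in> flat_at M p" "vf Y (vf X f) \<in> flat_at M p" using f bracket.IH by simp_all
    then have "(\<lambda>z. vf X (vf Y f) z + - 1 * vf Y (vf X f) z) \<in> flat_at M p"
      by (intro flat_at_add flat_at_mult smooth_near_const)
    then show ?thesis
      by (rule flat_at_cong) (rule eq_near_sym[OF eq_near_vf_lie_bracket[OF X Y flat_at_smooth[OF f]]])
  qed
  then show ?case using smooth_near_lie_bracket[OF X Y] by simp
qed

lemma vf_hol_on:
  assumes "hol_on U f" "z \<in> U"
  shows "vf X f z = (\<Sum>j\<in>UNIV. fst (X z) $ j * d_z j f z)"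
  unfolding vf_def ct_apply_def by (simp add: hol_on_d_zbar[OF assms])

text \<open>The (1,0)-parts of suitable members of the Lie algebra form a frame, which expresses the
  complex partial derivatives of a holomorphic function.\<close>
lemma flat_at_d_z:
  fixes M :: "(complex^'n::finite) set"
  assumes ft: "finite_type_at M p" and gen: "\<And>b. \<exists>X\<in>CT M p. fst X = b"
    and U: "open U" "p \<in> U" and f: "hol_on U f" "f \<in> flat_at M p"
  shows "d_z j f \<in> flat_at M p"
proof -
  have "\<exists>Y\<in>cr_lie_algebra M p. fst (Y p) = axis i 1" for i :: 'n
  proof -
    obtain X where X: "X \<in> CT M p" "fst X = axis i 1" using gen by blast
    from X(1) have "X \<in> (\<lambda>X. X p) ` cr_lie_algebra M p" using ft by (simp add: finite_type_at_def)
    then show ?thesis using X(2) by blast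
  qed
  then obtain Y where Y: "\<And>i. Y i \<in> cr_lie_algebra M p" "\<And>i :: 'n. fst (Y i p) = axis i 1" by metis
  define A where "A z = (\<chi> i j. fst (Y i z) $ j)" for z
  have "\<exists>V. open V \<and> p \<in> V \<and> smooth_on V (Y i)" for i
    using cr_lie_algebra_flat_at[OF Y(1)[of i]] unfolding smooth_near_def by blast
  then obtain V where V: "\<And>i. open (V i)" "\<And>i. p \<in> V i" "\<And>i. smooth_on (V i) (Y i)" by metis
  define W0 where "W0 = U \<inter> (\<Inter>i. V i)"
  have "open W0" unfolding W0_def by (intro open_Int open_INT U(1) ballI V(1)) simp
  moreover have "p \<in> W0" using U(2) V(2) by (simp add: W0_def)
  ultimately have W0: "open W0" "p \<in> W0" by simp_all
  have "W0 \<subseteq> V i" for i by (auto simp: W0_def)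
  then have YW: "smooth_on W0 (Y i)" for i by (rule smooth_on_subset[OF V(1) W0(1) _ V(3)])
  have AW: "smooth_on W0 (\<lambda>z. A z $ i $ j)" for i j
    unfolding A_def vec_lambda_beta by (intro smooth_on_vec_nth smooth_on_fst W0(1) YW)
  have "A p = mat 1" unfolding A_def Y(2) by (simp add: vec_eq_iff mat_def axis_def)
  then have detp: "det (A p) \<noteq> 0" by simp
  let ?W = "W0 \<inter> (\<lambda>z. det (A z)) -` (- {0})"
  have W: "open ?W"
    by (rule continuous_open_preimage[OF smooth_on_continuous_on[OF smooth_on_det[OF W0(1) AW]] W0(1)]) auto
  have pW: "p \<in> ?W" using W0(2) detp by simp
  \<comment> \<open>The entry in row \<open>j\<close> and column \<open>i\<close> of the inverse
    matrix. As \<open>f\<close> is holomorphic, \<open>Y i\<close> acts on it through row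
    \<open>i\<close> of \<open>A\<close> alone, so these coefficients recover
    \<open>d_z j f\<close>; \<open>A p = mat 1\<close> secures invertibility near
    \<open>p\<close>.\<close>
  define c where "c i z = (matrix_inv (A z) *v axis i 1) $ j" for i z
  have "smooth_on ?W (c i)" for i
    unfolding c_def
    by (intro smooth_on_vec_nth smooth_on_matrix_inv_mult smooth_on_const W
        smooth_on_subset[OF W0(1) W Int_lower1 AW]) simp
  then have c: "smooth_near p (c i)" for i unfolding smooth_near_def using W pW by blast
  have eq: "(\<Sum>i\<in>UNIV. c i z * vf (Y i) f z) = d_z j f z" if z: "z \<in> ?W" for z
  proof -
    have zU: "z \<in> U" and det: "det (A z) \<noteq> 0" using z by (auto simp: W0_def)
    have ci: "c i z = matrix_inv (A z) $ j $ i" for i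
      unfolding c_def matrix_vector_mult_def vec_lambda_beta sum_mult_axis by simp
    have "A z *v (\<chi> j. d_z j f z) = (\<chi> i. vf (Y i) f z)"
      by (simp add: vec_eq_iff matrix_vector_mult_def A_def vf_hol_on[OF f(1) zU])
    then have "(matrix_inv (A z) *v (\<chi> i. vf (Y i) f z)) $ j = d_z j f z"
      using matrix_inv_mult(2)[OF det, of "\<chi> j. d_z j f z"] by simp
    then show ?thesis unfolding ci by (simp add: matrix_vector_mult_def)
  qed
  have "eq_near p (\<lambda>z. \<Sum>i\<in>UNIV. c i z * vf (Y i) f z) (d_z j f)"
    unfolding eq_near_def eventually_nhds using W pW eq by (intro exI[of _ ?W]) simp
  moreover have "(\<lambda>z. \<Sum>i\<in>UNIV. c i z * vf (Y i) f z) \<in> flat_at M p"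
    using cr_lie_algebra_flat_at[OF Y(1)] f(2) by (intro flat_at_sum flat_at_mult c) blast
  ultimately show ?thesis using flat_at_cong by blast
qed

text \<open>Holomorphic flat functions form a class closed under complex directional derivatives and
  vanishing at \<open>p\<close>, as \<open>hol_on_eq_zero\<close> requires. The empty word gives the
  vanishing at \<open>p\<close>.\<close>

lemma flat_at_holomorphic_eq_0:
  fixes M :: "(complex^'n::finite) set"
  assumes ft: "finite_type_at M p" and gen: "\<And>b. \<exists>X\<in>CT M p. fst X = b"
    and U: "open U" "p \<in> U" and f: "hol_on U f" "f \<in> flat_at M p"
  shows "\<forall>\<^sub>F z in nhds p. f z = 0"
proof -
  obtain r where r: "r > 0" "ball p r \<subseteq> U" using U open_contains_ball by blast
  have "f z = 0" if z: "z \<in> ball p r" for z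
  proof (rule hol_on_eq_zero[OF r(2), where P = "\<lambda>h. hol_on U h \<and> h \<in> flat_at M p"])
    fix h :: "complex^'n \<Rightarrow> complex" assume h: "hol_on U h \<and> h \<in> flat_at M p"
    show "hol_on U h" using h by simp
    show "h p = 0" using flat_at_wd[of h M p "[]"] h by (simp add: wd_simps)
    fix v :: "complex^'n"
    have "hol_on U (\<lambda>z. \<Sum>j\<in>UNIV. d_z j h z * v $ j)"
      using h by (intro hol_on_sum hol_on_mult hol_on_const hol_on_d_z U(1)) simp
    moreover have "(\<lambda>z. \<Sum>j\<in>UNIV. v $ j * d_z j h z) \<in> flat_at M p"
      using h by (intro flat_at_sum flat_at_mult smooth_near_const flat_at_d_z[OF ft gen U]) simp_all
    ultimately show "hol_on U (\<lambda>z. \<Sum>j\<in>UNIV. d_z j h z * v $ j) \<and> (\<lambda>z. \<Sum>j\<in>UNIV. d_z j h z * v $ j) \<in> flat_at M p"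
      by (simp add: mult.commute)
  qed (use f z in simp_all)
  then show ?thesis unfolding eventually_nhds using r(1) by (intro exI[of _ "ball p r"]) simp
qed

lemma wd_mult_on:
  assumes p: "p \<in> M" and w: "w \<in> lists (cr_letters M p)"
    and s: "smooth_near p f" "smooth_near p g" "smooth_near p h"
    and eq: "eq_on_near M p (\<lambda>z. f z * g z) h"
  shows "shuffle_product (\<lambda>w. wd w f p) (\<lambda>w. wd w g p) w = wd w h p"
proof -
  have "set w \<subseteq> Collect (tangential_near M p)" using w cr_letters_tangential[of M p] by (auto simp: in_lists_conv_set)
  then have "eq_on_near M p (wd w (\<lambda>z. f z * g z)) (wd w h)"
    by (rule eq_on_near_wd[OF _ smooth_near_mult[OF s(1,2)] s(3) eq])
  then show ?thesis
    using eq_on_near_at[OF _ p] wd_mult_at[OF lists_cr_letters_smooth[OF w] s(1,2)] by metis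
qed

text \<open>Acting first, \<open>X\<close> produces a function that is zero on \<open>M\<close>, and
  tangential letters keep it zero there.\<close>

lemma wd_Cons_eq_0:
  assumes p: "p \<in> M" and X: "tangential_near M p X" and w: "w \<in> lists (cr_letters M p)"
    and h: "smooth_near p h" and zero: "eq_on_near M p (vf X h) (\<lambda>z. 0)"
  shows "wd (X # w) h p = 0"
proof -
  have sX: "smooth_near p X" using X by (simp add: tangential_near_def)
  have "set w \<subseteq> Collect (tangential_near M p)" using w cr_letters_tangential[of M p] by (auto simp: in_lists_conv_set)
  then have "eq_on_near M p (wd w (vf X h)) (wd w (\<lambda>z. 0))"
    by (rule eq_on_near_wd[OF _ smooth_near_vf[OF sX h] smooth_near_const zero])
  from eq_on_near_at[OF this p] show ?thesis by (simp add: wd_simps wd_zero)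
qed

text \<open>\<open>D\<close> divides both the CR function \<open>J\<close> and its conjugate.\<close>
lemma real_divisor_of_holomorphic_nonzero:
  fixes M :: "(complex^'n::finite) set"
  assumes p: "p \<in> M" and ft: "finite_type_at M p" and gen: "\<And>b. \<exists>X\<in>CT M p. fst X = b"
    and U: "open U" "p \<in> U" and J: "hol_on U J" "\<exists>\<^sub>F z in nhds p. J z \<noteq> 0"
    and D: "smooth_near p D" and e: "smooth_near p e"
    and De: "eq_on_near M p (\<lambda>z. D z * e z) J" and real: "eq_on_near M p D (\<lambda>z. cnj (D z))"
  shows "D p \<noteq> 0"
proof -
  let ?c = "\<lambda>X q. ct_cnj (X q)"
  have sJ: "smooth_near p J" unfolding smooth_near_def using U hol_on_smooth_on[OF U(1) J(1)] by blast
  have "J \<notin> flat_at M p"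
  proof
    assume "J \<in> flat_at M p"
    then have "\<forall>\<^sub>F z in nhds p. J z = 0" by (rule flat_at_holomorphic_eq_0[OF ft gen U J(1)])
    then show False using J(2) by (simp add: frequently_def)
  qed
  then have "\<exists>w0. w0 \<in> lists (cr_letters M p) \<and> wd w0 J p \<noteq> 0"
    using flat_atI[OF sJ, of M] by metis
  then obtain w0 where w0: "w0 \<in> lists (cr_letters M p)" "wd w0 J p \<noteq> 0" by (elim exE conjE)
  \<comment> \<open>A finite alphabet closed under conjugation that still contains a word detecting
    \<open>J\<close>: the CR fields among the letters of \<open>w0\<close> and their conjugates form
    \<open>K1\<close>, and their conjugates form \<open>K2\<close>.\<close>
  define K1 where "K1 = {X \<in> set w0 \<union> ?c ` set w0. cr_field_near M p X}"
  define K2 where "K2 = ?c ` K1"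
  have cc: "?c (?c X) = X" for X :: "complex^'n \<Rightarrow> 'n ctvec" by (simp add: ct_cnj_ct_cnj)
  have fin: "finite (K1 \<union> K2)" by (simp add: K1_def K2_def)
  have K1cr: "cr_field_near M p X" if "X \<in> K1" for X using that by (simp add: K1_def)
  have sub: "K1 \<union> K2 \<subseteq> cr_letters M p" unfolding cr_letters_def K2_def using K1cr by blast
  have w0K: "set w0 \<subseteq> K1 \<union> K2"
  proof
    fix X assume X: "X \<in> set w0"
    then have "X \<in> cr_letters M p" using w0(1) by auto
    then consider "cr_field_near M p X" | Y where "cr_field_near M p Y" "X = ?c Y"
      unfolding cr_letters_def by blast
    then show "X \<in> K1 \<union> K2"
    proof cases
      case 1
      then show ?thesis using X by (simp add: K1_def)
    next
      case 2
      have "Y \<in> ?c ` set w0" using X 2(2) cc[of Y] by (metis imageI)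
      then have "Y \<in> K1" using 2(1) by (simp add: K1_def)
      then show ?thesis unfolding K2_def 2(2) by blast
    qed
  qed
  have c_inv: "?c X \<in> K1 \<union> K2" if "X \<in> K1 \<union> K2" for X
  proof (cases "X \<in> K1")
    case True
    then show ?thesis unfolding K2_def by blast
  next
    case False
    then have "X \<in> ?c ` K1" using that False unfolding K2_def by simp
    then obtain Y where Y: "Y \<in> K1" "X = ?c Y" by (rule imageE)
    then show ?thesis by (simp add: ct_cnj_ct_cnj)
  qed
  have lists_sub: "w \<in> lists (cr_letters M p)" if "w \<in> lists (K1 \<union> K2)" for w
    using that lists_mono[OF sub] by blast
  have sJc: "smooth_near p (\<lambda>z. cnj (J z))" and sec: "smooth_near p (\<lambda>z. cnj (e z))"
    by (rule smooth_near_cnj[OF sJ], rule smooth_near_cnj[OF e])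
  have Dec: "eq_on_near M p (\<lambda>z. D z * cnj (e z)) (\<lambda>z. cnj (J z))"
    \<comment> \<open>Conjugating \<open>D e = J\<close> leaves \<open>D\<close> in place because it
      is real on \<open>M\<close>.\<close>
    using De real unfolding eq_on_near_def by eventually_elim (metis complex_cnj_mult)
  have killJ: "eq_on_near M p (vf X J) (\<lambda>z. 0)" if X: "cr_field_near M p X" for X
  proof -
    have "\<forall>\<^sub>F z in nhds p. z \<in> U" using U eventually_nhds by blast
    then show ?thesis using cr_field_near_T01[OF X] unfolding eq_on_near_def
    proof eventually_elim
      case (elim z)
      show ?case
      proof
        assume "z \<in> M"
        then have "fst (X z) = 0" using elim(2) by (simp add: T01_of_def T01_def)
        then show "vf X J z = 0" by (simp add: vf_hol_on[OF J(1) elim(1)])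
      qed
    qed
  qed
  have killJc: "eq_on_near M p (vf (?c X) (\<lambda>z. cnj (J z))) (\<lambda>z. 0)" if X: "cr_field_near M p X" for X
    using killJ[OF X] eq_near_vf_cnj[OF sJ, of X] unfolding eq_on_near_def eq_near_def
    by eventually_elim simp
  \<comment> \<open>The conjugate word detects \<open>cnj J\<close>, which provides the nonzero
    coefficient of the second product.\<close>
  let ?w1 = "map ?c w0"
  have "(\<lambda>w. wd w D p) [] \<noteq> 0"
  proof (rule shuffle_product_unit[OF fin, where g = "\<lambda>w. wd w e p" and h = "\<lambda>w. wd w (\<lambda>z. cnj (e z)) p"])
    fix X w assume X: "X \<in> K1" and w: "w \<in> lists (K1 \<union> K2)"
    have "X # w \<in> lists (K1 \<union> K2)" using X w by simp
    then have "shuffle_product (\<lambda>w. wd w D p) (\<lambda>w. wd w e p) (X # w) = wd (X # w) J p"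
      by (rule wd_mult_on[OF p lists_sub D e sJ De])
    also have "\<dots> = 0"
      by (rule wd_Cons_eq_0[OF p cr_field_near_tangential(1)[OF K1cr[OF X]] lists_sub[OF w] sJ killJ[OF K1cr[OF X]]])
    finally show "shuffle_product (\<lambda>w. wd w D p) (\<lambda>w. wd w e p) (X # w) = 0" .
  next
    fix X w assume X: "X \<in> K2" and w: "w \<in> lists (K1 \<union> K2)"
    obtain Y where Y: "Y \<in> K1" "X = ?c Y" using X unfolding K2_def by (rule imageE)
    have "X # w \<in> lists (K1 \<union> K2)" using X w by simp
    then have "shuffle_product (\<lambda>w. wd w D p) (\<lambda>w. wd w (\<lambda>z. cnj (e z)) p) (X # w) = wd (X # w) (\<lambda>z. cnj (J z)) p"
      by (rule wd_mult_on[OF p lists_sub D sec sJc Dec])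
    also have "\<dots> = 0" unfolding Y(2)
      by (rule wd_Cons_eq_0[OF p cr_field_near_tangential(2)[OF K1cr[OF Y(1)]] lists_sub[OF w] sJc killJc[OF K1cr[OF Y(1)]]])
    finally show "shuffle_product (\<lambda>w. wd w D p) (\<lambda>w. wd w (\<lambda>z. cnj (e z)) p) (X # w) = 0" .
  next
    show w0': "w0 \<in> lists (K1 \<union> K2)" using w0K by (simp add: in_lists_conv_set subset_iff)
    show "shuffle_product (\<lambda>w. wd w D p) (\<lambda>w. wd w e p) w0 \<noteq> 0"
      unfolding wd_mult_on[OF p w0(1) D e sJ De] by (rule w0(2))
    show w1: "?w1 \<in> lists (K1 \<union> K2)" using w0K c_inv by (auto simp: in_lists_conv_set)
    have "wd ?w1 (\<lambda>z. cnj (J z)) p = cnj (wd w0 J p)"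
      by (rule eq_near_at[OF eq_near_wd_cnj[OF lists_cr_letters_smooth[OF w0(1)] sJ]])
    then show "shuffle_product (\<lambda>w. wd w D p) (\<lambda>w. wd w (\<lambda>z. cnj (e z)) p) ?w1 \<noteq> 0"
      unfolding wd_mult_on[OF p lists_sub[OF w1] D sec sJc Dec] using w0(2) by simp
  qed
  then show ?thesis by (simp add: wd_simps)
qed

section \<open>CR transversality\<close>

lemma holomorphic_map_on_component:
  assumes "holomorphic_map_on U H"
  shows "hol_on U (\<lambda>z. H z $ i)"
  unfolding hol_on_def
proof
  fix z assume "z \<in> U"
  then obtain A where A: "(H has_derivative (\<lambda>v. A *v v)) (at z)"
    using assms unfolding holomorphic_map_on_def by blast
  have "((\<lambda>z. H z $ i) has_derivative (\<lambda>v. (A *v v) $ i)) (at z)"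
    by (rule bounded_linear.has_derivative[OF bounded_linear_vec_nth A])
  then show "\<exists>a::complex^'a. ((\<lambda>z. H z $ i) has_derivative (\<lambda>v. \<Sum>j\<in>UNIV. a $ j * v $ j)) (at z)"
    by (intro exI[of _ "A $ i"]) (simp add: matrix_vector_mult_def)
qed

definition hol_jacobian :: "(complex^'n::finite \<Rightarrow> complex^'m::finite) \<Rightarrow> complex^'n \<Rightarrow> complex^'n^'m" where
  "hol_jacobian H z = (\<chi> i j. d_z j (\<lambda>w. H w $ i) z)"

lemma holomorphic_map_on_has_derivative:
  assumes "holomorphic_map_on U H" "z \<in> U"
  shows "(H has_derivative (\<lambda>v. hol_jacobian H z *v v)) (at z)"
proof -
  obtain A where A: "(H has_derivative (\<lambda>v. A *v v)) (at z)"
    using assms unfolding holomorphic_map_on_def by blast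
  have "((\<lambda>z. H z $ i) has_derivative (\<lambda>v. \<Sum>j\<in>UNIV. A $ i $ j * v $ j)) (at z)" for i
    using bounded_linear.has_derivative[OF bounded_linear_vec_nth A, of i] by (simp add: matrix_vector_mult_def)
  from d_z_eqI(1)[OF this] have "hol_jacobian H z = A" by (simp add: hol_jacobian_def vec_eq_iff)
  with A show ?thesis by simp
qed

lemma ct_diff_T10:
  assumes "holomorphic_map_on U H" "z \<in> U"
  shows "ct_diff H z (b, 0) = (hol_jacobian H z *v b, 0)"
proof -
  note hol = holomorphic_map_on_component[OF assms(1)]
  have diff: "(\<lambda>z. H z $ i) differentiable at z" for i
    using hol_on_has_derivative[OF hol assms(2)] unfolding differentiable_def by blast
  have "ct_apply (b, 0) (\<lambda>z. H z $ i) z = (hol_jacobian H z *v b) $ i" for i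
    by (simp add: ct_apply_def hol_jacobian_def matrix_vector_mult_def mult.commute)
  moreover have "ct_apply (b, 0) (\<lambda>z. cnj (H z $ i)) z = 0" for i
    by (simp add: ct_apply_def d_z_cnj[OF diff] hol_on_d_zbar[OF hol assms(2)])
  ultimately show ?thesis by (simp add: ct_diff_def vec_eq_iff)
qed

lemma cnj_det: "cnj (det A) = det (\<chi> i j. cnj (A $ i $ j))"
  by (simp add: det_def)

lemma matrix_vector_mult_axis: "(A *v axis j c) $ i = A $ i $ j * (c::complex)"
  unfolding matrix_vector_mult_def by (simp add: sum_mult_axis)

lemma det_matrix_inv:
  fixes A :: "complex^'n::finite^'n"
  assumes "det A \<noteq> 0"
  shows "det (matrix_inv A) = inverse (det A)"
proof -
  have "det A * det (matrix_inv A) = 1"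
    using det_mul[of A "matrix_inv A"] by (simp add: matrix_mul_matrix_inv(1)[OF assms])
  then show ?thesis using assms by (simp add: field_simps)
qed

text \<open>A holomorphic map sends (1,0) vectors to (1,0) vectors through its complex Jacobian
  matrix, so transversality amounts to splitting every coordinate vector \<open>w\<close>.\<close>

lemma cr_transversal_atI:
  assumes H: "holomorphic_map_on U H" "p \<in> U"
    and split: "\<And>w. \<exists>b. (w - hol_jacobian H p *v b, 0) \<in> T10_of M' (H p)"
  shows "cr_transversal_at H M' p"
  unfolding cr_transversal_at_def
proof
  show "{X + Y |X Y. X \<in> T10_of M' (H p) \<and> Y \<in> ct_diff H p ` T10} \<subseteq> T10"
  proof
    fix Z assume "Z \<in> {X + Y |X Y. X \<in> T10_of M' (H p) \<and> Y \<in> ct_diff H p ` T10}"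
    then obtain X Y where Z: "Z = X + ct_diff H p Y" and X: "X \<in> T10_of M' (H p)" and Y: "Y \<in> T10" by blast
    have "Y = (fst Y, 0)" using Y by (simp add: T10_def prod_eq_iff)
    then have "ct_diff H p Y = (hol_jacobian H p *v fst Y, 0)" using ct_diff_T10[OF H, of "fst Y"] by simp
    then have "snd (ct_diff H p Y) = 0" by simp
    moreover have "snd X = 0" using subsetD[OF T10_of_subset X] by (simp add: T10_def)
    ultimately show "Z \<in> T10" by (simp add: Z T10_def)
  qed
  show "T10 \<subseteq> {X + Y |X Y. X \<in> T10_of M' (H p) \<and> Y \<in> ct_diff H p ` T10}"
  proof
    fix Z :: "'a ctvec" assume Z: "Z \<in> T10"
    obtain b where b: "(fst Z - hol_jacobian H p *v b, 0) \<in> T10_of M' (H p)" using split by blast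
    have "(b, 0) \<in> T10" by (simp add: T10_def)
    moreover have "Z = (fst Z - hol_jacobian H p *v b, 0) + ct_diff H p (b, 0)"
      using Z by (simp add: ct_diff_T10[OF H] T10_def prod_eq_iff)
    ultimately show "Z \<in> {X + Y |X Y. X \<in> T10_of M' (H p) \<and> Y \<in> ct_diff H p ` T10}" using b by blast
  qed
qed

text \<open>The rows in \<open>S\<close> of the matrix of \<open>dH\<close> with respect to the two moving frames express the
  pullbacks of the characteristic forms \<open>\<i>\<partial>\<sigma>'\<^sub>i\<close> of \<open>M'\<close>, which are real, by those of \<open>M\<close>.\<close>
lemma frame_matrix_rows:
  fixes H :: "complex^'n::finite \<Rightarrow> complex^'n"
  assumes fr: "adapted_frame M U S \<sigma> B" and fr': "adapted_frame M' U' S \<sigma>' B'"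
    and H: "holomorphic_map_on V H" "z \<in> V" and z: "z \<in> M \<inter> U" and Hz: "H z \<in> U'"
    and maps: "\<forall>\<^sub>F y in nhds z. y \<in> M \<longrightarrow> H y \<in> M' \<inter> U'"
    and i: "i \<in> S"
    and G: "G = frame S \<sigma>' B' (H z) ** hol_jacobian H z ** matrix_inv (frame S \<sigma> B z)"
  shows "j \<notin> S \<Longrightarrow> G $ i $ j = 0" and "cnj (G $ i $ j) = G $ i $ j"
proof -
  have det: "det (frame S \<sigma> B z) \<noteq> 0" using fr z by (simp add: adapted_frame_def)
  have U': "open U'" "smooth_on U' (\<sigma>' i)" and MU': "M' \<inter> U' = {z \<in> U'. \<forall>j\<in>S. \<sigma>' j z = 0}"
    using fr' i by (simp_all add: adapted_frame_def)
  have d\<sigma>: "\<sigma>' i differentiable at (H z)" by (rule smooth_on_differentiable[OF U' Hz])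
  have key: "Re ((G *v u) $ i) = 0" if u: "\<And>k. k \<in> S \<Longrightarrow> Re (u $ k) = 0" for u
  proof -
    \<comment> \<open>The vector with coordinates \<open>u\<close> is tangent to \<open>M\<close>,
      and \<open>\<sigma>' i\<close> composed with \<open>H\<close> vanishes on \<open>M\<close>, so
      its differential kills this vector.\<close>
    let ?v = "matrix_inv (frame S \<sigma> B z) *v u"
    have "?v \<in> tangent_space M z"
      by (rule tangent_spaceI[OF fr z]) (simp add: matrix_inv_mult[OF det] u)
    moreover have d: "((\<lambda>y. \<sigma>' i (H y)) has_derivative
        (\<lambda>v. frechet_derivative (\<sigma>' i) (at (H z)) (hol_jacobian H z *v v))) (at z)"
      by (rule has_derivative_compose[OF holomorphic_map_on_has_derivative[OF H] d\<sigma>[unfolded frechet_derivative_works]])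
    moreover have "\<forall>\<^sub>F y in nhds z. y \<in> M \<longrightarrow> \<sigma>' i (H y) = 0"
      using maps by eventually_elim (use MU' i in blast)
    ultimately have "frechet_derivative (\<lambda>y. \<sigma>' i (H y)) (at z) ?v = 0"
      by (intro tangent_space_frechet_derivative_eq_0[where M = M]) (auto simp: differentiable_def)
    then have "frechet_derivative (\<sigma>' i) (at (H z)) (hol_jacobian H z *v ?v) = 0"
      unfolding frechet_derivative_at[OF d, symmetric] .
    then have "Re ((frame S \<sigma>' B' (H z) *v (hol_jacobian H z *v ?v)) $ i) = 0"
      unfolding frechet_derivative_frame[where \<sigma> = \<sigma>' and j = i and S = S and B = B', OF d\<sigma> i] by simp
    then show ?thesis unfolding G by (simp add: matrix_vector_mul_assoc matrix_mul_assoc)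
  qed
  show zero: "G $ i $ j = 0" if j: "j \<notin> S" for j
  proof -
    \<comment> \<open>For \<open>j\<close> outside \<open>S\<close> every complex multiple of the
      basis vector is allowed, so the whole entry vanishes.\<close>
    have "Re ((G *v axis j c) $ i) = 0" for c by (rule key) (use j in \<open>auto simp: axis_def\<close>)
    then have "Re (G $ i $ j * c) = 0" for c unfolding matrix_vector_mult_axis .
    from this[of 1] this[of \<i>] show ?thesis by (simp add: complex_eq_iff)
  qed
  \<comment> \<open>The imaginary multiple is allowed for every \<open>j\<close> and annihilates the
    imaginary part of the entry.\<close>
  have "Re ((G *v axis j \<i>) $ i) = 0" by (rule key) (auto simp: axis_def)
  then have "Im (G $ i $ j) = 0" unfolding matrix_vector_mult_axis by simp
  then show "cnj (G $ i $ j) = G $ i $ j" by (simp add: complex_eq_iff)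
qed

theorem theorem1p1:
  fixes M M' :: "(complex^'n::finite) set"
    and H :: "complex^'n \<Rightarrow> complex^'n"
    and p p' :: "complex^'n"
    and d :: nat
  assumes "generic_submanifold d M" and "generic_submanifold d M'"
    and "p \<in> M" and "p' \<in> M'"
    and "open U" and "p \<in> U" and "holomorphic_map_on U H" and "H p = p'"
    and "\<forall>\<^sub>F z in nhds p. z \<in> M \<longrightarrow> H z \<in> M'"
    and "finite_type_at M p"
    and "\<exists>\<^sub>F z in nhds p. Jac H z \<noteq> 0"
  shows "cr_transversal_at H M' p"
proof -
  note H = assms(7)
  \<comment> \<open>Equal codimension allows one index set for both coframes, so that the blocks of
    \<open>G\<close> line up and the block in \<open>S\<close> is square.\<close>
  obtain S :: "'n set" where S: "card S = d"
    using obtain_subset_with_card_n[OF generic_submanifold_codim_le[OF assms(1,3)]] by metis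
  obtain U0 \<sigma> B where pU0: "p \<in> U0" and fr: "adapted_frame M U0 S \<sigma> B"
    using adapted_frame_exists[OF assms(1,3) S] by (elim exE conjE)
  obtain U1 \<sigma>' B' where pU1: "p' \<in> U1" and fr': "adapted_frame M' U1 S \<sigma>' B'"
    using adapted_frame_exists[OF assms(2,4) S] by (elim exE conjE)
  have oU0: "open U0" and \<sigma>: "\<And>j. j \<in> S \<Longrightarrow> smooth_on U0 (\<sigma> j)" and det0: "\<And>z. z \<in> U0 \<Longrightarrow> det (frame S \<sigma> B z) \<noteq> 0"
    using fr by (simp_all add: adapted_frame_def)
  have oU1: "open U1" and \<sigma>': "\<And>j. j \<in> S \<Longrightarrow> smooth_on U1 (\<sigma>' j)" and det1: "\<And>z. z \<in> U1 \<Longrightarrow> det (frame S \<sigma>' B' z) \<noteq> 0"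
    using fr' by (simp_all add: adapted_frame_def)
  have holH: "hol_on U (\<lambda>z. H z $ i)" for i by (rule holomorphic_map_on_component[OF H])
  have "smooth_on U (\<lambda>z. \<chi> i. H z $ i)"
    by (rule smooth_on_vec_lambda[OF assms(5) hol_on_smooth_on[OF assms(5) holH]])
  then have smH: "smooth_on U H" by simp
  obtain V where V: "open V" "p \<in> V" "\<And>z. z \<in> V \<Longrightarrow> z \<in> M \<Longrightarrow> H z \<in> M'"
    using assms(9) unfolding eventually_nhds by blast
  define W where "W = (U \<inter> H -` U1) \<inter> (U0 \<inter> V)"
  have oW: "open W" unfolding W_def
    by (intro open_Int oU0 V(1) continuous_open_preimage[OF smooth_on_continuous_on[OF smH] assms(5) oU1])
  have pW: "p \<in> W" using pU0 pU1 V(2) assms(6,8) by (simp add: W_def)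
  have WU: "W \<subseteq> U" and WU0: "W \<subseteq> U0" and WU1: "H ` W \<subseteq> U1" and WV: "W \<subseteq> V" by (auto simp: W_def)
  define R where "R = frame S \<sigma> B"
  define P where "P z = frame S \<sigma>' B' (H z)" for z
  define G where "G z = P z ** hol_jacobian H z ** matrix_inv (R z)" for z
  have smHW: "smooth_on W H" by (rule smooth_on_subset[OF assms(5) oW WU smH])
  have smR: "smooth_on W (\<lambda>z. R z $ i $ j)" for i j
    unfolding R_def by (rule smooth_on_subset[OF oU0 oW WU0 smooth_on_frame[OF oU0 \<sigma>]])
  have smP: "smooth_on W (\<lambda>z. P z $ i $ j)" for i j
    unfolding P_def by (rule smooth_on_compose[OF oW oU1 WU1 smHW smooth_on_frame[OF oU1 \<sigma>']])
  have detR: "det (R z) \<noteq> 0" and detP: "det (P z) \<noteq> 0" if "z \<in> W" for z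
    using that det0 det1 WU0 WU1 by (auto simp: R_def P_def)
  have smJ: "smooth_on W (\<lambda>z. hol_jacobian H z $ i $ j)" for i j
    using smooth_on_subset[OF assms(5) oW WU hol_on_smooth_on[OF assms(5) hol_on_d_z[OF assms(5) holH]]]
    by (simp add: hol_jacobian_def)
  have smRi: "smooth_on W (\<lambda>z. matrix_inv (R z) $ i $ j)" for i j
  proof -
    have "smooth_on W (\<lambda>z. (matrix_inv (R z) *v axis j 1) $ i)"
      by (intro smooth_on_vec_nth smooth_on_matrix_inv_mult smooth_on_const oW smR detR)
    then show ?thesis by (simp add: matrix_vector_mult_axis)
  qed
  have smG: "smooth_on W (\<lambda>z. G z $ i $ j)" for i j
    unfolding G_def matrix_matrix_mult_def vec_lambda_beta
    by (intro smooth_on_sum smooth_on_mult oW smP smJ smRi)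
  \<comment> \<open>On \<open>M\<close> the rows of \<open>G\<close> in \<open>S\<close> vanish
    outside \<open>S\<close>, so \<open>G\<close> factors as \<open>A ** C\<close> there:
    \<open>A\<close> carries these rows padded by the identity, and \<open>C\<close> the remaining
    rows.\<close>
  define A where "A z = (\<chi> i j. if i \<in> S then G z $ i $ j else if i = j then 1 else 0)" for z
  define C where "C z = (\<chi> i j. if i \<in> S then if i = j then 1 else 0 else G z $ i $ j)" for z
  define D where "D z = det (A z)" for z
  \<comment> \<open>Solves \<open>D z * det (C z) = det (P z) * Jac H z / det (R z)\<close> for the
    cofactor of \<open>D\<close> in \<open>Jac H\<close>.\<close>
  define e where "e z = det (C z) * det (R z) / det (P z)" for z
  have smA: "smooth_on W (\<lambda>z. A z $ i $ j)" for i j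
    using smG[of i j] smooth_on_const[OF oW, of "0::complex"] smooth_on_const[OF oW, of "1::complex"]
    by (cases "i \<in> S"; cases "i = j") (simp_all add: A_def)
  have smC: "smooth_on W (\<lambda>z. C z $ i $ j)" for i j
    using smG[of i j] smooth_on_const[OF oW, of "0::complex"] smooth_on_const[OF oW, of "1::complex"]
    by (cases "i \<in> S"; cases "i = j") (simp_all add: C_def)
  have smD: "smooth_near p D" unfolding smooth_near_def D_def[abs_def]
    using smooth_on_det[OF oW smA] oW pW by blast
  have "smooth_on W e" unfolding e_def[abs_def]
    by (intro smooth_on_divide smooth_on_mult smooth_on_det oW smC smR smP detP)
  then have sme: "smooth_near p e" unfolding smooth_near_def using oW pW by blast
  have rows: "j \<notin> S \<Longrightarrow> G z $ i $ j = 0" "cnj (G z $ i $ j) = G z $ i $ j"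
    if z: "z \<in> W" "z \<in> M" and i: "i \<in> S" for z i j
  proof -
    have zU: "z \<in> U" and zM: "z \<in> M \<inter> U0" and Hz: "H z \<in> U1" using z WU WU0 WU1 by auto
    have maps: "\<forall>\<^sub>F y in nhds z. y \<in> M \<longrightarrow> H y \<in> M' \<inter> U1"
      unfolding eventually_nhds using oW z(1) WV WU1 V(3) by (intro exI[of _ W]) blast
    note fm = frame_matrix_rows[OF fr fr' H zU zM Hz maps i, of "G z" j]
    show "j \<notin> S \<Longrightarrow> G z $ i $ j = 0" by (rule fm(1)) (simp_all add: G_def P_def R_def)
    show "cnj (G z $ i $ j) = G z $ i $ j" by (rule fm(2)) (simp add: G_def P_def R_def)
  qed
  have De: "D z * e z = Jac H z" if z: "z \<in> W" "z \<in> M" for z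
  proof -
    have "A z ** C z = G z"
    proof (simp only: vec_eq_iff, intro allI)
      fix i j
      show "(A z ** C z) $ i $ j = G z $ i $ j"
      proof (cases "i \<in> S")
        case True
        have "(\<Sum>k\<in>UNIV. A z $ i $ k * C z $ k $ j) = (\<Sum>k\<in>UNIV. if k = j then G z $ i $ j else 0)"
        proof (rule sum.cong[OF refl])
          fix k
          show "A z $ i $ k * C z $ k $ j = (if k = j then G z $ i $ j else 0)"
            using True rows(1)[OF z True, of k] by (cases "k \<in> S") (auto simp: A_def C_def)
        qed
        then show ?thesis by (simp add: matrix_matrix_mult_def)
      next
        case False
        have "(\<Sum>k\<in>UNIV. A z $ i $ k * C z $ k $ j) = (\<Sum>k\<in>UNIV. if k = i then C z $ i $ j else 0)"
          by (rule sum.cong) (use False in \<open>auto simp: A_def\<close>)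
        then show ?thesis using False by (simp add: matrix_matrix_mult_def C_def)
      qed
    qed
    then have "D z * det (C z) = det (P z) * det (hol_jacobian H z) * inverse (det (R z))"
      using det_mul[of "A z" "C z"] by (simp add: D_def G_def det_mul det_matrix_inv[OF detR[OF z(1)]])
    moreover have "D z * e z = D z * det (C z) * det (R z) / det (P z)" by (simp add: e_def)
    ultimately have "D z * e z = det (P z) * det (hol_jacobian H z) * inverse (det (R z)) * det (R z) / det (P z)"
      by simp
    also have "\<dots> = det (hol_jacobian H z)" using detR[OF z(1)] detP[OF z(1)] by simp
    finally show ?thesis by (simp add: Jac_def hol_jacobian_def)
  qed
  have real: "D z = cnj (D z)" if z: "z \<in> W" "z \<in> M" for z
  proof -
    have "cnj (A z $ i $ j) = A z $ i $ j" for i j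
      using rows(2)[OF z, of i j] by (simp add: A_def)
    then show ?thesis by (simp add: D_def cnj_det)
  qed
  have evW: "\<forall>\<^sub>F z in nhds p. z \<in> W" using oW pW eventually_nhds by blast
  have "D p \<noteq> 0"
  proof (rule real_divisor_of_holomorphic_nonzero[OF assms(3,10) _ assms(5,6) _ assms(11) smD sme])
    show "\<exists>X\<in>CT M p. fst X = b" for b by (rule fst_CT[OF fr]) (use assms(3) pU0 in simp)
    have "hol_on U (\<lambda>z. det (hol_jacobian H z))"
      by (rule hol_on_det) (simp add: hol_jacobian_def hol_on_d_z[OF assms(5) holH])
    then show "hol_on U (Jac H)" by (simp add: Jac_def[abs_def] hol_jacobian_def)
    show "eq_on_near M p (\<lambda>z. D z * e z) (Jac H)"
      unfolding eq_on_near_def using evW by eventually_elim (use De in blast)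
    show "eq_on_near M p D (\<lambda>z. cnj (D z))"
      unfolding eq_on_near_def using evW by eventually_elim (use real in blast)
  qed
  then have detA: "det (A p) \<noteq> 0" by (simp add: D_def)
  show ?thesis
  proof (rule cr_transversal_atI[OF H assms(6)])
    fix w :: "complex^'n"
    \<comment> \<open>The rows of \<open>G p\<close> and \<open>A p\<close> with index in
      \<open>S\<close> agree, so solving with \<open>A p\<close> yields a \<open>b\<close> whose
      image under the Jacobian has the same coordinates in \<open>S\<close> as \<open>w\<close>; the
      difference is then of type (1,0) along \<open>M'\<close>.\<close>
    define y where "y = matrix_inv (A p) *v (P p *v w)"
    define b where "b = matrix_inv (R p) *v y"
    have "(frame S \<sigma>' B' (H p) *v (w - hol_jacobian H p *v b)) $ i = 0" if i: "i \<in> S" for i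
    proof -
      have "(P p *v (hol_jacobian H p *v b)) $ i = (G p *v y) $ i"
        by (simp add: G_def b_def matrix_vector_mul_assoc matrix_mul_assoc)
      also have "\<dots> = (A p *v y) $ i" using i by (simp add: A_def matrix_vector_mult_def)
      also have "\<dots> = (P p *v w) $ i" by (simp add: y_def matrix_inv_mult[OF detA])
      finally show ?thesis by (simp add: P_def matrix_vector_mult_diff_distrib)
    qed
    then have "(w - hol_jacobian H p *v b, 0) \<in> T10_of M' (H p)"
      using assms(4,8) pU1 by (intro T10_ofI[OF fr']) simp_all
    then show "\<exists>b. (w - hol_jacobian H p *v b, 0) \<in> T10_of M' (H p)" ..
  qed
qed

end
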